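(* There exist $\mu>0$ (sufficiently large), $\delta_0>0$ and $C>0$, independent of $k$ and $h$, such that for every time mesh with $k-k_{\min}\le\delta_0$ and every conformal triangulation $\mathcal T$ of $\Omega$ the following holds. Let $f\in L^\infty(I;L^2(\Omega))$, let $u_0\in H^1_0(\Omega)$ with $A_{k,m}u_0\in L^2(\Omega)$ for all $m=1,\dots,M$, and let $u_{kh}\in X^{0,r}_{k,h}$ be the fully discrete solution with data $f,u_0$. Then $$\max_{1\le m\le M}\left(\|A_{kh,m}u_{kh,m}\|_{L^2(\Omega)}+\left\|\frac{[u_{kh}]_{m-1}}{k_m}\right\|_{L^2(\Omega)}\right)\le Ce^{\mu T}\left(\ln\frac{T}{k}\,\|f\|_{L^\infty(I;L^2(\Omega))}+\mu T\max_{1\le m\le M}\|A_{kh,m}P_hu_0\|_{L^2(\Omega)}\right).$$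
   Context: Problem data. $\Omega\subset\mathbb R^d$, $d\ge1$, is a bounded polygonal/polyhedral Lipschitz domain, $T>0$, $I=(0,T)$. The coefficients $a_{ij}\in L^\infty(I\times\Omega)$ ($1\le i,j\le d$) satisfy $a_{ij}=a_{ji}$ and $\sum_{i,j}a_{ij}(t,x)\xi_i\xi_j\ge\alpha|\xi|^2$ for all $\xi\in\mathbb R^d$ and a.e. $(t,x)$, with a constant $\alpha>0$; they are continuous in $t$ on $\bar I$ for almost all $x$, and $|a_{ij}(t_1,x)-a_{ij}(t_2,x)|\le\omega(|t_1-t_2|)$ for all $t_1,t_2\in\bar I$ and almost all $x\in\Omega$, where $\omega:[0,T]\to[0,\infty)$ is nondecreasing, $\omega(t)/t^{3/2}$ is non-increasing on $(0,T]$, and $\int_0^T\omega(t)t^{-3/2}\,dt<\infty$. For $u,v\in H^1_0(\Omega)$ set $a(t;u,v)=\int_\Omega\sum_{i,j}a_{ij}(t,x)\partial_iu\,\partial_jv\,dx$, and let $A(t):H^1_0(\Omega)\to H^{-1}(\Omega)$ be given by $\langle A(t)u,v\rangle=a(t;u,v)$. Time meshes. $0=t_0<t_1<\dots<t_M=T$, $I_m=(t_{m-1},t_m]$, $k_m=t_m-t_{m-1}$, $k=\max_mk_m$, $k_{\min}=\min_mk_m$. All meshes satisfy, with fixed constants $c,\beta,\kappa>0$: (i) $k_{\min}\ge ck^\beta$; (ii) $\kappa^{-1}\le k_m/k_{m+1}\le\kappa$ for $1\le m\le M-1$; (iii) $k\le T/4$. Set $A_{k,m}=\frac1{k_m}\int_{I_m}A(t)\,dt:H^1_0(\Omega)\to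 H^{-1}(\Omega)$. Space discretization. $\mathcal T=\{\tau\}$ is a conformal (no hanging nodes) partition of $\Omega$ into simplices, $h$ the maximal diameter; no shape regularity or quasi-uniformity is assumed. $V_h$ is the set of functions in $H^1_0(\Omega)$ that are polynomials of degree $r\ge1$ on each $\tau$. $P_h:L^2(\Omega)\to V_h$ is the $L^2$-orthogonal projection. $A_h(t):V_h\to V_h$ is defined by $(A_h(t)v_h,\chi)_\Omega=a(t;v_h,\chi)$ for all $\chi\in V_h$, and $A_{kh,m}=\frac1{k_m}\int_{I_m}A_h(t)\,dt:V_h\to V_h$. Full discretization. $X^{0,r}_{k,h}$ is the space of functions on $I$ with values in $V_h$ that are constant in time on each $I_m$; $v_{kh,m}:=v_{kh}|_{I_m}$. The fully discrete solution $u_{kh}\in X^{0,r}_{k,h}$ with data $f,u_0$ is defined by $$\int_Ia(t;u_{kh},\varphi_{kh})\,dt+\sum_{m=2}^M(u_{kh,m}-u_{kh,m-1},\varphi_{kh,m})_\Omega+(u_{kh,1},\varphi_{kh,1})_\Omega=\int_I(f,\varphi_{kh})_\Omega\,dt+(u_0,\varphi_{kh,1})_\Omega\quad\forall\varphi_{kh}\in X^{0,r}_{k,h}.$$ Jumps: $[u_{kh}]_m=u_{kh,m+1}-u_{kh,m}$ for $1\le m\le M-1$, and $[u_{kh}]_0=u_{kh,1}-P_hu_0$. "Independent of $k$ and $h$" means: depending only on $\Omega,d,T$, the coefficients $a_{ij}$ (including $\alpha,\omega$) and $c,\beta,\kappa$, and not otherwise on the time mesh, nor on the triangulation, $f,u_0$.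 *)

theory Defs
  imports "HOL-Analysis.Analysis" "HOL-Probability.Essential_Supremum"
begin

text \<open>
  Elements of Lebesgue and Sobolev spaces on a set \<open>\<Omega>\<close> are represented by functions
  \<open>real^'n \<Rightarrow> real\<close>; only their almost everywhere class on \<open>\<Omega>\<close> matters, and every notion
  below (norms, forms, operators) depends on that class only.  Operators whose value is a class
  return some representative, chosen by \<open>SOME\<close>.
\<close>

section \<open>Function spaces\<close>

definition L2 :: "(real^'n) set \<Rightarrow> (real^'n \<Rightarrow> real) set" where
  "L2 \<Omega> = {u. u \<in> borel_measurable (lebesgue_on \<Omega>) \<and> integrable (lebesgue_on \<Omega>) (\<lambda>x. (u x)\<^sup>2)}"

definition L2_inner :: "(real^'n) set \<Rightarrow> (real^'n \<Rightarrow> real) \<Rightarrow> (real^'n \<Rightarrow> real) \<Rightarrow> real" where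
  "L2_inner \<Omega> u v = (LINT x|lebesgue_on \<Omega>. u x * v x)"

definition L2_norm :: "(real^'n) set \<Rightarrow> (real^'n \<Rightarrow> real) \<Rightarrow> real" where
  "L2_norm \<Omega> u = sqrt (L2_inner \<Omega> u u)"

definition Linfty :: "'a measure \<Rightarrow> ('a \<Rightarrow> real) set" where
  "Linfty M = {g. g \<in> borel_measurable M \<and> esssup M (\<lambda>x. ereal \<bar>g x\<bar>) < \<infinity>}"

text \<open>Strong (Bochner) measurability of an \<open>L\<^sup>2(\<Omega>)\<close>-valued function on \<open>J\<close>: it is almost
  everywhere the limit, in \<open>L\<^sup>2(\<Omega>)\<close>, of measurable functions with finitely many values.\<close>

definition L2_strongly_measurable :: "(real^'n) set \<Rightarrow> real set \<Rightarrow> (real \<Rightarrow> real^'n \<Rightarrow> real) \<Rightarrow> bool"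
  where
  "L2_strongly_measurable \<Omega> J f \<longleftrightarrow>
     (\<exists>S. (\<forall>n. finite (S n ` J) \<and> (\<forall>t\<in>J. S n t \<in> L2 \<Omega>) \<and>
              (\<forall>w. {t\<in>J. S n t = w} \<in> sets lebesgue)) \<and>
          (AE t in lebesgue_on J. (\<lambda>n. L2_norm \<Omega> (\<lambda>x. f t x - S n t x)) \<longlonglongrightarrow> 0))"

definition Linfty_L2 :: "(real^'n) set \<Rightarrow> real set \<Rightarrow> (real \<Rightarrow> real^'n \<Rightarrow> real) set" where
  "Linfty_L2 \<Omega> J = {f. (AE t in lebesgue_on J. f t \<in> L2 \<Omega>) \<and> L2_strongly_measurable \<Omega> J f \<and>
                        esssup (lebesgue_on J) (\<lambda>t. ereal (L2_norm \<Omega> (f t))) < \<infinity>}"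

definition Linfty_L2_norm :: "(real^'n) set \<Rightarrow> real set \<Rightarrow> (real \<Rightarrow> real^'n \<Rightarrow> real) \<Rightarrow> real" where
  "Linfty_L2_norm \<Omega> J f = real_of_ereal (esssup (lebesgue_on J) (\<lambda>t. ereal (L2_norm \<Omega> (f t))))"

definition partial_deriv :: "'n \<Rightarrow> (real^'n \<Rightarrow> real) \<Rightarrow> real^'n \<Rightarrow> real" where
  "partial_deriv i \<phi> x = frechet_derivative \<phi> (at x) (axis i 1)"

primrec Ck :: "nat \<Rightarrow> (real^'n \<Rightarrow> real) \<Rightarrow> bool" where
  "Ck 0 \<phi> \<longleftrightarrow> continuous_on UNIV \<phi>"
| "Ck (Suc k) \<phi> \<longleftrightarrow> (\<forall>x. \<phi> differentiable (at x)) \<and> (\<forall>i. Ck k (partial_deriv i \<phi>))"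

definition test_functions :: "(real^'n) set \<Rightarrow> (real^'n \<Rightarrow> real) set" where
  "test_functions \<Omega> =
     {\<phi>. (\<forall>k. Ck k \<phi>) \<and> compact (closure {x. \<phi> x \<noteq> 0}) \<and> closure {x. \<phi> x \<noteq> 0} \<subseteq> \<Omega>}"

definition is_weak_gradient ::
  "(real^'n) set \<Rightarrow> (real^'n \<Rightarrow> real) \<Rightarrow> (real^'n \<Rightarrow> real^'n) \<Rightarrow> bool" where
  "is_weak_gradient \<Omega> u g \<longleftrightarrow>
     (\<forall>i. (\<lambda>x. g x $ i) \<in> L2 \<Omega> \<and>
          (\<forall>\<phi>\<in>test_functions \<Omega>.
             L2_inner \<Omega> u (partial_deriv i \<phi>) = - L2_inner \<Omega> (\<lambda>x. g x $ i) \<phi>))"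

definition weak_gradient :: "(real^'n) set \<Rightarrow> (real^'n \<Rightarrow> real) \<Rightarrow> real^'n \<Rightarrow> real^'n" where
  "weak_gradient \<Omega> u = (SOME g. is_weak_gradient \<Omega> u g)"

definition H1 :: "(real^'n) set \<Rightarrow> (real^'n \<Rightarrow> real) set" where
  "H1 \<Omega> = {u \<in> L2 \<Omega>. \<exists>g. is_weak_gradient \<Omega> u g}"

definition H1_norm :: "(real^'n) set \<Rightarrow> (real^'n \<Rightarrow> real) \<Rightarrow> real" where
  "H1_norm \<Omega> u =
     sqrt ((L2_norm \<Omega> u)\<^sup>2 + (\<Sum>i\<in>UNIV. (L2_norm \<Omega> (\<lambda>x. weak_gradient \<Omega> u x $ i))\<^sup>2))"

definition H10 :: "(real^'n) set \<Rightarrow> (real^'n \<Rightarrow> real) set" where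
  "H10 \<Omega> = {u \<in> H1 \<Omega>. \<exists>\<phi>. (\<forall>n. \<phi> n \<in> test_functions \<Omega>) \<and>
                          (\<lambda>n. H1_norm \<Omega> (\<lambda>x. u x - \<phi> n x)) \<longlonglongrightarrow> 0}"

section \<open>Domain\<close>

text \<open>Near each boundary point, \<open>\<Omega>\<close> lies on one side of the graph of a Lipschitz function over
  a hyperplane with unit normal \<open>e\<close>.\<close>

definition lipschitz_domain :: "(real^'n) set \<Rightarrow> bool" where
  "lipschitz_domain \<Omega> \<longleftrightarrow>
     open \<Omega> \<and> connected \<Omega> \<and> \<Omega> \<noteq> {} \<and>
     (\<forall>x\<in>frontier \<Omega>. \<exists>e U \<gamma> L. norm e = 1 \<and> open U \<and> x \<in> U \<and> L-lipschitz_on {y. y \<bullet> e = 0} \<gamma> \<and>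
        \<Omega> \<inter> U = {y\<in>U. \<gamma> (y - (y \<bullet> e) *\<^sub>R e) < y \<bullet> e})"

definition polyhedral_set :: "(real^'n) set \<Rightarrow> bool" where
  "polyhedral_set \<Omega> \<longleftrightarrow> (\<exists>\<P>. finite \<P> \<and> (\<forall>P\<in>\<P>. polytope P) \<and> closure \<Omega> = \<Union>\<P>)"

section \<open>Elliptic operators\<close>

definition admissible_coefficients ::
  "(real^'n) set \<Rightarrow> real \<Rightarrow> ('n \<Rightarrow> 'n \<Rightarrow> real \<Rightarrow> real^'n \<Rightarrow> real) \<Rightarrow> real \<Rightarrow> (real \<Rightarrow> real) \<Rightarrow> bool"
  where
  "admissible_coefficients \<Omega> T a \<alpha> \<omega> \<longleftrightarrow>
     (\<forall>i j. (\<lambda>(t, x). a i j t x) \<in> Linfty (lebesgue_on ({0<..<T} \<times> \<Omega>))) \<and>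
     (AE (t, x) in lebesgue_on ({0<..<T} \<times> \<Omega>). \<forall>i j. a i j t x = a j i t x) \<and>
     (AE (t, x) in lebesgue_on ({0<..<T} \<times> \<Omega>).
        \<forall>\<xi>::real^'n. (\<Sum>i\<in>UNIV. \<Sum>j\<in>UNIV. a i j t x * \<xi> $ i * \<xi> $ j) \<ge> \<alpha> * (norm \<xi>)\<^sup>2) \<and>
     (\<forall>i j. AE x in lebesgue_on \<Omega>. continuous_on {0..T} (\<lambda>t. a i j t x)) \<and>
     (\<forall>i j. \<forall>t\<^sub>1\<in>{0..T}. \<forall>t\<^sub>2\<in>{0..T}.
        AE x in lebesgue_on \<Omega>. \<bar>a i j t\<^sub>1 x - a i j t\<^sub>2 x\<bar> \<le> \<omega> \<bar>t\<^sub>1 - t\<^sub>2\<bar>)"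

definition modulus :: "real \<Rightarrow> (real \<Rightarrow> real) \<Rightarrow> bool" where
  "modulus T \<omega> \<longleftrightarrow>
     (\<forall>t\<in>{0..T}. 0 \<le> \<omega> t) \<and> mono_on {0..T} \<omega> \<and>
     antimono_on {0<..T} (\<lambda>t. \<omega> t / t powr (3/2)) \<and>
     integrable (lebesgue_on {0<..<T}) (\<lambda>t. \<omega> t * t powr (-3/2))"

definition a_form :: "(real^'n) set \<Rightarrow> ('n \<Rightarrow> 'n \<Rightarrow> real \<Rightarrow> real^'n \<Rightarrow> real) \<Rightarrow> real \<Rightarrow>
    (real^'n \<Rightarrow> real) \<Rightarrow> (real^'n \<Rightarrow> real) \<Rightarrow> real" where
  "a_form \<Omega> a t u v =
     (LINT x|lebesgue_on \<Omega>. (\<Sum>i\<in>UNIV. \<Sum>j\<in>UNIV.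
        a i j t x * weak_gradient \<Omega> u x $ i * weak_gradient \<Omega> v x $ j))"

text \<open>An element of \<open>H\<^sup>-\<^sup>1(\<Omega>)\<close> is a functional, applied to functions in \<open>H10 \<Omega>\<close>.\<close>

definition A_op :: "(real^'n) set \<Rightarrow> ('n \<Rightarrow> 'n \<Rightarrow> real \<Rightarrow> real^'n \<Rightarrow> real) \<Rightarrow> real \<Rightarrow>
    (real^'n \<Rightarrow> real) \<Rightarrow> ((real^'n \<Rightarrow> real) \<Rightarrow> real)" where
  "A_op \<Omega> a t u = (\<lambda>v. a_form \<Omega> a t u v)"

definition functional_in_L2 :: "(real^'n) set \<Rightarrow> ((real^'n \<Rightarrow> real) \<Rightarrow> real) \<Rightarrow> bool" where
  "functional_in_L2 \<Omega> F \<longleftrightarrow> (\<exists>g\<in>L2 \<Omega>. \<forall>v\<in>H10 \<Omega>. F v = L2_inner \<Omega> g v)"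

section \<open>Time meshes\<close>

text \<open>A mesh is given by its nodes \<open>tn 0 < \<dots> < tn M\<close>; subintervals are numbered from 1.\<close>

definition mesh_int :: "(nat \<Rightarrow> real) \<Rightarrow> nat \<Rightarrow> real set" where
  "mesh_int tn m = {tn (m - 1)<..tn m}"

definition mesh_step :: "(nat \<Rightarrow> real) \<Rightarrow> nat \<Rightarrow> real" where
  "mesh_step tn m = tn m - tn (m - 1)"

definition k_max :: "nat \<Rightarrow> (nat \<Rightarrow> real) \<Rightarrow> real" where
  "k_max M tn = Max (mesh_step tn ` {1..M})"

definition k_min :: "nat \<Rightarrow> (nat \<Rightarrow> real) \<Rightarrow> real" where
  "k_min M tn = Min (mesh_step tn ` {1..M})"

definition time_mesh ::
  "real \<Rightarrow> real \<Rightarrow> real \<Rightarrow> real \<Rightarrow> nat \<Rightarrow> (nat \<Rightarrow> real) \<Rightarrow> bool" where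
  "time_mesh T c \<beta> \<kappa> M tn \<longleftrightarrow>
     tn 0 = 0 \<and> tn M = T \<and> (\<forall>m\<in>{1..M}. tn (m - 1) < tn m) \<and>
     k_min M tn \<ge> c * k_max M tn powr \<beta> \<and>
     (\<forall>m\<in>{1..<M}. 1 / \<kappa> \<le> mesh_step tn m / mesh_step tn (m + 1) \<and>
                   mesh_step tn m / mesh_step tn (m + 1) \<le> \<kappa>) \<and>
     k_max M tn \<le> T / 4"

definition A_km :: "(real^'n) set \<Rightarrow> ('n \<Rightarrow> 'n \<Rightarrow> real \<Rightarrow> real^'n \<Rightarrow> real) \<Rightarrow> (nat \<Rightarrow> real) \<Rightarrow> nat \<Rightarrow>
    (real^'n \<Rightarrow> real) \<Rightarrow> ((real^'n \<Rightarrow> real) \<Rightarrow> real)" where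
  "A_km \<Omega> a tn m u = (\<lambda>v. 1 / mesh_step tn m * (LINT t|lebesgue_on (mesh_int tn m). A_op \<Omega> a t u v))"

section \<open>Space discretization\<close>

definition conformal_triangulation :: "(real^'n) set \<Rightarrow> (real^'n) set set \<Rightarrow> bool" where
  "conformal_triangulation \<Omega> \<T> \<longleftrightarrow>
     triangulation \<T> \<and> (\<forall>\<tau>\<in>\<T>. int CARD('n) simplex \<tau>) \<and> \<Union>\<T> = closure \<Omega>"

definition poly_fun :: "nat \<Rightarrow> (real^'n \<Rightarrow> real) \<Rightarrow> bool" where
  "poly_fun r p \<longleftrightarrow>
     (\<exists>c. \<forall>x. p x = (\<Sum>e | (\<Sum>i\<in>UNIV. e i) \<le> r. c e * (\<Prod>i\<in>UNIV. x $ i ^ e i)))"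

definition fe_space :: "(real^'n) set \<Rightarrow> (real^'n) set set \<Rightarrow> nat \<Rightarrow> (real^'n \<Rightarrow> real) set" where
  "fe_space \<Omega> \<T> r =
     {v \<in> H10 \<Omega>. \<forall>\<tau>\<in>\<T>. \<exists>p. poly_fun r p \<and> (AE x in lebesgue_on \<tau>. v x = p x)}"

definition L2_proj ::
  "(real^'n) set \<Rightarrow> (real^'n \<Rightarrow> real) set \<Rightarrow> (real^'n \<Rightarrow> real) \<Rightarrow> (real^'n \<Rightarrow> real)" where
  "L2_proj \<Omega> V u = (SOME w. w \<in> V \<and> (\<forall>\<psi>\<in>V. L2_inner \<Omega> (\<lambda>x. u x - w x) \<psi> = 0))"

definition A_h :: "(real^'n) set \<Rightarrow> ('n \<Rightarrow> 'n \<Rightarrow> real \<Rightarrow> real^'n \<Rightarrow> real) \<Rightarrow> (real^'n \<Rightarrow> real) set \<Rightarrow>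
    real \<Rightarrow> (real^'n \<Rightarrow> real) \<Rightarrow> (real^'n \<Rightarrow> real)" where
  "A_h \<Omega> a V t v = (SOME w. w \<in> V \<and> (\<forall>\<psi>\<in>V. L2_inner \<Omega> w \<psi> = a_form \<Omega> a t v \<psi>))"

text \<open>The integral of a function with values in a (finite-dimensional) space \<open>V\<close> of classes of
  functions.  A pointwise integral would make no sense, as representatives may vary with \<open>t\<close>;
  the integral is taken with respect to the inner product of \<open>V\<close>.\<close>

definition V_integral :: "(real^'n) set \<Rightarrow> (real^'n \<Rightarrow> real) set \<Rightarrow> real set \<Rightarrow>
    (real \<Rightarrow> real^'n \<Rightarrow> real) \<Rightarrow> (real^'n \<Rightarrow> real)" where
  "V_integral \<Omega> V J g =
     (SOME w. w \<in> V \<and> (\<forall>\<psi>\<in>V. L2_inner \<Omega> w \<psi> = (LINT t|lebesgue_on J. L2_inner \<Omega> (g t) \<psi>)))"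

definition A_khm :: "(real^'n) set \<Rightarrow> ('n \<Rightarrow> 'n \<Rightarrow> real \<Rightarrow> real^'n \<Rightarrow> real) \<Rightarrow> (real^'n \<Rightarrow> real) set \<Rightarrow>
    (nat \<Rightarrow> real) \<Rightarrow> nat \<Rightarrow> (real^'n \<Rightarrow> real) \<Rightarrow> (real^'n \<Rightarrow> real)" where
  "A_khm \<Omega> a V tn m v =
     (\<lambda>x. 1 / mesh_step tn m * V_integral \<Omega> V (mesh_int tn m) (\<lambda>t. A_h \<Omega> a V t v) x)"

section \<open>Full discretization\<close>

text \<open>The value of a piecewise constant function on the \<open>m\<close>-th subinterval, which is closed on the
  right, is its value at the node \<open>tn m\<close>.\<close>

definition pw_const :: "(real^'n \<Rightarrow> real) set \<Rightarrow> nat \<Rightarrow> (nat \<Rightarrow> real) \<Rightarrow> (real \<Rightarrow> real^'n \<Rightarrow> real) set"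
  where
  "pw_const V M tn = {v. \<forall>m\<in>{1..M}. \<exists>w\<in>V. \<forall>t\<in>mesh_int tn m. v t = w}"

definition fully_discrete_solution ::
  "(real^'n) set \<Rightarrow> real \<Rightarrow> ('n \<Rightarrow> 'n \<Rightarrow> real \<Rightarrow> real^'n \<Rightarrow> real) \<Rightarrow> (real^'n \<Rightarrow> real) set \<Rightarrow>
   nat \<Rightarrow> (nat \<Rightarrow> real) \<Rightarrow> (real \<Rightarrow> real^'n \<Rightarrow> real) \<Rightarrow> (real^'n \<Rightarrow> real) \<Rightarrow>
   (real \<Rightarrow> real^'n \<Rightarrow> real) \<Rightarrow> bool" where
  "fully_discrete_solution \<Omega> T a V M tn f u\<^sub>0 u \<longleftrightarrow>
     u \<in> pw_const V M tn \<and>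
     (\<forall>\<phi>\<in>pw_const V M tn.
        (LINT t|lebesgue_on {0<..<T}. a_form \<Omega> a t (u t) (\<phi> t)) +
        (\<Sum>m=2..M. L2_inner \<Omega> (\<lambda>x. u (tn m) x - u (tn (m - 1)) x) (\<phi> (tn m))) +
        L2_inner \<Omega> (u (tn 1)) (\<phi> (tn 1))
        = (LINT t|lebesgue_on {0<..<T}. L2_inner \<Omega> (f t) (\<phi> t)) +
          L2_inner \<Omega> u\<^sub>0 (\<phi> (tn 1)))"

definition jump :: "(real^'n) set \<Rightarrow> (real^'n \<Rightarrow> real) set \<Rightarrow> (nat \<Rightarrow> real) \<Rightarrow> (real^'n \<Rightarrow> real) \<Rightarrow>
    (real \<Rightarrow> real^'n \<Rightarrow> real) \<Rightarrow> nat \<Rightarrow> (real^'n \<Rightarrow> real)" where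
  "jump \<Omega> V tn u\<^sub>0 u m =
     (if m = 0 then (\<lambda>x. u (tn 1) x - L2_proj \<Omega> V u\<^sub>0 x)
      else (\<lambda>x. u (tn (m + 1)) x - u (tn m) x))"

end

theory Submission
  imports Defs "HOL-Library.Function_Algebras" "HOL-Computational_Algebra.Polynomial"
begin

text \<open>
On the finite element space \<open>V\<close> write \<open>A\<^sub>m\<close> for the operator of the time-averaged form and \<open>\<tau>\<^sub>l = t\<^sub>n - t\<^sub>l\<^sub>-\<^sub>1\<close>.
The scheme reads \<open>u\<^sub>m - u\<^sub>m\<^sub>-\<^sub>1 + k\<^sub>m A\<^sub>m u\<^sub>m = k\<^sub>m f\<^sub>m\<close>.  Fix \<open>n\<close>, freeze the operator \<open>A = A\<^sub>n\<close> and solve the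
dual problem \<open>z\<^sub>l\<^sub>+\<^sub>1 = z\<^sub>l + k\<^sub>l A z\<^sub>l\<close> backwards from \<open>z\<^sub>n\<^sub>+\<^sub>1 = A\<^sub>n u\<^sub>n\<close>.  With \<open>y\<^sub>l = A z\<^sub>l\<close>, summation
by parts (\<open>duhamel_dual\<close>) gives
\<open>|A\<^sub>n u\<^sub>n|\<^sup>2 = (A\<^sub>n u\<^sub>0, z\<^sub>1) + \<Sum> k\<^sub>l (f\<^sub>l, y\<^sub>l) + \<Sum> k\<^sub>l ((A\<^sub>n - A\<^sub>l) u\<^sub>l, y\<^sub>l)\<close>.

The dual solution is smoothed (\<open>dual_smoothing\<close>): \<open>|y\<^sub>l| \<le> |A\<^sub>n u\<^sub>n| / \<tau>\<^sub>l\<close>, and for \<open>l < n\<close> the energy norm of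
\<open>y\<^sub>l\<close> is at most a constant times \<open>|A\<^sub>n u\<^sub>n| \<tau>\<^sub>l\<^bsup>-3/2\<^esup>\<close>.  Fractional powers and spectral theory are
avoided: the product of the factors \<open>1 + k\<^sub>j A\<close> is a polynomial in \<open>A\<close> with nonnegative coefficients, all the
mixed terms of its squared norm are nonnegative because \<open>A\<close> is symmetric and positive, and so the
terms with \<open>A\<^sup>2\<close> and \<open>A\<^sup>3\<close> can be kept alone.  Hence the load contributes
\<open>\<Sum> k\<^sub>l / \<tau>\<^sub>l\<close>, which is logarithmic.  The last sum vanishes at \<open>l = n\<close>; for \<open>l < n\<close> the coefficients differ by
at most \<open>\<omega>(\<tau>\<^sub>l)\<close>, and the gradient of \<open>u\<^sub>l\<close> is controlled by \<open>|A\<^sub>l u\<^sub>l|\<close> through the Poincare inequality.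
For \<open>N\<^sub>n = |A\<^sub>n u\<^sub>n|\<close> this is a discrete Volterra inequality (\<open>recursive_estimate\<close>)
\<open>N\<^sub>n \<le> G + F (1 + ln (T / k\<^sub>m\<^sub>i\<^sub>n)) + \<Gamma> \<Sum> k\<^sub>l \<phi>(\<tau>\<^sub>l) N\<^sub>l\<close> with the decreasing, integrable kernel
\<open>\<phi>(s) = \<omega>(s) s\<^bsup>-3/2\<^esup>\<close>.  After multiplication with \<open>exp (- \<mu> t\<^sub>n)\<close> the kernel sum is dominated by
\<open>\<integral> \<phi>(s) exp (- \<mu> s / (1 + \<kappa>)) ds\<close>, because neighbouring steps have comparable sizes, and this
integral tends to \<open>0\<close> as \<open>\<mu>\<close> grows.  A large \<open>\<mu>\<close> absorbs the sum (\<open>maximal_regularity\<close>).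
The mesh condition \<open>k\<^sub>m\<^sub>i\<^sub>n \<ge> c k\<^sup>\<beta>\<close> turns \<open>ln (T / k\<^sub>m\<^sub>i\<^sub>n)\<close> into a multiple of \<open>ln (T / k)\<close>, and the jump
quotient is \<open>f\<^sub>m - A\<^sub>m u\<^sub>m\<close>.

Apart from \<open>T\<close>, the dimension and the constants of the time mesh, only the Poincare constant of \<open>\<Omega>\<close>, the ellipticity
constant and the modulus \<open>\<omega>\<close> enter, so nothing depends on the triangulation.  The remaining sections supply the analysis that this argument takes for granted: weak
gradients are unique almost everywhere, functions in \<open>H10\<close> satisfy the Poincare inequality, the coefficients have
bounded, symmetric and elliptic time slices at every time, and the finite element space
is finite-dimensional up to null sets, so that the discrete operators and projections exist.
\<close>

section \<open>Semi-inner products and Riesz representers\<close>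

text \<open>
Positivity is only required in the weak sense \<open>0 \<le> ip v v\<close>: elements of Lebesgue and Sobolev spaces are
represented by functions, so nonzero functions of norm zero occur.
\<close>

locale semi_inner =
  fixes V :: "'a::real_vector set" and ip :: "'a \<Rightarrow> 'a \<Rightarrow> real"
  assumes subspace: "subspace V"
    and add_left: "\<lbrakk>u \<in> V; v \<in> V; w \<in> V\<rbrakk> \<Longrightarrow> ip (u + v) w = ip u w + ip v w"
    and scale_left: "\<lbrakk>u \<in> V; w \<in> V\<rbrakk> \<Longrightarrow> ip (c *\<^sub>R u) w = c * ip u w"
    and sym: "\<lbrakk>u \<in> V; v \<in> V\<rbrakk> \<Longrightarrow> ip u v = ip v u"
    and nonneg: "v \<in> V \<Longrightarrow> 0 \<le> ip v v"
begin

lemma mem [simp, intro]: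
  "0 \<in> V" "\<lbrakk>u \<in> V; v \<in> V\<rbrakk> \<Longrightarrow> u + v \<in> V" "\<lbrakk>u \<in> V; v \<in> V\<rbrakk> \<Longrightarrow> u - v \<in> V" "u \<in> V \<Longrightarrow> c *\<^sub>R u \<in> V"
  using subspace by (auto simp: subspace_0 subspace_add subspace_diff subspace_scale)

lemma add_right: "\<lbrakk>u \<in> V; v \<in> V; w \<in> V\<rbrakk> \<Longrightarrow> ip w (u + v) = ip w u + ip w v"
  by (metis add_left sym mem(2))

lemma scale_right: "\<lbrakk>u \<in> V; w \<in> V\<rbrakk> \<Longrightarrow> ip w (c *\<^sub>R u) = c * ip w u"
  by (metis scale_left sym mem(4))

lemma diff_left: "\<lbrakk>u \<in> V; v \<in> V; w \<in> V\<rbrakk> \<Longrightarrow> ip (u - v) w = ip u w - ip v w"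
  using add_left[of "u - v" v w] by auto

lemma diff_right: "\<lbrakk>u \<in> V; v \<in> V; w \<in> V\<rbrakk> \<Longrightarrow> ip w (u - v) = ip w u - ip w v"
  by (metis diff_left sym mem(3))

lemmas bilinear_simps = add_left add_right scale_left scale_right diff_left diff_right

lemma zero_left [simp]: "w \<in> V \<Longrightarrow> ip 0 w = 0"
  using scale_left[of 0 w 0] by simp

lemma zero_right [simp]: "w \<in> V \<Longrightarrow> ip w 0 = 0"
  using scale_right[of 0 w 0] by simp

definition nrm :: "'a \<Rightarrow> real" where "nrm v = sqrt (ip v v)"

lemma nrm_nonneg [simp]: "v \<in> V \<Longrightarrow> 0 \<le> nrm v"
  by (simp add: nrm_def nonneg)

lemma nrm_sq: "v \<in> V \<Longrightarrow> (nrm v)\<^sup>2 = ip v v"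
  by (simp add: nrm_def nonneg)

lemma cauchy_schwarz_sq:
  assumes "u \<in> V" "v \<in> V"
  shows "(ip u v)\<^sup>2 \<le> ip u u * ip v v"
proof -
  have q: "0 \<le> ip u u - 2 * s * ip u v + s\<^sup>2 * ip v v" for s
  proof -
    have "0 \<le> ip (u - s *\<^sub>R v) (u - s *\<^sub>R v)"
      using assms by (intro nonneg) auto
    also have "\<dots> = ip u u - 2 * s * ip u v + s\<^sup>2 * ip v v"
      using assms sym[of u v] by (simp add: bilinear_simps power2_eq_square algebra_simps)
    finally show ?thesis .
  qed
  show ?thesis
  proof (cases "ip v v = 0")
    case True
    have "ip u v = 0"
    proof (rule ccontr)
      assume ne: "ip u v \<noteq> 0"
      show False
        using q[of "(ip u u + 1) / (2 * ip u v)"] ne True by (simp add: field_simps)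
    qed
    then show ?thesis using True by simp
  next
    case False
    then have pos: "ip v v > 0" using nonneg[OF assms(2)] by simp
    have "0 \<le> ip u u - (ip u v)\<^sup>2 / ip v v"
      using q[of "ip u v / ip v v"] pos by (simp add: field_simps power2_eq_square)
    then show ?thesis using pos by (simp add: field_simps)
  qed
qed

lemma cauchy_schwarz:
  assumes "u \<in> V" "v \<in> V"
  shows "\<bar>ip u v\<bar> \<le> nrm u * nrm v"
proof -
  have "\<bar>ip u v\<bar> = sqrt ((ip u v)\<^sup>2)" by simp
  also have "\<dots> \<le> sqrt (ip u u * ip v v)"
    by (intro real_sqrt_le_mono cauchy_schwarz_sq assms)
  finally show ?thesis by (simp add: nrm_def real_sqrt_mult)
qed

lemma nrm_triangle:
  assumes "u \<in> V" "v \<in> V"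
  shows "nrm (u + v) \<le> nrm u + nrm v"
proof (rule power2_le_imp_le)
  have "(nrm (u + v))\<^sup>2 = ip u u + 2 * ip u v + ip v v"
    using assms sym[of u v] by (simp add: nrm_sq bilinear_simps)
  also have "\<dots> \<le> (nrm u + nrm v)\<^sup>2"
    using cauchy_schwarz[OF assms] assms by (simp add: nrm_sq power2_sum)
  finally show "(nrm (u + v))\<^sup>2 \<le> (nrm u + nrm v)\<^sup>2" .
qed (use assms in auto)

lemma nrm_scale: "v \<in> V \<Longrightarrow> nrm (c *\<^sub>R v) = \<bar>c\<bar> * nrm v"
  by (simp add: nrm_def bilinear_simps real_sqrt_mult flip: mult.assoc)

end

lemma semi_inner_subset:
  assumes "semi_inner V ip" "subspace W" "W \<subseteq> V"
  shows "semi_inner W ip"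
proof -
  interpret semi_inner V ip by fact
  show ?thesis
    by standard (use assms add_left scale_left sym nonneg in \<open>auto simp: subset_iff\<close>)
qed

definition linear_functional :: "'a::real_vector set \<Rightarrow> ('a \<Rightarrow> real) \<Rightarrow> bool" where
  "linear_functional V F \<longleftrightarrow>
     (\<forall>u\<in>V. \<forall>v\<in>V. F (u + v) = F u + F v) \<and> (\<forall>c. \<forall>u\<in>V. F (c *\<^sub>R u) = c * F u)"

lemma (in semi_inner) linear_functional_ip: "w \<in> V \<Longrightarrow> linear_functional V (ip w)"
  by (simp add: linear_functional_def add_right scale_right)

lemma (in semi_inner) null_orthogonal:
  assumes "v \<in> V" "ip v v = 0" "w \<in> V"
  shows "ip w v = 0"
  using cauchy_schwarz_sq[OF assms(3,1)] assms by simp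

lemma linear_functional_diff:
  assumes "linear_functional V F" "subspace V" "u \<in> V" "v \<in> V"
  shows "F (u - v) = F u - F v"
proof -
  have "F ((u - v) + v) = F (u - v) + F v"
    using assms unfolding linear_functional_def by (metis subspace_diff)
  then show ?thesis by simp
qed

text \<open>
A Gram-Schmidt step.  A new vector \<open>b\<close> is split into its projection \<open>p\<close> on the old span, which exists by
the induction hypothesis for the functional \<open>ip b\<close>, and an orthogonal remainder \<open>e\<close>; the representer is
corrected by a multiple of \<open>e\<close>.  If \<open>e\<close> has norm zero, the correction is dropped, since the
functional vanishes on null vectors.
\<close>

lemma (in semi_inner) riesz_span:
  assumes "finite B" "B \<subseteq> V" "linear_functional V F"
    and "\<And>v. \<lbrakk>v \<in> V; ip v v = 0\<rbrakk> \<Longrightarrow> F v = 0"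
  shows "\<exists>w\<in>span B. \<forall>v\<in>span B. ip w v = F v"
  using assms
proof (induction B arbitrary: F rule: finite_induct)
  case empty
  then have "F (0 *\<^sub>R 0) = 0 * F 0" using mem(1) unfolding linear_functional_def by blast
  then show ?case by simp
next
  case (insert b B)
  have bV: "b \<in> V" and BV: "B \<subseteq> V" using insert.prems by auto
  have sp: "span B \<subseteq> V" using BV subspace by (rule span_minimal)
  obtain w where w: "w \<in> span B" "\<And>v. v \<in> span B \<Longrightarrow> ip w v = F v"
    using insert.IH[OF BV insert.prems(2,3)] by blast
  obtain p where p: "p \<in> span B" "\<And>v. v \<in> span B \<Longrightarrow> ip p v = ip b v"
    using insert.IH[OF BV linear_functional_ip[OF bV]] null_orthogonal bV by blast
  define e where "e = b - p"
  have V: "w \<in> V" "p \<in> V" "e \<in> V" using w p sp bV by (auto simp: e_def)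
  have e: "ip e v = 0" if "v \<in> span B" for v
    using p(2)[OF that] that sp V bV by (auto simp: e_def diff_left)
  have eF: "F b = F p + F e"
    using linear_functional_diff[OF insert.prems(2) subspace bV V(2)] by (simp add: e_def)
  define c where "c = (if ip e e = 0 then 0 else F e / ip e e)"
  have ce: "c * ip e e = F e" using insert.prems(3)[OF V(3)] by (simp add: c_def)
  define w' where "w' = w + c *\<^sub>R e"
  have emem: "e \<in> span (insert b B)"
    unfolding e_def by (rule span_diff) (use p span_mono[of B "insert b B"] in \<open>auto intro: span_base\<close>)
  have "w' \<in> span (insert b B)"
    unfolding w'_def using w span_mono[of B "insert b B"] emem by (auto intro: span_add span_scale)
  moreover have "ip w' v = F v" if v: "v \<in> span (insert b B)" for v
  proof -
    obtain k where k: "v - k *\<^sub>R b \<in> span B" using v by (auto simp: span_breakdown_eq)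
    define x where "x = (v - k *\<^sub>R b) + k *\<^sub>R p"
    have x: "x \<in> span B" unfolding x_def using k p by (intro span_add span_scale)
    have v_eq: "v = x + k *\<^sub>R e" by (simp add: x_def e_def algebra_simps)
    have xV: "x \<in> V" using x sp by auto
    have "ip w' v = ip w x + k * ip w e + c * ip e x + k * (c * ip e e)"
      unfolding w'_def v_eq using V xV by (simp add: bilinear_simps algebra_simps)
    also have "\<dots> = F x + k * F e"
      using w x e[OF x] e[OF w(1)] sym[of w e] V ce by simp
    also have "\<dots> = F v"
      unfolding v_eq using insert.prems(2) xV V by (simp add: linear_functional_def)
    finally show ?thesis .
  qed
  ultimately show ?case by blast
qed

text \<open>
A space spanned by finitely many vectors only up to null vectors behaves like a finite-dimensional
one.  This is the situation of finite element functions that are determined almost everywhere.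
\<close>

lemma (in semi_inner) riesz:
  assumes "finite B" "B \<subseteq> V" "linear_functional V F"
    and null: "\<And>v. \<lbrakk>v \<in> V; ip v v = 0\<rbrakk> \<Longrightarrow> F v = 0"
    and dense: "\<And>v. v \<in> V \<Longrightarrow> \<exists>w\<in>span B. ip (v - w) (v - w) = 0"
  shows "\<exists>w\<in>V. \<forall>v\<in>V. ip w v = F v"
proof -
  have sp: "span B \<subseteq> V" using assms(2) subspace by (rule span_minimal)
  obtain w where w: "w \<in> span B" "\<And>v. v \<in> span B \<Longrightarrow> ip w v = F v"
    using riesz_span[OF assms(1-4)] by blast
  have "ip w v = F v" if v: "v \<in> V" for v
  proof -
    obtain v' where v': "v' \<in> span B" "ip (v - v') (v - v') = 0" using dense[OF v] by blast
    have V: "v' \<in> V" "w \<in> V" using v' w sp by auto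
    have "ip w (v - v') = 0" "F (v - v') = 0"
      using null_orthogonal[of "v - v'" w] null[of "v - v'"] v v' V by auto
    then show ?thesis
      using w(2)[OF v'(1)] linear_functional_diff[OF assms(3) subspace v V(1)] V v
      by (simp add: diff_right)
  qed
  then show ?thesis using w sp by auto
qed

section \<open>Smoothing by the dual implicit Euler scheme\<close>

lemma nodes_mono:
  fixes t :: "nat \<Rightarrow> real"
  assumes "\<And>l. l \<in> {1..n} \<Longrightarrow> t (l - 1) < t l" "l \<le> n"
  shows "t l \<le> t n"
  using assms(2)
proof (induction rule: inc_induct)
  case (step m)
  then show ?case using assms(1)[of "Suc m"] by auto
qed auto

text \<open>
Here \<open>z' = (1 + k A) z\<close>, \<open>y = A z\<close> and \<open>y' = A z'\<close>, where \<open>A\<close> is the operator of the form \<open>a\<close>.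
In every term on the right, expanding \<open>z'\<close> produces nonnegative terms only, since \<open>(A\<^sup>i z, A\<^sup>j z) \<ge> 0\<close>.
Dropping all powers beyond \<open>A\<^sup>3\<close> leaves the left side.  The quadratic coefficient comes out as
\<open>\<tau>\<^sup>2 + 4 \<tau> k + k\<^sup>2\<close>, which contains the full square \<open>(\<tau> + k)\<^sup>2\<close>, and the cubic one gains \<open>2 \<tau> k (\<tau> + k)\<close>.
\<close>

lemma euler_step_energy:
  assumes "semi_inner V ip" and "semi_inner V a"
    and V: "z \<in> V" "y \<in> V" "y' \<in> V" and k: "k > 0" and "\<tau> \<ge> 0" "s \<ge> 0"
    and y: "\<And>\<psi>. \<psi> \<in> V \<Longrightarrow> ip y \<psi> = a z \<psi>"
    and y': "\<And>\<psi>. \<psi> \<in> V \<Longrightarrow> ip y' \<psi> = a (z + k *\<^sub>R y) \<psi>"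
  defines "z' \<equiv> z + k *\<^sub>R y"
  shows "ip z z + 2 * (\<tau> + k) * a z z + (\<tau> + k)\<^sup>2 * ip y y + (s + 2 * \<tau> * k * (\<tau> + k)) * a y y
       \<le> ip z' z' + 2 * \<tau> * a z' z' + \<tau>\<^sup>2 * ip y' y' + s * a y' y'"
proof -
  interpret I: semi_inner V ip by fact
  interpret A: semi_inner V a by fact
  \<comment> \<open>The difference \<open>d\<close> plays the role of \<open>k A y\<close>.\<close>
  define d where "d = y' - y"
  have d: "d \<in> V" and y'd: "y' = y + d" using V by (auto simp: d_def)
  have ipd: "ip d \<psi> = k * a y \<psi>" if "\<psi> \<in> V" for \<psi>
    using that V y[of \<psi>] y'[of \<psi>] by (simp add: d_def I.bilinear_simps A.bilinear_simps)
  have zz: "ip z' z' = ip z z + 2 * k * a z z + k\<^sup>2 * ip y y"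
    using V y[of z] I.sym[of z y]
    by (simp add: z'_def I.bilinear_simps power2_eq_square algebra_simps)
  have azz: "a z' z' = a z z + 2 * k * ip y y + k\<^sup>2 * a y y"
    using V y[of y] A.sym[of z y]
    by (simp add: z'_def A.bilinear_simps power2_eq_square algebra_simps)
  have "ip y' y' = ip y y + 2 * ip d y + ip d d"
    using V d I.sym[of d y] by (simp add: y'd I.bilinear_simps)
  then have yy: "ip y' y' \<ge> ip y y + 2 * k * a y y"
    using V d I.nonneg[of d] ipd[of y] by simp
  have "a y' y' = a y y + 2 * a y d + a d d"
    using V d A.sym[of d y] by (simp add: y'd A.bilinear_simps)
  moreover have "a y d \<ge> 0"
    using ipd[of d] d k I.nonneg[of d] by (simp add: zero_le_mult_iff)
  ultimately have ayy: "a y' y' \<ge> a y y"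
    using A.nonneg[OF d] by simp
  have "ip z z + 2 * (\<tau> + k) * a z z + (\<tau> + k)\<^sup>2 * ip y y + (s + 2 * \<tau> * k * (\<tau> + k)) * a y y
      \<le> (ip z z + 2 * k * a z z + k\<^sup>2 * ip y y) + 2 * \<tau> * (a z z + 2 * k * ip y y + k\<^sup>2 * a y y)
        + \<tau>\<^sup>2 * (ip y y + 2 * k * a y y) + s * a y y"
  proof -
    have "0 \<le> 2 * \<tau> * k * ip y y" using I.nonneg[of y] V assms by simp
    then show ?thesis by (simp add: power2_eq_square algebra_simps)
  qed
  also have "\<dots> \<le> ip z' z' + 2 * \<tau> * a z' z' + \<tau>\<^sup>2 * ip y' y' + s * a y' y'"
    using mult_left_mono[OF yy, of "\<tau>\<^sup>2"] mult_left_mono[OF ayy \<open>s \<ge> 0\<close>] zz azz by simp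
  finally show ?thesis .
qed

text \<open>
Iterating the previous step from \<open>n\<close> down to \<open>l\<close> makes the quadratic coefficient \<open>(t n - t (l - 1))\<^sup>2\<close>.
The cubic coefficient is zero after one step, as the squared norm of \<open>(1 + k A) z\<close> ends with the
term \<open>k\<^sup>2 (A\<^sup>2 z, z)\<close>; from the second step on, comparable neighbouring steps make it grow like the cube of the elapsed
time.  The value of \<open>\<gamma>\<close> is small enough for both the second step and all later ones.
\<close>

lemma dual_smoothing:
  assumes SI: "semi_inner V ip" and SA: "semi_inner V a"
    and zV: "\<And>l. l \<in> {1..Suc n} \<Longrightarrow> z l \<in> V" and yV: "\<And>l. l \<in> {1..Suc n} \<Longrightarrow> y l \<in> V"
    and y: "\<And>l \<psi>. \<lbrakk>l \<in> {1..Suc n}; \<psi> \<in> V\<rbrakk> \<Longrightarrow> ip (y l) \<psi> = a (z l) \<psi>"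
    and z: "\<And>l. l \<in> {1..n} \<Longrightarrow> z (Suc l) = z l + (t l - t (l - 1)) *\<^sub>R y l"
    and t: "\<And>l. l \<in> {1..n} \<Longrightarrow> t (l - 1) < t l"
    and \<kappa>: "\<kappa> > 0"
    and up: "\<And>l. l \<in> {1..<n} \<Longrightarrow> t l - t (l - 1) \<le> \<kappa> * (t (Suc l) - t l)"
    and dn: "\<And>l. l \<in> {1..<n} \<Longrightarrow> t (Suc l) - t l \<le> \<kappa> * (t l - t (l - 1))"
    and l: "l \<in> {1..n}"
  defines "\<gamma> \<equiv> 2 / (3 * (1 + \<kappa>)\<^sup>2)"
  shows "ip (z l) (z l) + 2 * (t n - t (l - 1)) * a (z l) (z l) + (t n - t (l - 1))\<^sup>2 * ip (y l) (y l)
          + (if l = n then 0 else \<gamma> * (t n - t (l - 1)) ^ 3) * a (y l) (y l)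
         \<le> ip (z (Suc n)) (z (Suc n))"
proof -
  interpret I: semi_inner V ip by fact
  interpret A: semi_inner V a by fact
  define E where "E \<tau> s l = ip (z l) (z l) + 2 * \<tau> * a (z l) (z l) + \<tau>\<^sup>2 * ip (y l) (y l) + s * a (y l) (y l)"
    for \<tau> s l
  have step: "E (\<tau> + (t l - t (l - 1))) (s + 2 * \<tau> * (t l - t (l - 1)) * (\<tau> + (t l - t (l - 1)))) l \<le> E \<tau> s (Suc l)"
    if "l \<in> {1..n}" "\<tau> \<ge> 0" "s \<ge> 0" for l \<tau> s
    unfolding E_def z[OF that(1)]
    by (rule euler_step_energy[OF SI SA])
      (use that t[of l] zV[of l] yV[of l] yV[of "Suc l"] y[of l] y[of "Suc l"] z[of l] in auto)
  have mono: "E \<tau> s l \<le> E \<tau> s' l" if "s \<le> s'" "l \<in> {1..n}" for \<tau> s s' l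
    using mult_right_mono[OF that(1), of "a (y l) (y l)"] A.nonneg[of "y l"] yV[of l] that
    by (auto simp: E_def)
  have tn: "t l \<le> t n" if "l \<le> n" for l
    using nodes_mono[of n t l] t that by auto
  have \<gamma>: "\<gamma> > 0" using \<kappa> by (simp add: \<gamma>_def)
  have \<gamma>1: "\<gamma> * (1 + \<kappa>) * (1 + \<kappa>) = 2 / 3" and \<gamma>2: "\<gamma> * 3 * (1 + \<kappa>) = 2 / (1 + \<kappa>)"
  proof -
    have "2 / (3 * K\<^sup>2) * K * K = 2 / 3 \<and> 2 / (3 * K\<^sup>2) * 3 * K = 2 / K" if "K > 0" for K :: real
      using that by (simp add: power2_eq_square)
    from this[of "1 + \<kappa>"] show "\<gamma> * (1 + \<kappa>) * (1 + \<kappa>) = 2 / 3" "\<gamma> * 3 * (1 + \<kappa>) = 2 / (1 + \<kappa>)"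
      using \<kappa> by (simp_all add: \<gamma>_def)
  qed
  have "E (t n - t (l - 1)) (if l = n then 0 else \<gamma> * (t n - t (l - 1)) ^ 3) l
         \<le> ip (z (Suc n)) (z (Suc n))" if "1 \<le> l" "l \<le> n" for l
    using that(2,1)
  proof (induction rule: inc_induct)
    case base
    then show ?case using step[of n 0 0] by (simp add: E_def)
  next
    case (step l)
    define k where "k = t l - t (l - 1)"
    define \<tau> where "\<tau> = t n - t l"
    define s where "s = (if Suc l = n then 0 else \<gamma> * \<tau> ^ 3)"
    have k: "k > 0" using t[of l] step.hyps step.prems by (simp add: k_def)
    have Sl: "t l < t (Suc l)" using t[of "Suc l"] step.hyps by auto
    have \<tau>: "\<tau> > 0" using tn[of "Suc l"] Sl step.hyps by (simp add: \<tau>_def)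
    have k\<tau>: "k \<le> \<kappa> * \<tau>"
    proof -
      have "k \<le> \<kappa> * (t (Suc l) - t l)" using up[of l] step by (auto simp: k_def)
      also have "\<dots> \<le> \<kappa> * \<tau>" using tn[of "Suc l"] step \<kappa> by (auto simp: \<tau>_def)
      finally show ?thesis .
    qed
    have \<tau>1: "\<tau> + k \<le> (1 + \<kappa>) * \<tau>" using k\<tau> by (simp add: algebra_simps)
    have s: "\<gamma> * (\<tau> + k) ^ 3 \<le> s + 2 * \<tau> * k * (\<tau> + k)"
    proof (cases "Suc l = n")
      case True
      have "\<tau> \<le> \<kappa> * k" using dn[of l] step True by (auto simp: k_def \<tau>_def)
      then have "\<tau> + k \<le> (1 + \<kappa>) * k" by (simp add: algebra_simps)
      with \<tau>1 have "(\<tau> + k) * (\<tau> + k) \<le> ((1 + \<kappa>) * \<tau>) * ((1 + \<kappa>) * k)"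
        using k \<tau> \<kappa> by (intro mult_mono) auto
      then have "\<gamma> * ((\<tau> + k) * (\<tau> + k)) \<le> \<gamma> * (((1 + \<kappa>) * \<tau>) * ((1 + \<kappa>) * k))"
        using \<gamma> by (intro mult_left_mono) auto
      also have "\<dots> = (2 / 3) * (\<tau> * k)"
        by (subst \<gamma>1[symmetric]) (simp add: algebra_simps)
      also have "\<dots> \<le> 2 * (\<tau> * k)" using \<tau> k by simp
      finally have "\<gamma> * ((\<tau> + k) * (\<tau> + k)) * (\<tau> + k) \<le> 2 * (\<tau> * k) * (\<tau> + k)"
        using \<tau> k by (intro mult_right_mono) auto
      then show ?thesis using True by (simp add: s_def power3_eq_cube algebra_simps)
    next
      case False
      have 1: "(\<tau> + k) ^ 3 - \<tau> ^ 3 \<le> 3 * k * (\<tau> + k)\<^sup>2"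
      proof -
        have "3 * k * (\<tau> + k)\<^sup>2 - ((\<tau> + k) ^ 3 - \<tau> ^ 3) = 3 * \<tau> * k\<^sup>2 + 2 * k ^ 3"
          by (simp add: power2_eq_square power3_eq_cube algebra_simps)
        moreover have "\<dots> \<ge> 0" using \<tau> k by simp
        ultimately show ?thesis by linarith
      qed
      have "\<gamma> * ((\<tau> + k) ^ 3 - \<tau> ^ 3) \<le> \<gamma> * (3 * k * (\<tau> + k)\<^sup>2)"
        using \<gamma> 1 by simp
      also have "\<dots> = \<gamma> * 3 * k * (\<tau> + k) * (\<tau> + k)"
        by (simp add: power2_eq_square)
      also have "\<dots> \<le> \<gamma> * 3 * k * (\<tau> + k) * ((1 + \<kappa>) * \<tau>)"
        using \<tau>1 \<gamma> k \<tau> by (intro mult_left_mono) auto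
      also have "\<dots> = 2 / (1 + \<kappa>) * (\<tau> * k * (\<tau> + k))"
        by (subst \<gamma>2[symmetric]) (simp add: algebra_simps)
      also have "\<dots> \<le> 2 * (\<tau> * k * (\<tau> + k))"
        using \<kappa> k \<tau> by (intro mult_right_mono) (auto simp: field_simps)
      finally show ?thesis using False by (simp add: s_def algebra_simps)
    qed
    have s0: "s \<ge> 0" using \<gamma> \<tau> by (simp add: s_def)
    have "E (\<tau> + k) (\<gamma> * (\<tau> + k) ^ 3) l \<le> E (\<tau> + k) (s + 2 * \<tau> * k * (\<tau> + k)) l"
      using step s by (intro mono) auto
    also have "\<dots> \<le> E \<tau> s (Suc l)"
      using \<open>\<And>s \<tau> l. \<lbrakk>l \<in> {1..n}; 0 \<le> \<tau>; 0 \<le> s\<rbrakk> \<Longrightarrow> E (\<tau> + (t l - t (l - 1))) (s + 2 * \<tau> * (t l - t (l - 1)) * (\<tau> + (t l - t (l - 1)))) l \<le> E \<tau> s (Suc l)\<close>[of l \<tau> s]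
        step s0 \<tau> by (auto simp: k_def)
    also have "\<dots> \<le> ip (z (Suc n)) (z (Suc n))"
      using step.IH by (cases "Suc l = n") (auto simp: \<tau>_def s_def)
    finally show ?case using step.hyps by (simp add: k_def \<tau>_def)
  qed
  from this[of l] l show ?thesis by (simp add: E_def)
qed

text \<open>
Summation by parts of \<open>ip (u l) (y (l + 1))\<close>.  The frozen form \<open>a\<close> of the dual problem appears against the
forms \<open>b l\<close> of the scheme, so the sum collects their differences.
\<close>

lemma duhamel_dual:
  assumes SI: "semi_inner V ip" and SA: "semi_inner V a"
    and uV: "\<And>l. l \<le> n \<Longrightarrow> u l \<in> V"
    and zV: "\<And>l. l \<in> {1..Suc n} \<Longrightarrow> z l \<in> V" and yV: "\<And>l. l \<in> {1..Suc n} \<Longrightarrow> y l \<in> V"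
    and y: "\<And>l \<psi>. \<lbrakk>l \<in> {1..Suc n}; \<psi> \<in> V\<rbrakk> \<Longrightarrow> ip (y l) \<psi> = a (z l) \<psi>"
    and z: "\<And>l. l \<in> {1..n} \<Longrightarrow> z (Suc l) = z l + k l *\<^sub>R y l"
    and eq: "\<And>l \<psi>. \<lbrakk>l \<in> {1..n}; \<psi> \<in> V\<rbrakk> \<Longrightarrow> ip (u l - u (l - 1)) \<psi> + k l * b l (u l) \<psi> = k l * F l \<psi>"
  shows "a (z (Suc n)) (u n)
       = a (z 1) (u 0) + (\<Sum>l=1..n. k l * (F l (y l) + (a (u l) (y l) - b l (u l) (y l))))"
proof -
  interpret I: semi_inner V ip by fact
  interpret A: semi_inner V a by fact
  have "ip (u m) (y (Suc m))
      = ip (u 0) (y 1) + (\<Sum>l=1..m. k l * (F l (y l) + (a (u l) (y l) - b l (u l) (y l))))"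
    if "m \<le> n" for m
    using that
  proof (induction m)
    case (Suc m)
    let ?m = "Suc m"
    have V: "u m \<in> V" "u ?m \<in> V" "y ?m \<in> V" "y (Suc ?m) \<in> V" "z ?m \<in> V" "z (Suc ?m) \<in> V"
      using uV zV yV Suc.prems by auto
    have "ip (u ?m) (y (Suc ?m)) - ip (u ?m) (y ?m) = a (z (Suc ?m)) (u ?m) - a (z ?m) (u ?m)"
      using y[of ?m "u ?m"] y[of "Suc ?m" "u ?m"] V Suc.prems I.sym[of "u ?m"] by auto
    also have "\<dots> = k ?m * a (u ?m) (y ?m)"
      using z[of ?m] Suc.prems V A.sym[of "u ?m" "y ?m"] by (simp add: A.bilinear_simps)
    finally have 1: "ip (u ?m) (y (Suc ?m)) = ip (u ?m) (y ?m) + k ?m * a (u ?m) (y ?m)" by simp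
    have 2: "ip (u ?m) (y ?m) = ip (u m) (y ?m) + k ?m * F ?m (y ?m) - k ?m * b ?m (u ?m) (y ?m)"
      using eq[of ?m "y ?m"] V Suc.prems by (auto simp: I.bilinear_simps)
    show ?case
      using 1 2 Suc by (simp add: algebra_simps)
  qed auto
  from this[of n] show ?thesis
    using y[of "Suc n" "u n"] y[of 1 "u 0"] uV zV yV I.sym[of "u n" "y (Suc n)"] I.sym[of "u 0" "y 1"]
    by auto
qed

text \<open>
The dual problem runs backwards in time, each step applying the resolvent of \<open>A\<close>.  Taking \<open>y l\<close> as the difference
quotient of \<open>z\<close>, instead of a representer of \<open>A z\<close>, makes the recursion for \<open>z\<close> an exact
identity of vectors and not only one up to null vectors.
\<close>

lemma dual_problem_exists:
  assumes solve: "\<And>c w. \<lbrakk>c \<ge> 0; w \<in> V\<rbrakk> \<Longrightarrow> \<exists>z\<in>V. \<forall>\<psi>\<in>V. ip z \<psi> + c * a z \<psi> = ip w \<psi>"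
    and rep: "\<And>w. w \<in> V \<Longrightarrow> \<exists>y\<in>V. \<forall>\<psi>\<in>V. ip y \<psi> = a w \<psi>"
    and SI: "semi_inner V ip"
    and k: "\<And>l. l \<in> {1..n} \<Longrightarrow> k l > 0" and \<eta>: "\<eta> \<in> V"
  obtains z y where "z (Suc n) = \<eta>" "\<And>l. l \<in> {1..Suc n} \<Longrightarrow> z l \<in> V"
    "\<And>l. l \<in> {1..Suc n} \<Longrightarrow> y l \<in> V"
    "\<And>l \<psi>. \<lbrakk>l \<in> {1..Suc n}; \<psi> \<in> V\<rbrakk> \<Longrightarrow> ip (y l) \<psi> = a (z l) \<psi>"
    "\<And>l. l \<in> {1..n} \<Longrightarrow> z (Suc l) = z l + k l *\<^sub>R y l"
proof -
  interpret I: semi_inner V ip by fact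
  have "\<exists>g. \<forall>i. (g i \<in> V \<and> (i = 0 \<longrightarrow> g i = \<eta>)) \<and>
          (i < n \<longrightarrow> (\<forall>\<psi>\<in>V. ip (g (Suc i)) \<psi> + k (n - i) * a (g (Suc i)) \<psi> = ip (g i) \<psi>))"
  proof (intro dependent_nat_choice)
    fix x :: 'a and i :: nat assume x: "x \<in> V \<and> (i = 0 \<longrightarrow> x = \<eta>)"
    show "\<exists>y. (y \<in> V \<and> (Suc i = 0 \<longrightarrow> y = \<eta>)) \<and>
          (i < n \<longrightarrow> (\<forall>\<psi>\<in>V. ip y \<psi> + k (n - i) * a y \<psi> = ip x \<psi>))"
    proof (cases "i < n")
      case True
      then have "n - i \<in> {1..n}" by auto
      then have "k (n - i) \<ge> 0" using k by (meson less_imp_le)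
      then show ?thesis using solve[of "k (n - i)" x] x by auto
    qed (use x in auto)
  qed (use \<eta> in auto)
  then obtain g where "\<forall>i. (g i \<in> V \<and> (i = 0 \<longrightarrow> g i = \<eta>)) \<and>
          (i < n \<longrightarrow> (\<forall>\<psi>\<in>V. ip (g (Suc i)) \<psi> + k (n - i) * a (g (Suc i)) \<psi> = ip (g i) \<psi>))" ..
  then have g: "\<And>i. g i \<in> V" "g 0 = \<eta>"
    "\<And>i \<psi>. \<lbrakk>i < n; \<psi> \<in> V\<rbrakk> \<Longrightarrow> ip (g (Suc i)) \<psi> + k (n - i) * a (g (Suc i)) \<psi> = ip (g i) \<psi>"
    by auto
  obtain y0 where y0: "y0 \<in> V" "\<And>\<psi>. \<psi> \<in> V \<Longrightarrow> ip y0 \<psi> = a \<eta> \<psi>"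
    using rep[OF \<eta>] by auto
  define z where "z l = g (Suc n - l)" for l
  define y where "y l = (if l = Suc n then y0 else (1 / k l) *\<^sub>R (z (Suc l) - z l))" for l
  have zV: "z l \<in> V" for l by (simp add: z_def g)
  have main: "ip (y l) \<psi> = a (z l) \<psi>" if "l \<in> {1..Suc n}" "\<psi> \<in> V" for l \<psi>
  proof (cases "l = Suc n")
    case True
    then show ?thesis using y0 that by (simp add: y_def z_def g)
  next
    case False
    with that have l: "l \<in> {1..n}" by auto
    have "Suc n - l = Suc (n - l)" "n - (n - l) = l" using l by auto
    then have "ip (z l) \<psi> + k l * a (z l) \<psi> = ip (z (Suc l)) \<psi>"
      using g(3)[of "n - l" \<psi>] l that by (simp add: z_def)
    then show ?thesis
      using False k[OF l] zV that by (simp add: y_def I.bilinear_simps field_simps)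
  qed
  show ?thesis
  proof
    show "z (Suc n) = \<eta>" by (simp add: z_def g)
    show "z l \<in> V" for l by fact
    show "y l \<in> V" for l using zV y0 by (simp add: y_def I.mem)
    show "ip (y l) \<psi> = a (z l) \<psi>" if "l \<in> {1..Suc n}" "\<psi> \<in> V" for l \<psi> using main that .
    show "z (Suc l) = z l + k l *\<^sub>R y l" if "l \<in> {1..n}" for l
      using that k[OF that] by (auto simp: y_def)
  qed
qed

section \<open>Logarithmic and weakly singular sums over a mesh\<close>

text \<open>
A left-endpoint Riemann sum of \<open>1 / (t n - s)\<close>: for \<open>l < n\<close> each summand is \<open>1 - p / q \<le> ln q - ln p\<close> with
\<open>p\<close>, \<open>q\<close> the distances of the two nodes from \<open>t n\<close>, and the last summand is \<open>1\<close>.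
\<close>

lemma sum_step_over_distance_le:
  fixes t :: "nat \<Rightarrow> real"
  assumes t: "\<And>l. l \<in> {1..n} \<Longrightarrow> t (l - 1) < t l" and "1 \<le> n"
  shows "(\<Sum>l=1..n. (t l - t (l - 1)) / (t n - t (l - 1))) \<le> 1 + ln ((t n - t 0) / (t n - t (n - 1)))"
proof -
  have tn: "t l \<le> t n" if "l \<le> n" for l
    using nodes_mono[of n t l] t that by auto
  have n1: "t n - t (n - 1) > 0" using t[of n] assms(2) by auto
  have "(\<Sum>l=m..n. (t l - t (l - 1)) / (t n - t (l - 1))) \<le> 1 + ln ((t n - t (m - 1)) / (t n - t (n - 1)))"
    if "1 \<le> m" "m \<le> n" for m
    using that(2,1)
  proof (induction rule: inc_induct)
    case base
    then show ?case using n1 by simp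
  next
    case (step m)
    define p where "p = t n - t m"
    define q where "q = t n - t (m - 1)"
    have p: "p > 0" using tn[of "Suc m"] t[of "Suc m"] step by (auto simp: p_def)
    have pq: "p < q" using t[of m] step by (auto simp: p_def q_def)
    have "(t m - t (m - 1)) / q = 1 - p / q" using p pq by (simp add: p_def q_def field_simps)
    also have "\<dots> \<le> - ln (p / q)" using ln_le_minus_one[of "p / q"] p pq by simp
    also have "\<dots> = ln (q / (t n - t (n - 1))) - ln (p / (t n - t (n - 1)))"
      using p pq n1 by (simp add: ln_div)
    finally have "(t m - t (m - 1)) / q \<le> ln (q / (t n - t (n - 1))) - ln (p / (t n - t (n - 1)))" .
    moreover have "(\<Sum>l=m..n. (t l - t (l - 1)) / (t n - t (l - 1)))
        = (t m - t (m - 1)) / q + (\<Sum>l=Suc m..n. (t l - t (l - 1)) / (t n - t (l - 1)))"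
      using step by (simp add: sum.atLeast_Suc_atMost q_def)
    ultimately show ?case using step.IH by (simp add: p_def q_def)
  qed
  from this[of 1] assms(2) show ?thesis by simp
qed

text \<open>
On the \<open>l\<close>-th step the decreasing kernel is at least its value at the far end \<open>t n - t (l - 1)\<close>, and the
exponential at \<open>t n - t l\<close> is at most the one with the rate reduced by \<open>1 + \<kappa>\<close>, because
\<open>t n - t (l - 1) \<le> (1 + \<kappa>) (t n - t l)\<close> for \<open>l < n\<close>.  So every summand lies below an integral over its own
step.  The step next to \<open>t n\<close>, where this comparison fails, does not occur in the sum.
\<close>

lemma weighted_kernel_sum_le:
  fixes t :: "nat \<Rightarrow> real" and \<phi> :: "real \<Rightarrow> real"
  assumes t: "\<And>l. l \<in> {1..n} \<Longrightarrow> t (l - 1) < t l" and "t 0 = 0" "t n \<le> T" "1 \<le> n"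
    and \<kappa>: "\<kappa> > 0" and up: "\<And>l. l \<in> {1..<n} \<Longrightarrow> t l - t (l - 1) \<le> \<kappa> * (t (Suc l) - t l)"
    and anti: "antimono_on {0<..T} \<phi>" and pos: "\<And>s. s \<in> {0<..T} \<Longrightarrow> 0 \<le> \<phi> s"
    and int: "integrable (lebesgue_on {0<..<T}) (\<lambda>s. \<phi> s * exp (- \<mu> * s / (1 + \<kappa>)))"
    and \<mu>: "\<mu> > 0"
  shows "(\<Sum>l\<in>{1..<n}. (t l - t (l - 1)) * \<phi> (t n - t (l - 1)) * exp (- \<mu> * (t n - t l)))
     \<le> (LINT s|lebesgue_on {0<..<T}. \<phi> s * exp (- \<mu> * s / (1 + \<kappa>)))"
proof -
  define g where "g s = \<phi> s * exp (- \<mu> * s / (1 + \<kappa>))" for s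
  have sint: "set_integrable lebesgue {0<..<T} g"
    using int by (simp add: g_def set_integrable_def integrable_restrict_space)
  have sub: "set_integrable lebesgue {a..<b} g" "set_integrable lebesgue {0<..<b} g" if "0 < a" "b \<le> T" for a b
    by (rule set_integrable_subset[OF sint]; use that in auto)+
  have gpos: "0 \<le> g s" if "s \<in> {0<..T}" for s using pos that by (simp add: g_def)
  have tn: "t l \<le> t n" if "l \<le> n" for l
    using nodes_mono[of n t l] t that by auto
  have t0: "0 \<le> t l" if "l \<le> n" for l
    using that
  proof (induction l)
    case (Suc m)
    then show ?case using t[of "Suc m"] by auto
  qed (use assms in auto)
  have "(\<Sum>l\<in>{m..<n}. (t l - t (l - 1)) * \<phi> (t n - t (l - 1)) * exp (- \<mu> * (t n - t l)))
     \<le> (LINT s:{0<..<t n - t (m - 1)}|lebesgue. g s)"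
    if "1 \<le> m" "m \<le> n" for m
    using that(2,1)
  proof (induction rule: inc_induct)
    case base
    have "t n - t (n - 1) \<le> T" using t0[of "n - 1"] assms by auto
    then show ?case unfolding set_lebesgue_integral_def
      by (auto intro!: integral_nonneg_AE AE_I2 gpos simp: indicator_def)
  next
    case (step m)
    define p where "p = t n - t m"
    define q where "q = t n - t (m - 1)"
    have p: "p > 0" using tn[of "Suc m"] t[of "Suc m"] step by (auto simp: p_def)
    have pq: "p < q" using t[of m] step by (auto simp: p_def q_def)
    have qT: "q \<le> T" using t0[of "m - 1"] less_imp_diff_less[OF \<open>m < n\<close>, of 1] assms(3) by (simp add: q_def)
    have qp: "q \<le> (1 + \<kappa>) * p"
    proof -
      have "q - p \<le> \<kappa> * (t (Suc m) - t m)" using up[of m] step by (auto simp: p_def q_def)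
      also have "\<dots> \<le> \<kappa> * p" using tn[of "Suc m"] step \<kappa> by (auto simp: p_def)
      finally show ?thesis by (simp add: algebra_simps)
    qed
    have le: "\<phi> q * exp (- \<mu> * p) \<le> g s" if "s \<in> {p..<q}" for s
      unfolding g_def
    proof (intro mult_mono)
      show "\<phi> q \<le> \<phi> s" using anti that p qT by (auto simp: monotone_on_def)
      have "s \<le> (1 + \<kappa>) * p" using that qp by auto
      then have "s / (1 + \<kappa>) \<le> p" using \<kappa> by (simp add: field_simps)
      then show "exp (- \<mu> * p) \<le> exp (- \<mu> * s / (1 + \<kappa>))"
        using \<mu> mult_left_mono[of "s / (1 + \<kappa>)" p \<mu>] by simp
      show "0 \<le> \<phi> s" using pos[of s] that p qT by auto
    qed auto
    have "(q - p) * \<phi> q * exp (- \<mu> * p) = (LINT s:{p..<q}|lebesgue. \<phi> q * exp (- \<mu> * p))"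
      using pq by (simp add: set_lebesgue_integral_def)
    also have "\<dots> \<le> (LINT s:{p..<q}|lebesgue. g s)"
    proof (rule set_integral_mono)
      show "set_integrable lebesgue {p..<q} (\<lambda>s. \<phi> q * exp (- \<mu> * p))"
        using pq by (auto simp: set_integrable_def intro!: integrable_real_mult_indicator)
    qed (use sub p qT le in auto)
    finally have 1: "(q - p) * \<phi> q * exp (- \<mu> * p) \<le> (LINT s:{p..<q}|lebesgue. g s)" .
    have "{0<..<q} = {0<..<p} \<union> {p..<q}" using p pq by auto
    then have 2: "(LINT s:{0<..<q}|lebesgue. g s) = (LINT s:{0<..<p}|lebesgue. g s) + (LINT s:{p..<q}|lebesgue. g s)"
      using sub[of p] sub[of p p] p pq qT by (subst \<open>{0<..<q} = _\<close>, intro set_integral_Un) auto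
    have "(\<Sum>l\<in>{m..<n}. (t l - t (l - 1)) * \<phi> (t n - t (l - 1)) * exp (- \<mu> * (t n - t l)))
        = (q - p) * \<phi> q * exp (- \<mu> * p) + (\<Sum>l\<in>{Suc m..<n}. (t l - t (l - 1)) * \<phi> (t n - t (l - 1)) * exp (- \<mu> * (t n - t l)))"
      using step by (simp add: sum.atLeast_Suc_lessThan p_def q_def)
    then show ?case using step.IH 1 2 by (simp add: p_def q_def)
  qed
  from this[of 1] assms have "(\<Sum>l\<in>{1..<n}. (t l - t (l - 1)) * \<phi> (t n - t (l - 1)) * exp (- \<mu> * (t n - t l)))
     \<le> (LINT s:{0<..<t n}|lebesgue. g s)" by simp
  also have "\<dots> \<le> (LINT s:{0<..<T}|lebesgue. g s)"
    unfolding set_lebesgue_integral_def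
    using sint sub(2)[of 1 "t n"] assms(3)
    by (intro integral_mono) (auto simp: set_integrable_def indicator_def gpos)
  also have "\<dots> = (LINT s|lebesgue_on {0<..<T}. g s)"
    by (simp add: set_lebesgue_integral_def integral_restrict_space)
  finally show ?thesis by (simp add: g_def)
qed

text \<open>
Dominated convergence as the rate \<open>\<mu>\<close> runs through the natural numbers.
\<close>

lemma exponential_weight_small:
  fixes \<phi> :: "real \<Rightarrow> real"
  assumes int: "integrable (lebesgue_on {0<..<T}) \<phi>" and q: "q > 0" and \<epsilon>: "\<epsilon> > 0"
  obtains \<mu> where "\<mu> > 0" "integrable (lebesgue_on {0<..<T}) (\<lambda>s. \<phi> s * exp (- \<mu> * s / q))"
    "(LINT s|lebesgue_on {0<..<T}. \<phi> s * exp (- \<mu> * s / q)) \<le> \<epsilon>"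
proof -
  have meas: "(\<lambda>s. exp (- \<mu> * s / q)) \<in> borel_measurable (lebesgue_on {0<..<T})" for \<mu>
    by (intro continuous_imp_measurable_on_sets_lebesgue continuous_intros) (use q in auto)
  have int2: "integrable (lebesgue_on {0<..<T}) (\<lambda>s. \<phi> s * exp (- real n * s / q))" for n
    by (rule Bochner_Integration.integrable_bound[OF int])
      (use int q meas[of "real n"] in \<open>auto simp: abs_mult mult_left_le intro!: AE_I2\<close>)
  have "(\<lambda>n. LINT s|lebesgue_on {0<..<T}. \<phi> s * exp (- real n * s / q)) \<longlonglongrightarrow> (LINT s|lebesgue_on {0<..<T}. 0)"
  proof (rule integral_dominated_convergence[where w = "\<lambda>s. \<bar>\<phi> s\<bar>"])
    show "AE s in lebesgue_on {0<..<T}. (\<lambda>n. \<phi> s * exp (- real n * s / q)) \<longlonglongrightarrow> 0"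
    proof (rule AE_I2)
      fix s assume "s \<in> space (lebesgue_on {0<..<T})"
      then have "s > 0" by simp
      then have "(\<lambda>n. exp (- (s / q)) ^ n) \<longlonglongrightarrow> 0"
        using q by (intro LIMSEQ_realpow_zero) auto
      then have "(\<lambda>n. exp (- real n * s / q)) \<longlonglongrightarrow> 0"
        by (simp add: exp_of_nat_mult[symmetric] algebra_simps)
      then show "(\<lambda>n. \<phi> s * exp (- real n * s / q)) \<longlonglongrightarrow> 0"
        using tendsto_mult_right_zero by blast
    qed
    show "AE s in lebesgue_on {0<..<T}. norm (\<phi> s * exp (- real n * s / q)) \<le> \<bar>\<phi> s\<bar>" for n
      using q by (intro AE_I2) (auto simp: abs_mult mult_left_le)
  qed (use int int2 in auto)
  then have "\<forall>\<^sub>F n in sequentially. (LINT s|lebesgue_on {0<..<T}. \<phi> s * exp (- real n * s / q)) < \<epsilon>"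
    using \<epsilon> by (intro order_tendstoD(2)[where y = 0]) auto
  then obtain n where n: "n \<ge> 1" "(LINT s|lebesgue_on {0<..<T}. \<phi> s * exp (- real n * s / q)) < \<epsilon>"
    unfolding eventually_sequentially by (metis nle_le)
  show ?thesis
    by (rule that[of "real n"]) (use n int2 in auto)
qed

text \<open>
Converts the logarithm of the smallest step into one of the largest.  Constants are absorbed since
\<open>T / k \<ge> 4 > exp 1\<close>.
\<close>

lemma log_mesh_ratio:
  fixes c \<beta> T k k' :: real
  assumes "c > 0" "\<beta> > 0" "T > 0" "k > 0" "k \<le> T / 4" "c * k powr \<beta> \<le> k'"
  shows "1 + ln (T / k') \<le> (1 + \<beta> + \<bar>(1 - \<beta>) * ln T - ln c\<bar>) * ln (T / k)" "1 \<le> ln (T / k)"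
proof -
  have "exp 1 \<le> (4::real)" using exp_le by simp
  moreover have "4 \<le> T / k" using assms by (simp add: field_simps)
  ultimately have "exp 1 \<le> T / k" by linarith
  then show l1: "1 \<le> ln (T / k)" using assms by (subst ln_ge_iff) auto
  have kc: "c * k powr \<beta> > 0" using assms by simp
  have "k' > 0" using kc assms(6) by linarith
  have "ln (T / k') \<le> ln (T / (c * k powr \<beta>))"
    using assms kc \<open>k' > 0\<close> by (intro ln_mono frac_le) auto
  also have "\<dots> = ln T - (ln c + \<beta> * ln k)"
    using assms kc by (simp add: ln_div ln_mult ln_powr)
  also have "\<dots> = \<beta> * ln (T / k) + ((1 - \<beta>) * ln T - ln c)"
    using assms by (simp add: ln_div algebra_simps)
  also have "\<dots> \<le> \<beta> * ln (T / k) + \<bar>(1 - \<beta>) * ln T - ln c\<bar> * ln (T / k)"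
  proof (rule add_left_mono)
    have "A \<le> \<bar>A\<bar> * ln (T / k)" for A :: real
      using mult_left_mono[OF l1 abs_ge_zero[of A]] by simp
    then show "(1 - \<beta>) * ln T - ln c \<le> \<bar>(1 - \<beta>) * ln T - ln c\<bar> * ln (T / k)" .
  qed
  finally show "1 + ln (T / k') \<le> (1 + \<beta> + \<bar>(1 - \<beta>) * ln T - ln c\<bar>) * ln (T / k)"
    using l1 by (simp add: algebra_simps)
qed

section \<open>Maximal regularity of an abstract scheme\<close>

text \<open>
The setting of the argument without any function spaces.  The form \<open>D\<close> is that of the gradients, \<open>P\<close> the constant of the
Poincare inequality, and \<open>\<omega>\<close> bounds the difference of two forms \<open>a n\<close>, \<open>a l\<close> in terms of the total length of the
steps \<open>l, \<dots>, n\<close>.  Solvability is assumed in the form of representers and resolvents.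
\<close>

locale parabolic_scheme =
  I: semi_inner V ip + D: semi_inner V D
  for V :: "'a::real_vector set" and ip D :: "'a \<Rightarrow> 'a \<Rightarrow> real" +
  fixes a :: "nat \<Rightarrow> 'a \<Rightarrow> 'a \<Rightarrow> real" and t :: "nat \<Rightarrow> real" and M :: nat
    and T \<alpha> \<kappa> P K :: real and \<omega> :: "real \<Rightarrow> real"
  assumes form: "m \<in> {1..M} \<Longrightarrow> semi_inner V (a m)"
    and coercive: "\<lbrakk>m \<in> {1..M}; v \<in> V\<rbrakk> \<Longrightarrow> \<alpha> * D v v \<le> a m v v"
    and \<alpha>: "\<alpha> > 0"
    and poincare: "v \<in> V \<Longrightarrow> I.nrm v \<le> P * D.nrm v" and P: "P > 0"
    and lip: "\<lbrakk>1 \<le> l; l < n; n \<le> M; v \<in> V; w \<in> V\<rbrakk> \<Longrightarrow>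
        \<bar>a n v w - a l v w\<bar> \<le> K * \<omega> (t n - t (l - 1)) * (D.nrm v * D.nrm w)" and K: "K > 0"
    and \<omega>: "\<And>s. s \<in> {0..T} \<Longrightarrow> 0 \<le> \<omega> s"
    and riesz: "\<lbrakk>m \<in> {1..M}; w \<in> V\<rbrakk> \<Longrightarrow> \<exists>y\<in>V. \<forall>\<psi>\<in>V. ip y \<psi> = a m w \<psi>"
    and resolvent: "\<lbrakk>m \<in> {1..M}; c \<ge> 0; w \<in> V\<rbrakk> \<Longrightarrow> \<exists>z\<in>V. \<forall>\<psi>\<in>V. ip z \<psi> + c * a m z \<psi> = ip w \<psi>"
    and t: "\<And>l. l \<in> {1..M} \<Longrightarrow> t (l - 1) < t l" and t0: "t 0 = 0" and tM: "t M = T"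
    and \<kappa>: "\<kappa> > 0"
    and up: "\<And>l. l \<in> {1..<M} \<Longrightarrow> t l - t (l - 1) \<le> \<kappa> * (t (Suc l) - t l)"
    and dn: "\<And>l. l \<in> {1..<M} \<Longrightarrow> t (Suc l) - t l \<le> \<kappa> * (t l - t (l - 1))"
begin

lemma t_mono: "\<lbrakk>l \<le> n; n \<le> M\<rbrakk> \<Longrightarrow> t l \<le> t n"
  using nodes_mono[of n t l] t by auto

lemma t_range: "l \<le> M \<Longrightarrow> t l \<in> {0..T}"
  using t_mono[of 0 l] t_mono[of l M] t0 tM by auto

lemma t_range': "l \<le> M \<Longrightarrow> t (l - 1) \<in> {0..T}"
  by (rule t_range) simp

definition \<Gamma> :: real where "\<Gamma> = P / \<alpha> * K / sqrt (\<alpha> * (2 / (3 * (1 + \<kappa>)\<^sup>2)))"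

lemma \<Gamma>: "\<Gamma> > 0"
  using P \<alpha> K \<kappa> by (simp add: \<Gamma>_def)

text \<open>
Coercivity, the Cauchy-Schwarz inequality and the Poincare inequality give
\<open>\<alpha> |\<nabla>v|\<^sup>2 \<le> (A v, v) \<le> P |A v| |\<nabla>v|\<close>.
\<close>

lemma gradient_le_operator:
  assumes "m \<in> {1..M}" "v \<in> V" "w \<in> V" "\<And>\<psi>. \<psi> \<in> V \<Longrightarrow> ip w \<psi> = a m v \<psi>"
  shows "D.nrm v \<le> P / \<alpha> * I.nrm w"
proof (cases "D.nrm v = 0")
  case True
  then show ?thesis using P \<alpha> assms by simp
next
  case False
  then have pos: "D.nrm v > 0" using D.nrm_nonneg[OF assms(2)] by simp
  have "\<alpha> * (D.nrm v * D.nrm v) \<le> ip w v"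
    using coercive[OF assms(1,2)] assms(2,4) D.nrm_sq[of v] by (simp add: power2_eq_square)
  also have "\<dots> \<le> I.nrm w * I.nrm v" using I.cauchy_schwarz[of w v] assms by auto
  also have "\<dots> \<le> I.nrm w * (P * D.nrm v)"
    using poincare assms by (intro mult_left_mono) auto
  finally have "\<alpha> * D.nrm v \<le> P * I.nrm w" using pos
    by (metis mult.assoc mult.commute mult_le_cancel_right_pos)
  then show ?thesis using \<alpha> by (simp add: field_simps)
qed

text \<open>
The Duhamel identity with end value \<open>z (n + 1) = w n\<close>, which represents \<open>A\<^sub>n u\<^sub>n\<close>, so that its left side is
\<open>|w n|\<^sup>2\<close>.  Every term on the right is at most a multiple of \<open>|w n|\<close>, and one factor cancels.
\<close>

lemma recursive_estimate:
  assumes n: "n \<in> {1..M}"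
    and uV: "\<And>l. l \<le> M \<Longrightarrow> u l \<in> V"
    and eq: "\<And>l \<psi>. \<lbrakk>l \<in> {1..M}; \<psi> \<in> V\<rbrakk> \<Longrightarrow>
        ip (u l - u (l - 1)) \<psi> + (t l - t (l - 1)) * a l (u l) \<psi> = (t l - t (l - 1)) * F l \<psi>"
    and F: "\<And>l \<psi>. \<lbrakk>l \<in> {1..M}; \<psi> \<in> V\<rbrakk> \<Longrightarrow> \<bar>F l \<psi>\<bar> \<le> B * I.nrm \<psi>"
    and B: "B \<ge> 0"
    and w: "\<And>l. l \<in> {1..M} \<Longrightarrow> w l \<in> V" "\<And>l \<psi>. \<lbrakk>l \<in> {1..M}; \<psi> \<in> V\<rbrakk> \<Longrightarrow> ip (w l) \<psi> = a l (u l) \<psi>"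
    and g: "g \<in> V" "\<And>\<psi>. \<psi> \<in> V \<Longrightarrow> ip g \<psi> = a n (u 0) \<psi>"
  shows "I.nrm (w n) \<le> I.nrm g + B * (1 + ln ((t n - t 0) / (t n - t (n - 1))))
     + \<Gamma> * (\<Sum>l\<in>{1..<n}. (t l - t (l - 1)) * (\<omega> (t n - t (l - 1)) / (t n - t (l - 1)) powr (3 / 2)) * I.nrm (w l))"
proof -
  let ?N = "I.nrm (w n)"
  define \<tau> where "\<tau> l = t n - t (l - 1)" for l
  define k where "k l = t l - t (l - 1)" for l
  define \<gamma> where "\<gamma> = 2 / (3 * (1 + \<kappa>)\<^sup>2)"
  have \<gamma>: "\<gamma> > 0" using \<kappa> by (simp add: \<gamma>_def)
  interpret A: semi_inner V "a n" using form n .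
  have k: "k l > 0" if "l \<in> {1..n}" for l using t[of l] that n by (auto simp: k_def)
  have \<tau>k: "k l \<le> \<tau> l" if "l \<in> {1..n}" for l
    using t_mono[of l n] that n by (auto simp: k_def \<tau>_def)
  have \<tau>: "\<tau> l > 0" if "l \<in> {1..n}" for l using k[OF that] \<tau>k[OF that] by simp
  have \<tau>T: "\<tau> l \<in> {0..T}" if "l \<in> {1..n}" for l
    using \<tau>[OF that] t_range'[of l] t_range[of n] that n by (auto simp: \<tau>_def)
  obtain z y where zn: "z (Suc n) = w n" and zV: "\<And>l. l \<in> {1..Suc n} \<Longrightarrow> z l \<in> V"
    and yV: "\<And>l. l \<in> {1..Suc n} \<Longrightarrow> y l \<in> V"
    and y: "\<And>l \<psi>. \<lbrakk>l \<in> {1..Suc n}; \<psi> \<in> V\<rbrakk> \<Longrightarrow> ip (y l) \<psi> = a n (z l) \<psi>"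
    and z: "\<And>l. l \<in> {1..n} \<Longrightarrow> z (Suc l) = z l + k l *\<^sub>R y l"
    by (rule dual_problem_exists[of V ip "a n" n k "w n"])
      (use resolvent[OF n] riesz[OF n] I.semi_inner_axioms k w(1) n in auto)
  have energy: "ip (z l) (z l) + 2 * \<tau> l * a n (z l) (z l) + (\<tau> l)\<^sup>2 * ip (y l) (y l)
          + (if l = n then 0 else \<gamma> * \<tau> l ^ 3) * a n (y l) (y l) \<le> ?N\<^sup>2" if "l \<in> {1..n}" for l
  proof -
    have "ip (z l) (z l) + 2 * \<tau> l * a n (z l) (z l) + (\<tau> l)\<^sup>2 * ip (y l) (y l)
          + (if l = n then 0 else \<gamma> * \<tau> l ^ 3) * a n (y l) (y l) \<le> ip (z (Suc n)) (z (Suc n))"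
      unfolding \<tau>_def \<gamma>_def
    proof (rule dual_smoothing[OF I.semi_inner_axioms A.semi_inner_axioms])
      show "z (Suc l) = z l + (t l - t (l - 1)) *\<^sub>R y l" if "l \<in> {1..n}" for l
        using z[OF that] by (simp add: k_def)
      show "t (l - 1) < t l" if "l \<in> {1..n}" for l using t[of l] that n by auto
      show "t l - t (l - 1) \<le> \<kappa> * (t (Suc l) - t l)" if "l \<in> {1..<n}" for l using up[of l] that n by auto
      show "t (Suc l) - t l \<le> \<kappa> * (t l - t (l - 1))" if "l \<in> {1..<n}" for l using dn[of l] that n by auto
    qed (fact zV yV y \<kappa> that)+
    then show ?thesis by (simp only: zn I.nrm_sq[OF w(1)[OF n]])
  qed
  have terms: "0 \<le> ip (z l) (z l)" "0 \<le> 2 * \<tau> l * a n (z l) (z l)" "0 \<le> (\<tau> l)\<^sup>2 * ip (y l) (y l)"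
    "0 \<le> (if l = n then 0 else \<gamma> * \<tau> l ^ 3) * a n (y l) (y l)" if "l \<in> {1..n}" for l
    using I.nonneg A.nonneg zV[of l] yV[of l] \<tau>[OF that] \<gamma> that by auto
  have N0: "?N \<ge> 0" using w n by simp
  have "1 \<in> {1..n}" using n by auto
  from energy[OF this] terms[OF this] have "ip (z 1) (z 1) \<le> ?N\<^sup>2" by linarith
  then have z1: "I.nrm (z 1) \<le> ?N"
    using N0 zV[of 1] by (intro power2_le_imp_le[OF _ N0]) (simp add: I.nrm_sq)
  have yl: "I.nrm (y l) \<le> ?N / \<tau> l" if "l \<in> {1..n}" for l
  proof -
    have "(\<tau> l)\<^sup>2 * ip (y l) (y l) \<le> ?N\<^sup>2"
      using energy[OF that] terms[OF that] by linarith
    then have "(\<tau> l * I.nrm (y l))\<^sup>2 \<le> ?N\<^sup>2"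
      using yV[of l] that by (simp add: I.nrm_sq power_mult_distrib)
    then have "\<tau> l * I.nrm (y l) \<le> ?N" using N0 by (rule power2_le_imp_le)
    then show ?thesis using \<tau>[OF that] by (simp add: field_simps)
  qed
  have Dyl: "D.nrm (y l) \<le> ?N / (sqrt (\<alpha> * \<gamma>) * \<tau> l powr (3 / 2))" if "l \<in> {1..<n}" for l
  proof -
    have l: "l \<in> {1..n}" "l \<noteq> n" using that by auto
    have sq: "\<tau> l ^ 3 = (\<tau> l powr (3 / 2))\<^sup>2"
      using \<tau>[OF l(1)] by (simp add: power2_eq_square flip: powr_add)
    have "\<gamma> * \<tau> l ^ 3 * (\<alpha> * D (y l) (y l)) \<le> \<gamma> * \<tau> l ^ 3 * a n (y l) (y l)"
      using coercive[OF n, of "y l"] yV[of l] l \<gamma> \<tau>[of l] by (intro mult_left_mono) auto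
    also have "\<dots> = (if l = n then 0 else \<gamma> * \<tau> l ^ 3) * a n (y l) (y l)" using l(2) by simp
    also have "\<dots> \<le> ?N\<^sup>2" using energy[OF l(1)] terms[OF l(1)] by linarith
    finally have "(sqrt (\<alpha> * \<gamma>) * \<tau> l powr (3 / 2) * D.nrm (y l))\<^sup>2 \<le> ?N\<^sup>2"
      using yV[of l] l \<gamma> \<alpha> by (simp add: D.nrm_sq power_mult_distrib sq algebra_simps)
    then have "sqrt (\<alpha> * \<gamma>) * \<tau> l powr (3 / 2) * D.nrm (y l) \<le> ?N" using N0 by (rule power2_le_imp_le)
    moreover have "sqrt (\<alpha> * \<gamma>) * \<tau> l powr (3 / 2) > 0" using \<tau>[OF l(1)] \<alpha> \<gamma> by simp
    ultimately show ?thesis by (simp add: field_simps)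
  qed
  have pert: "\<bar>a n (u l) (y l) - a l (u l) (y l)\<bar>
      \<le> \<Gamma> * (\<omega> (\<tau> l) / \<tau> l powr (3 / 2)) * I.nrm (w l) * ?N" if "l \<in> {1..<n}" for l
  proof -
    have l: "1 \<le> l" "l < n" "n \<le> M" "l \<in> {1..n}" "l \<in> {1..M}" using that n by auto
    have "\<bar>a n (u l) (y l) - a l (u l) (y l)\<bar> \<le> K * \<omega> (\<tau> l) * (D.nrm (u l) * D.nrm (y l))"
      using lip[OF l(1-3), of "u l" "y l"] uV[of l] yV[of l] l by (simp add: \<tau>_def)
    also have "\<dots> \<le> K * \<omega> (\<tau> l) * ((P / \<alpha> * I.nrm (w l)) * (?N / (sqrt (\<alpha> * \<gamma>) * \<tau> l powr (3 / 2))))"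
      using gradient_le_operator[OF l(5), of "u l" "w l"] Dyl[OF that] uV[of l] yV[of l] w l P \<alpha>
        \<omega>[OF \<tau>T[OF l(4)]] K
      by (intro mult_left_mono mult_mono) auto
    also have "\<dots> = \<Gamma> * (\<omega> (\<tau> l) / \<tau> l powr (3 / 2)) * I.nrm (w l) * ?N"
      by (simp add: \<Gamma>_def \<gamma>_def mult_ac)
    finally show ?thesis .
  qed
  have "?N * ?N = a n (z (Suc n)) (u n)"
    using w(2)[OF n w(1)[OF n]] I.nrm_sq[OF w(1)[OF n]] zn A.sym[of "u n" "w n"] uV[of n] w(1) n
    by (simp add: power2_eq_square)
  also have "\<dots> = a n (z 1) (u 0) + (\<Sum>l=1..n. k l * (F l (y l) + (a n (u l) (y l) - a l (u l) (y l))))"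
    by (rule duhamel_dual[OF I.semi_inner_axioms A.semi_inner_axioms])
      (use uV zV yV y z eq n in \<open>auto simp: k_def\<close>)
  also have "\<dots> \<le> I.nrm g * ?N + (\<Sum>l=1..n. k l * (B * (?N / \<tau> l)
      + (if l = n then 0 else \<Gamma> * (\<omega> (\<tau> l) / \<tau> l powr (3 / 2)) * I.nrm (w l) * ?N)))"
  proof (intro add_mono sum_mono mult_left_mono)
    have "a n (z 1) (u 0) = ip g (z 1)"
      using g(2)[of "z 1"] zV[of 1] uV[of 0] A.sym[of "z 1" "u 0"] by auto
    also have "\<dots> \<le> I.nrm g * I.nrm (z 1)"
      using I.cauchy_schwarz[of g "z 1"] g zV[of 1] by auto
    also have "\<dots> \<le> I.nrm g * ?N" using z1 g by (intro mult_left_mono) auto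
    finally show "a n (z 1) (u 0) \<le> I.nrm g * ?N" .
    fix l assume l: "l \<in> {1..n}"
    have "F l (y l) \<le> B * I.nrm (y l)" using F[of l "y l"] yV[of l] l n by auto
    also have "\<dots> \<le> B * (?N / \<tau> l)" using yl[OF l] B by (intro mult_left_mono) auto
    finally show "F l (y l) \<le> B * (?N / \<tau> l)" .
    show "a n (u l) (y l) - a l (u l) (y l)
      \<le> (if l = n then 0 else \<Gamma> * (\<omega> (\<tau> l) / \<tau> l powr (3 / 2)) * I.nrm (w l) * ?N)"
      using pert[of l] l by auto
    show "0 \<le> k l" using k[OF l] by simp
  qed
  also have "\<dots> = (I.nrm g + B * (\<Sum>l=1..n. k l / \<tau> l)
      + (\<Sum>l=1..n. k l * (if l = n then 0 else \<Gamma> * (\<omega> (\<tau> l) / \<tau> l powr (3 / 2)) * I.nrm (w l)))) * ?N"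
  proof -
    have "k l * (B * (?N / \<tau> l) + (if l = n then 0 else \<Gamma> * (\<omega> (\<tau> l) / \<tau> l powr (3 / 2)) * I.nrm (w l) * ?N))
        = B * (k l / \<tau> l) * ?N
          + k l * (if l = n then 0 else \<Gamma> * (\<omega> (\<tau> l) / \<tau> l powr (3 / 2)) * I.nrm (w l)) * ?N" for l
      by (cases "l = n") (simp_all add: distrib_left mult_ac)
    then show ?thesis
      by (simp only: sum.distrib sum_distrib_left sum_distrib_right distrib_right add.assoc)
  qed
  also have "(\<Sum>l=1..n. k l * (if l = n then 0 else \<Gamma> * (\<omega> (\<tau> l) / \<tau> l powr (3 / 2)) * I.nrm (w l)))
      = \<Gamma> * (\<Sum>l\<in>{1..<n}. k l * (\<omega> (\<tau> l) / \<tau> l powr (3 / 2)) * I.nrm (w l))"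
  proof -
    have "{1..n} = insert n {1..<n}" using n by auto
    then show ?thesis by (simp add: sum_distrib_left algebra_simps)
  qed
  finally have main: "?N * ?N \<le> (I.nrm g + B * (\<Sum>l=1..n. k l / \<tau> l)
      + \<Gamma> * (\<Sum>l\<in>{1..<n}. k l * (\<omega> (\<tau> l) / \<tau> l powr (3 / 2)) * I.nrm (w l))) * ?N" (is "_ \<le> ?R * ?N") .
  have S0: "0 \<le> (\<Sum>l=1..n. k l / \<tau> l)"
    using k \<tau> by (intro sum_nonneg divide_nonneg_nonneg) (auto simp: less_imp_le)
  have S1: "0 \<le> (\<Sum>l\<in>{1..<n}. k l * (\<omega> (\<tau> l) / \<tau> l powr (3 / 2)) * I.nrm (w l))"
  proof (intro sum_nonneg mult_nonneg_nonneg divide_nonneg_nonneg)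
    fix l assume "l \<in> {1..<n}"
    then have l: "l \<in> {1..n}" "l \<in> {1..M}" using n by auto
    show "0 \<le> k l" using k[OF l(1)] by simp
    show "0 \<le> \<omega> (\<tau> l)" using \<omega>[OF \<tau>T[OF l(1)]] .
    show "0 \<le> I.nrm (w l)" using w(1)[OF l(2)] by simp
  qed auto
  have "?N \<le> ?R"
  proof (cases "?N = 0")
    case True
    then show ?thesis using S0 S1 B \<Gamma> g by simp
  next
    case False
    then show ?thesis using main N0 by simp
  qed
  moreover have "B * (\<Sum>l=1..n. k l / \<tau> l) \<le> B * (1 + ln ((t n - t 0) / (t n - t (n - 1))))"
    unfolding k_def \<tau>_def
    using n B t by (intro mult_left_mono sum_step_over_distance_le) auto
  ultimately show ?thesis by (simp add: k_def \<tau>_def)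
qed

text \<open>
The maximum \<open>W\<close> of \<open>exp (- \<mu> t\<^sub>l) |w l|\<close> is attained at some \<open>m\<close>.  The recursive estimate at
\<open>m\<close>, with the sum weighted accordingly, reads \<open>W \<le> R + W / 2\<close> once \<open>\<mu>\<close> makes the kernel integral small.
\<close>

lemma maximal_regularity:
  assumes uV: "\<And>l. l \<le> M \<Longrightarrow> u l \<in> V"
    and eq: "\<And>l \<psi>. \<lbrakk>l \<in> {1..M}; \<psi> \<in> V\<rbrakk> \<Longrightarrow>
        ip (u l - u (l - 1)) \<psi> + (t l - t (l - 1)) * a l (u l) \<psi> = (t l - t (l - 1)) * F l \<psi>"
    and F: "\<And>l \<psi>. \<lbrakk>l \<in> {1..M}; \<psi> \<in> V\<rbrakk> \<Longrightarrow> \<bar>F l \<psi>\<bar> \<le> B * I.nrm \<psi>"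
    and B: "B \<ge> 0"
    and w: "\<And>l. l \<in> {1..M} \<Longrightarrow> w l \<in> V" "\<And>l \<psi>. \<lbrakk>l \<in> {1..M}; \<psi> \<in> V\<rbrakk> \<Longrightarrow> ip (w l) \<psi> = a l (u l) \<psi>"
    and g: "\<And>l. l \<in> {1..M} \<Longrightarrow> g l \<in> V" "\<And>l \<psi>. \<lbrakk>l \<in> {1..M}; \<psi> \<in> V\<rbrakk> \<Longrightarrow> ip (g l) \<psi> = a l (u 0) \<psi>"
    and G: "\<And>l. l \<in> {1..M} \<Longrightarrow> I.nrm (g l) \<le> G"
    and kmin: "\<And>l. l \<in> {1..M} \<Longrightarrow> kmin \<le> t l - t (l - 1)" "kmin > 0"
    and anti: "antimono_on {0<..T} (\<lambda>s. \<omega> s / s powr (3 / 2))"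
    and int: "integrable (lebesgue_on {0<..<T}) (\<lambda>s. \<omega> s / s powr (3 / 2) * exp (- \<mu> * s / (1 + \<kappa>)))"
    and small: "\<Gamma> * (LINT s|lebesgue_on {0<..<T}. \<omega> s / s powr (3 / 2) * exp (- \<mu> * s / (1 + \<kappa>))) \<le> 1 / 2"
    and \<mu>: "\<mu> > 0" and n: "n \<in> {1..M}"
  shows "I.nrm (w n) \<le> 2 * exp (\<mu> * T) * (G + B * (1 + ln (T / kmin)))"
proof -
  define R where "R = G + B * (1 + ln (T / kmin))"
  define W where "W = Max ((\<lambda>l. exp (- \<mu> * t l) * I.nrm (w l)) ` {1..M})"
  have le_W: "exp (- \<mu> * t l) * I.nrm (w l) \<le> W" if "l \<in> {1..M}" for l
    unfolding W_def using that by (intro Max_ge) auto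
  have "W \<in> (\<lambda>l. exp (- \<mu> * t l) * I.nrm (w l)) ` {1..M}"
    unfolding W_def using n by (intro Max_in) auto
  then obtain m where m: "m \<in> {1..M}" "W = exp (- \<mu> * t m) * I.nrm (w m)" by auto
  have W0: "W \<ge> 0" using m w by simp
  define S where "S = (\<Sum>l\<in>{1..<m}. (t l - t (l - 1)) * (\<omega> (t m - t (l - 1)) / (t m - t (l - 1)) powr (3 / 2)) * I.nrm (w l))"
  have tm: "0 < t m - t (m - 1)" "t m \<in> {0..T}" "0 < t m" using t[OF m(1)] t_range[of m] t_range'[of m] m by auto
  have ln_le: "ln ((t m - t 0) / (t m - t (m - 1))) \<le> ln (T / kmin)"
    using tm kmin(2) kmin(1)[OF m(1)] t0 by (intro ln_mono frac_le) auto
  have "I.nrm (w m) \<le> I.nrm (g m) + B * (1 + ln ((t m - t 0) / (t m - t (m - 1)))) + \<Gamma> * S"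
    unfolding S_def by (rule recursive_estimate) (use assms m in auto)
  also have "\<dots> \<le> R + \<Gamma> * S"
    unfolding R_def using G[OF m(1)] ln_le B \<Gamma> by (intro add_mono mult_left_mono) auto
  finally have 1: "I.nrm (w m) \<le> R + \<Gamma> * S" .
  have "exp (- \<mu> * t m) * S \<le> (\<Sum>l\<in>{1..<m}. (t l - t (l - 1)) * (\<omega> (t m - t (l - 1)) / (t m - t (l - 1)) powr (3 / 2))
      * exp (- \<mu> * (t m - t l))) * W"
    unfolding S_def sum_distrib_left sum_distrib_right
  proof (intro sum_mono)
    fix l assume l: "l \<in> {1..<m}"
    then have lM: "l \<in> {1..M}" using m by auto
    have ex: "exp (- \<mu> * t m) = exp (- \<mu> * (t m - t l)) * exp (- \<mu> * t l)"
      by (simp add: algebra_simps flip: exp_add)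
    have r: "t m - t (l - 1) \<in> {0..T}"
      using t_mono[of "l - 1" m] t_range[of m] t_range'[of l] l m by auto
    have "(t l - t (l - 1)) * (\<omega> (t m - t (l - 1)) / (t m - t (l - 1)) powr (3 / 2)) * exp (- \<mu> * (t m - t l))
        * (exp (- \<mu> * t l) * I.nrm (w l))
       \<le> (t l - t (l - 1)) * (\<omega> (t m - t (l - 1)) / (t m - t (l - 1)) powr (3 / 2)) * exp (- \<mu> * (t m - t l)) * W"
      using le_W[OF lM] t[OF lM] \<omega>[OF r]
      by (intro mult_left_mono mult_nonneg_nonneg divide_nonneg_nonneg) auto
    then show "exp (- \<mu> * t m) * ((t l - t (l - 1)) * (\<omega> (t m - t (l - 1)) / (t m - t (l - 1)) powr (3 / 2)) * I.nrm (w l))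
       \<le> (t l - t (l - 1)) * (\<omega> (t m - t (l - 1)) / (t m - t (l - 1)) powr (3 / 2)) * exp (- \<mu> * (t m - t l)) * W"
      unfolding ex by (simp add: mult.assoc mult.left_commute mult.commute)
  qed
  also have "\<dots> \<le> (LINT s|lebesgue_on {0<..<T}. \<omega> s / s powr (3 / 2) * exp (- \<mu> * s / (1 + \<kappa>))) * W"
    using t t0 t_range[of m] \<kappa> up anti int \<mu> m \<omega> W0
    by (intro mult_right_mono weighted_kernel_sum_le) auto
  finally have "\<Gamma> * (exp (- \<mu> * t m) * S)
      \<le> \<Gamma> * (LINT s|lebesgue_on {0<..<T}. \<omega> s / s powr (3 / 2) * exp (- \<mu> * s / (1 + \<kappa>))) * W"
    using \<Gamma> by (simp add: mult.assoc)
  also have "\<dots> \<le> 1 / 2 * W" using small W0 by (rule mult_right_mono)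
  finally have 2: "\<Gamma> * (exp (- \<mu> * t m) * S) \<le> W / 2" by simp
  have R0: "R \<ge> 0"
  proof -
    have "0 \<le> G" using G[OF m(1)] I.nrm_nonneg[OF g(1)[OF m(1)]] by linarith
    moreover have "kmin \<le> T" using kmin(1)[OF m(1)] t_range[of m] t_range'[of m] m by auto
    then have "0 \<le> ln (T / kmin)" using kmin by simp
    ultimately show ?thesis using B by (simp add: R_def)
  qed
  have "W \<le> exp (- \<mu> * t m) * (R + \<Gamma> * S)"
    using 1 unfolding m(2) by simp
  also have "\<dots> = exp (- \<mu> * t m) * R + \<Gamma> * (exp (- \<mu> * t m) * S)" by (simp add: algebra_simps)
  also have "\<dots> \<le> 1 * R + W / 2"
    using 2 R0 \<mu> tm by (intro add_mono mult_right_mono) auto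
  finally have W: "W \<le> 2 * R" by simp
  have "I.nrm (w n) = exp (\<mu> * t n) * (exp (- \<mu> * t n) * I.nrm (w n))"
    by (simp flip: exp_add mult.assoc)
  also have "\<dots> \<le> exp (\<mu> * T) * (2 * R)"
  proof (rule mult_mono)
    show "exp (- \<mu> * t n) * I.nrm (w n) \<le> 2 * R" using le_W[OF n] W by linarith
  qed (use t_range[of n] n \<mu> w(1)[OF n] in auto)
  finally show ?thesis by (simp add: R_def algebra_simps)
qed

end

section \<open>Square integrable functions\<close>

text \<open>
Real functions form a real vector space.  This makes spans, bases and subspaces available for the
function spaces below.
\<close>

instantiation "fun" :: (type, scaleR) scaleR
begin
definition scaleR_fun :: "real \<Rightarrow> ('a \<Rightarrow> 'b) \<Rightarrow> 'a \<Rightarrow> 'b" where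
  "scaleR_fun c f = (\<lambda>x. c *\<^sub>R f x)"
instance ..
end

lemma scaleR_fun_apply [simp]: "(c *\<^sub>R f) x = c *\<^sub>R f x"
  by (simp add: scaleR_fun_def)

instance "fun" :: (type, real_vector) real_vector
  by standard (simp_all add: fun_eq_iff scaleR_add_right scaleR_add_left)

lemma L2_integrable_mult:
  assumes "u \<in> L2 \<Omega>" "v \<in> L2 \<Omega>"
  shows "integrable (lebesgue_on \<Omega>) (\<lambda>x. u x * v x)"
proof (rule Bochner_Integration.integrable_bound)
  show "integrable (lebesgue_on \<Omega>) (\<lambda>x. (u x)\<^sup>2 + (v x)\<^sup>2)"
    using assms by (auto simp: L2_def)
  show "(\<lambda>x. u x * v x) \<in> borel_measurable (lebesgue_on \<Omega>)"
    using assms by (auto simp: L2_def)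
  show "AE x in lebesgue_on \<Omega>. norm (u x * v x) \<le> norm ((u x)\<^sup>2 + (v x)\<^sup>2)"
  proof (rule AE_I2)
    fix x
    have "0 \<le> (\<bar>u x\<bar> - \<bar>v x\<bar>)\<^sup>2" by simp
    then have "2 * (\<bar>u x\<bar> * \<bar>v x\<bar>) \<le> (u x)\<^sup>2 + (v x)\<^sup>2"
      by (simp add: power2_diff mult.assoc)
    moreover have "0 \<le> \<bar>u x\<bar> * \<bar>v x\<bar>" by simp
    ultimately have "\<bar>u x\<bar> * \<bar>v x\<bar> \<le> (u x)\<^sup>2 + (v x)\<^sup>2" by linarith
    then show "norm (u x * v x) \<le> norm ((u x)\<^sup>2 + (v x)\<^sup>2)"
      by (simp add: abs_mult)
  qed
qed

lemma subspace_L2: "subspace (L2 \<Omega>)"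
proof (rule subspaceI)
  show "0 \<in> L2 \<Omega>" by (simp add: L2_def zero_fun_def)
  fix u v assume uv: "u \<in> L2 \<Omega>" "v \<in> L2 \<Omega>"
  then have "integrable (lebesgue_on \<Omega>) (\<lambda>x. (u x)\<^sup>2 + 2 * (u x * v x) + (v x)\<^sup>2)"
    using L2_integrable_mult[OF uv] by (auto simp: L2_def)
  then show "u + v \<in> L2 \<Omega>" using uv
    by (auto simp: L2_def power2_eq_square algebra_simps plus_fun_def)
next
  fix c :: real and u assume "u \<in> L2 \<Omega>"
  then show "c *\<^sub>R u \<in> L2 \<Omega>"
    by (auto simp: L2_def scaleR_fun_def power_mult_distrib)
qed

lemma semi_inner_L2: "semi_inner (L2 \<Omega>) (L2_inner \<Omega>)"
proof
  fix u v w assume "u \<in> L2 \<Omega>" "v \<in> L2 \<Omega>" "w \<in> L2 \<Omega>"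
  then show "L2_inner \<Omega> (u + v) w = L2_inner \<Omega> u w + L2_inner \<Omega> v w"
    by (simp add: L2_inner_def distrib_right L2_integrable_mult Bochner_Integration.integral_add)
qed (auto simp: L2_inner_def subspace_L2 mult.assoc, simp add: mult.commute)

interpretation L2: semi_inner "L2 \<Omega>" "L2_inner \<Omega>" for \<Omega> :: "(real^'n) set"
  by (rule semi_inner_L2)

lemma L2_norm_eq_nrm: "L2_norm \<Omega> = L2.nrm \<Omega>"
  by (simp add: fun_eq_iff L2_norm_def L2.nrm_def)

lemma L2_inner_cong_AE:
  assumes "u \<in> L2 \<Omega>" "u' \<in> L2 \<Omega>" "v \<in> L2 \<Omega>" "v' \<in> L2 \<Omega>"
    and "AE x in lebesgue_on \<Omega>. u x = u' x" "AE x in lebesgue_on \<Omega>. v x = v' x"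
  shows "L2_inner \<Omega> u v = L2_inner \<Omega> u' v'"
  unfolding L2_inner_def
proof (rule integral_cong_AE)
  show "AE x in lebesgue_on \<Omega>. u x * v x = u' x * v' x"
    using assms(5,6) by eventually_elim simp
qed (use assms in \<open>auto simp: L2_def\<close>)

lemma L2_inner_self_eq_0_iff:
  assumes "u \<in> L2 \<Omega>"
  shows "L2_inner \<Omega> u u = 0 \<longleftrightarrow> (AE x in lebesgue_on \<Omega>. u x = 0)"
  using integral_nonneg_eq_0_iff_AE[OF L2_integrable_mult[OF assms assms]]
  by (auto simp: L2_inner_def)

lemma borel_measurable_lebesgue_on_AE:
  fixes u v :: "real^'n \<Rightarrow> real"
  assumes "u \<in> borel_measurable (lebesgue_on S)" "AE x in lebesgue_on S. u x = v x" "S \<in> sets lebesgue"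
  shows "v \<in> borel_measurable (lebesgue_on S)"
proof -
  have "(\<lambda>x. if x \<in> S then u x else 0) \<in> borel_measurable lebesgue"
    using assms by (simp add: borel_measurable_if)
  moreover have "AE x in lebesgue. (if x \<in> S then u x else 0) = (if x \<in> S then v x else 0)"
    using assms by (auto simp: AE_restrict_space_iff elim: AE_mp)
  ultimately have "(\<lambda>x. if x \<in> S then v x else 0) \<in> borel_measurable lebesgue"
    by (rule borel_measurable_AE[where g = "\<lambda>x. if x \<in> S then v x else 0"])
  then show ?thesis using assms by (simp add: borel_measurable_if)
qed

lemma L2_cong_AE:
  assumes "u \<in> L2 \<Omega>" "AE x in lebesgue_on \<Omega>. u x = v x" "\<Omega> \<in> sets lebesgue"
  shows "v \<in> L2 \<Omega>"
proof -
  have m: "v \<in> borel_measurable (lebesgue_on \<Omega>)"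
    using borel_measurable_lebesgue_on_AE[of u \<Omega> v] assms by (auto simp: L2_def)
  moreover have "integrable (lebesgue_on \<Omega>) (\<lambda>x. (v x)\<^sup>2)"
  proof (rule integrable_cong_AE_imp)
    show "AE x in lebesgue_on \<Omega>. (u x)\<^sup>2 = (v x)\<^sup>2" using assms(2) by eventually_elim simp
  qed (use assms m in \<open>auto simp: L2_def\<close>)
  ultimately show ?thesis by (simp add: L2_def)
qed

lemma bounded_measurable_in_L2:
  assumes "bounded \<Omega>" "\<Omega> \<in> sets lebesgue" "u \<in> borel_measurable (lebesgue_on \<Omega>)"
    and "\<And>x. x \<in> \<Omega> \<Longrightarrow> \<bar>u x\<bar> \<le> B"
  shows "u \<in> L2 \<Omega>"
proof -
  have "finite_measure (lebesgue_on \<Omega>)"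
    using assms(1,2) by (intro finite_measure_lebesgue_on bounded_set_imp_lmeasurable)
  then interpret finite_measure "lebesgue_on \<Omega>" .
  have "integrable (lebesgue_on \<Omega>) (\<lambda>x. (u x)\<^sup>2)"
  proof (rule integrable_const_bound)
    show "AE x in lebesgue_on \<Omega>. norm ((u x)\<^sup>2) \<le> B\<^sup>2"
      using assms(4) by (intro AE_I2) (auto simp: abs_le_square_iff[symmetric] intro: order_trans[OF _ abs_ge_self])
  qed (use assms in auto)
  then show ?thesis using assms by (simp add: L2_def)
qed

lemma bounded_mult_L2:
  assumes "u \<in> L2 \<Omega>" "v \<in> borel_measurable (lebesgue_on \<Omega>)" "AE x in lebesgue_on \<Omega>. \<bar>v x\<bar> \<le> B"
  shows "(\<lambda>x. v x * u x) \<in> L2 \<Omega>"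
proof -
  have "integrable (lebesgue_on \<Omega>) (\<lambda>x. (v x * u x)\<^sup>2)"
  proof (rule Bochner_Integration.integrable_bound)
    show "integrable (lebesgue_on \<Omega>) (\<lambda>x. B\<^sup>2 * (u x)\<^sup>2)" using assms by (auto simp: L2_def)
    show "AE x in lebesgue_on \<Omega>. norm ((v x * u x)\<^sup>2) \<le> norm (B\<^sup>2 * (u x)\<^sup>2)"
      using assms(3)
    proof eventually_elim
      case (elim x)
      then have "(v x)\<^sup>2 \<le> B\<^sup>2" by (meson abs_ge_self abs_le_square_iff order_trans)
      then show ?case by (simp add: power_mult_distrib mult_right_mono)
    qed
  qed (use assms in \<open>auto simp: L2_def\<close>)
  then show ?thesis using assms by (auto simp: L2_def)
qed

lemma L2_nrm_bounded_mult:
  assumes "u \<in> L2 \<Omega>" "v \<in> borel_measurable (lebesgue_on \<Omega>)" "AE x in lebesgue_on \<Omega>. \<bar>v x\<bar> \<le> B" "B \<ge> 0"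
  shows "L2.nrm \<Omega> (\<lambda>x. v x * u x) \<le> B * L2.nrm \<Omega> u"
proof -
  have L: "(\<lambda>x. v x * u x) \<in> L2 \<Omega>" by (rule bounded_mult_L2[OF assms(1-3)])
  have "L2_inner \<Omega> (\<lambda>x. v x * u x) (\<lambda>x. v x * u x) \<le> L2_inner \<Omega> (B *\<^sub>R u) (B *\<^sub>R u)"
    unfolding L2_inner_def
  proof (rule integral_mono_AE)
    show "integrable (lebesgue_on \<Omega>) (\<lambda>x. (B *\<^sub>R u) x * (B *\<^sub>R u) x)"
      using assms by (intro L2_integrable_mult L2.mem)
    show "AE x in lebesgue_on \<Omega>. v x * u x * (v x * u x) \<le> (B *\<^sub>R u) x * (B *\<^sub>R u) x"
      using assms(3)
    proof eventually_elim
      case (elim x)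
      then have "(v x)\<^sup>2 \<le> B\<^sup>2" by (meson abs_ge_self abs_le_square_iff order_trans)
      then have "(v x)\<^sup>2 * (u x)\<^sup>2 \<le> B\<^sup>2 * (u x)\<^sup>2" by (intro mult_right_mono) auto
      then show ?case by (simp add: power2_eq_square mult_ac)
    qed
  qed (rule L2_integrable_mult[OF L L])
  then have "L2.nrm \<Omega> (\<lambda>x. v x * u x) \<le> L2.nrm \<Omega> (B *\<^sub>R u)" by (simp add: L2.nrm_def)
  then show ?thesis using assms by (simp add: L2.nrm_scale)
qed

section \<open>Smooth functions and bumps\<close>

lemma partial_deriv_eq:
  assumes "(f has_derivative f') (at x)"
  shows "partial_deriv i f x = f' (axis i 1)"
  using assms by (simp add: partial_deriv_def frechet_derivative_at[symmetric])

lemma Ck_Suc_imp: "Ck (Suc k) f \<Longrightarrow> Ck k f"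
proof (induction k arbitrary: f)
  case 0
  then have "f differentiable_on UNIV"
    by (auto simp: differentiable_on_def)
  then show ?case by (simp add: differentiable_imp_continuous_on)
next
  case (Suc k)
  then show ?case by (metis Ck.simps(2))
qed

lemma Ck_const: "Ck k (\<lambda>x::real^'n. c)"
proof (induction k arbitrary: c)
  case (Suc k)
  have "partial_deriv i (\<lambda>x. c) = (\<lambda>x. 0)" for i :: 'n
    by (rule ext, subst partial_deriv_eq[OF has_derivative_const]) simp
  then show ?case using Suc by auto
qed auto

lemma Ck_add: "Ck k f \<Longrightarrow> Ck k g \<Longrightarrow> Ck k (\<lambda>x. f x + g x)"
proof (induction k arbitrary: f g)
  case (Suc k)
  have "partial_deriv i (\<lambda>x. f x + g x) = (\<lambda>x. partial_deriv i f x + partial_deriv i g x)" for i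
    using Suc.prems
    by (intro ext, subst partial_deriv_eq[OF has_derivative_add])
       (auto simp: frechet_derivative_works partial_deriv_def)
  then show ?case using Suc by (auto intro!: derivative_intros)
qed (auto intro: continuous_intros)

lemma partial_deriv_mult:
  assumes "f differentiable (at x)" "g differentiable (at x)"
  shows "partial_deriv i (\<lambda>x. f x * g x) x = f x * partial_deriv i g x + partial_deriv i f x * g x"
  using assms
  by (subst partial_deriv_eq[OF has_derivative_mult])
    (auto simp: frechet_derivative_works partial_deriv_def)

lemma Ck_mult: "Ck k f \<Longrightarrow> Ck k g \<Longrightarrow> Ck k (\<lambda>x. f x * g x)"
proof (induction k arbitrary: f g)
  case (Suc k)
  have "partial_deriv i (\<lambda>x. f x * g x) = (\<lambda>x. f x * partial_deriv i g x + partial_deriv i f x * g x)" for i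
    using Suc.prems by (intro ext partial_deriv_mult) auto
  moreover have "Ck k (\<lambda>x. f x * partial_deriv i g x + partial_deriv i f x * g x)" for i
    using Suc.prems by (intro Ck_add Suc.IH) (auto intro: Ck_Suc_imp)
  ultimately show ?case using Suc.prems by (auto intro!: derivative_intros)
qed (auto intro: continuous_intros)

lemma Ck_prod: "finite I \<Longrightarrow> (\<And>i. i \<in> I \<Longrightarrow> Ck k (f i)) \<Longrightarrow> Ck k (\<lambda>x. \<Prod>i\<in>I. f i x)"
  by (induction I rule: finite_induct) (auto intro: Ck_const Ck_mult)

lemma Ck_coordinate: "Ck k (\<lambda>x::real^'n. x $ i)"
proof (cases k)
  case 0
  then show ?thesis by (auto intro!: continuous_intros)
next
  case (Suc k)
  have d: "((\<lambda>x. x $ i) has_derivative (\<lambda>h. h $ i)) (at x)" for x :: "real^'n"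
    by (intro bounded_linear.has_derivative[OF bounded_linear_vec_nth] has_derivative_ident)
  have "partial_deriv j (\<lambda>x. x $ i) = (\<lambda>x. axis j 1 $ i)" for j :: 'n
    by (rule ext, rule partial_deriv_eq[OF d])
  then show ?thesis using Suc d Ck_const[of k] by (auto simp: differentiable_def)
qed

text \<open>
The functions \<open>p(1/s) exp (- 1/s)\<close>, extended by zero to \<open>s \<le> 0\<close>.  The polynomial factor makes the family
closed under differentiation, so that smoothness is a single induction over all polynomials.
\<close>

definition flat :: "real poly \<Rightarrow> real \<Rightarrow> real" where
  "flat p s = (if s > 0 then poly p (1 / s) * exp (- (1 / s)) else 0)"

lemma poly_div_exp_tendsto_0: "((\<lambda>y. poly p y * exp (- y)) \<longlongrightarrow> 0) at_top" for p :: "real poly"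
proof -
  have "((\<lambda>y. \<Sum>i\<le>degree p. coeff p i * (y ^ i / exp y)) \<longlongrightarrow> (\<Sum>i\<le>degree p. coeff p i * 0)) at_top"
    by (intro tendsto_intros tendsto_power_div_exp_0)
  then show ?thesis
    by (simp add: poly_altdef sum_distrib_right exp_minus divide_inverse mult.assoc)
qed

lemma flat_tendsto_0: "(flat p \<longlongrightarrow> 0) (at 0)"
proof -
  have "((\<lambda>s. poly p (1 / s) * exp (- (1 / s))) \<longlongrightarrow> 0) (at_right 0)"
    using filterlim_compose[OF poly_div_exp_tendsto_0[of p] filterlim_inverse_at_top_right]
    by (simp add: inverse_eq_divide)
  then have 1: "(flat p \<longlongrightarrow> 0) (at_right 0)"
    by (rule tendsto_cong[THEN iffD1, rotated]) (auto simp: flat_def eventually_at_filter)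
  have 2: "(flat p \<longlongrightarrow> 0) (at_left 0)"
    by (rule tendsto_eventually) (auto simp: flat_def eventually_at_filter)
  from 1 2 show ?thesis by (simp add: filterlim_at_split)
qed

text \<open>
At \<open>s = 0\<close> the difference quotient of \<open>flat p\<close> is the flat function of the polynomial \<open>X p\<close>, which
tends to zero.
\<close>

lemma flat_has_derivative:
  "(flat p has_real_derivative flat ([:0, 0, 1:] * (p - pderiv p)) s) (at s)"
proof -
  consider "s > 0" | "s < 0" | "s = 0" by linarith
  then show ?thesis
  proof cases
    case 1
    have "((\<lambda>s. poly p (1 / s) * exp (- (1 / s))) has_real_derivative
        flat ([:0, 0, 1:] * (p - pderiv p)) s) (at s)"
    proof -
      have inv: "((\<lambda>s. 1 / s) has_real_derivative - (1 / s\<^sup>2)) (at s)"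
        using 1 by (auto intro!: derivative_eq_intros simp: power2_eq_square)
      have e: "((\<lambda>s. exp (- (1 / s))) has_real_derivative exp (- (1 / s)) * (1 / s\<^sup>2)) (at s)"
        using DERIV_chain2[OF DERIV_exp DERIV_minus[OF inv]] by simp
      show ?thesis
        by (rule DERIV_cong[OF DERIV_mult[OF DERIV_chain2[OF poly_DERIV inv, of p] e]]) (use 1 in \<open>auto simp: flat_def field_simps power2_eq_square\<close>)
    qed
    then show ?thesis
      by (rule has_field_derivative_transform_within_open[of _ _ _ "{0<..}"]) (use 1 in \<open>auto simp: flat_def\<close>)
  next
    case 2
    have "((\<lambda>s. 0) has_real_derivative flat ([:0, 0, 1:] * (p - pderiv p)) s) (at s)"
      using 2 by (auto simp: flat_def)
    then show ?thesis
      by (rule has_field_derivative_transform_within_open[of _ _ _ "{..<0}"]) (use 2 in \<open>auto simp: flat_def\<close>)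
  next
    case 3
    have "((\<lambda>h. flat p h / h) \<longlongrightarrow> 0) (at 0)"
      by (rule tendsto_cong[THEN iffD1, OF _ flat_tendsto_0[of "[:0, 1:] * p"]])
        (auto simp: flat_def eventually_at_filter)
    then show ?thesis using 3
      by (simp add: has_field_derivative_iff flat_def)
  qed
qed

text \<open>
The derivative is a flat function again, times a constant.
\<close>

lemma Ck_flat: "Ck k (\<lambda>x. flat p (c * x $ i + d))"
proof (induction k arbitrary: p)
  case 0
  have "continuous_on UNIV (flat p)"
    by (intro DERIV_continuous_on) (auto intro: has_field_derivative_at_within flat_has_derivative)
  then have "continuous_on UNIV (\<lambda>x::real^'a. flat p (c * x $ i + d))"
    by (rule continuous_on_compose2) (auto intro!: continuous_intros)
  then show ?case by simp
next
  case (Suc k)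
  let ?q = "[:0, 0, 1:] * (p - pderiv p)"
  have d: "((\<lambda>x. flat p (c * x $ i + d)) has_derivative (\<lambda>h. flat ?q (c * x $ i + d) * (c * h $ i))) (at x)" for x :: "real^'a"
  proof -
    have 1: "((\<lambda>x. c * x $ i + d) has_derivative (\<lambda>h. c * h $ i)) (at x)"
      by (auto intro!: derivative_eq_intros bounded_linear.has_derivative[OF bounded_linear_vec_nth])
    have 2: "(flat p has_derivative (\<lambda>h. flat ?q (c * x $ i + d) * h)) (at (c * x $ i + d))"
      using flat_has_derivative[of p "c * x $ i + d"] by (simp only: has_field_derivative_def)
    show ?thesis using has_derivative_compose[OF 1 2] .
  qed
  have "partial_deriv j (\<lambda>x. flat p (c * x $ i + d)) = (\<lambda>x. flat ?q (c * x $ i + d) * (c * axis j 1 $ i))" for j :: 'a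
    by (rule ext, rule partial_deriv_eq[OF d])
  then show ?case using Suc d by (auto simp: differentiable_def intro!: Ck_mult Ck_const)
qed

text \<open>
A smooth function that is positive exactly on the open box between \<open>p\<close> and \<open>q\<close> (for \<open>n > 0\<close>).  As \<open>n\<close> grows, it
tends to the indicator of the box, since \<open>exp (- 1 / (n s))\<close> tends to \<open>1\<close> for \<open>s > 0\<close>.
\<close>

definition box_bump :: "nat \<Rightarrow> real^'n \<Rightarrow> real^'n \<Rightarrow> real^'n \<Rightarrow> real" where
  "box_bump n p q x = (\<Prod>i\<in>UNIV. flat 1 (real n * (x $ i - p $ i)) * flat 1 (real n * (q $ i - x $ i)))"

lemma flat_1_range: "0 \<le> flat 1 s" "flat 1 s \<le> 1"
  by (auto simp: flat_def)

lemma flat_1_limit: "(\<lambda>n. flat 1 (real n * s)) \<longlonglongrightarrow> (if s > 0 then 1 else 0)"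
proof (cases "s > 0")
  case True
  have "(\<lambda>n. exp (- (1 / s * inverse (real n)))) \<longlonglongrightarrow> exp (- (1 / s * 0))"
    by (intro tendsto_intros lim_inverse_n)
  then have "(\<lambda>n. exp (- (1 / s * inverse (real n)))) \<longlonglongrightarrow> 1" by simp
  moreover have "\<forall>\<^sub>F n in sequentially. exp (- (1 / s * inverse (real n))) = flat 1 (real n * s)"
    using eventually_gt_at_top[of 0]
    by eventually_elim (use True in \<open>simp add: flat_def field_simps\<close>)
  ultimately show ?thesis using True by (simp add: tendsto_cong)
next
  case False
  then have "flat 1 (real n * s) = 0" for n
    by (auto simp: flat_def zero_less_mult_iff)
  then show ?thesis using False by simp
qed

lemma box_bump_test_function:
  assumes "cbox p q \<subseteq> \<Omega>"
  shows "box_bump n p q \<in> test_functions \<Omega>"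
proof -
  have "Ck k (\<lambda>x::real^'a. flat 1 (real n * (x $ i - p $ i)))"
    "Ck k (\<lambda>x::real^'a. flat 1 (real n * (q $ i - x $ i)))" for k i
    using Ck_flat[of k 1 "real n" i "- real n * p $ i"] Ck_flat[of k 1 "- real n" i "real n * q $ i"]
    by (simp_all add: algebra_simps)
  then have Ck: "Ck k (box_bump n p q)" for k
    unfolding box_bump_def by (intro Ck_prod Ck_mult) auto
  have "x \<in> cbox p q" if nz: "box_bump n p q x \<noteq> 0" for x
  proof -
    have "flat 1 (real n * (x $ i - p $ i)) \<noteq> 0 \<and> flat 1 (real n * (q $ i - x $ i)) \<noteq> 0" for i
      using nz by (auto simp: box_bump_def)
    then have "real n * (x $ i - p $ i) > 0 \<and> real n * (q $ i - x $ i) > 0" for i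
      by (metis flat_def)
    then show ?thesis
      by (auto simp: mem_box_cart zero_less_mult_iff intro: less_imp_le)
  qed
  then have supp: "closure {x. box_bump n p q x \<noteq> 0} \<subseteq> cbox p q"
    by (intro closure_minimal) auto
  then have "compact (closure {x. box_bump n p q x \<noteq> 0})"
    by (meson bounded_cbox bounded_subset closed_closure compact_eq_bounded_closed)
  with Ck supp assms show ?thesis by (auto simp: test_functions_def)
qed

lemma box_bump_limit: "(\<lambda>n. box_bump n p q x) \<longlonglongrightarrow> indicator (box p q) x"
proof -
  have "(\<lambda>n. box_bump n p q x) \<longlonglongrightarrow>
     (\<Prod>i\<in>UNIV. (if x $ i - p $ i > 0 then 1 else 0) * (if q $ i - x $ i > 0 then 1 else 0))"
    unfolding box_bump_def by (intro tendsto_prod tendsto_mult flat_1_limit)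
  also have "(\<Prod>i\<in>UNIV. (if x $ i - p $ i > 0 then 1 else 0) * (if q $ i - x $ i > 0 then 1 else 0))
      = (indicator (box p q) x :: real)"
  proof (cases "x \<in> box p q")
    case True
    then show ?thesis by (simp add: mem_box_cart)
  next
    case False
    then obtain i where "\<not> (p $ i < x $ i \<and> x $ i < q $ i)" by (auto simp: mem_box_cart)
    then show ?thesis using False by (auto intro!: prod_zero)
  qed
  finally show ?thesis .
qed

lemma box_bump_bound: "\<bar>box_bump n p q x\<bar> \<le> 1"
  unfolding box_bump_def abs_prod
  by (intro prod_le_1) (auto simp: abs_mult flat_1_range intro!: mult_le_one)

section \<open>The fundamental lemma of the calculus of variations\<close>

lemma test_function_continuous: "\<phi> \<in> test_functions \<Omega> \<Longrightarrow> continuous_on UNIV \<phi>"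
  by (auto simp: test_functions_def dest: spec[of _ "0::nat"])

lemma test_function_differentiable: "\<phi> \<in> test_functions \<Omega> \<Longrightarrow> \<phi> differentiable (at x)"
proof -
  assume "\<phi> \<in> test_functions \<Omega>"
  then have "Ck (Suc 0) \<phi>" by (auto simp: test_functions_def)
  then show ?thesis by simp
qed

lemma test_function_partial_continuous:
  "\<phi> \<in> test_functions \<Omega> \<Longrightarrow> continuous_on UNIV (partial_deriv i \<phi>)"
proof -
  assume "\<phi> \<in> test_functions \<Omega>"
  then have "Ck (Suc 0) \<phi>" by (auto simp: test_functions_def)
  then show ?thesis by simp
qed

lemma continuous_in_L2:
  assumes "bounded \<Omega>" "open \<Omega>" "continuous_on UNIV u"
  shows "u \<in> L2 \<Omega>"
proof -
  have "compact (u ` closure \<Omega>)"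
    using assms by (intro compact_continuous_image) (auto intro: continuous_on_subset simp: compact_closure)
  then obtain B where "\<And>x. x \<in> closure \<Omega> \<Longrightarrow> \<bar>u x\<bar> \<le> B"
    by (metis (no_types, lifting) bounded_iff compact_imp_bounded image_eqI real_norm_def)
  moreover have "u \<in> borel_measurable (lebesgue_on \<Omega>)"
    using assms by (intro continuous_imp_measurable_on_sets_lebesgue) (auto intro: continuous_on_subset)
  ultimately show ?thesis
    using assms closure_subset by (intro bounded_measurable_in_L2[where B=B]) auto
qed

lemma L2_integrable:
  assumes "bounded \<Omega>" "open \<Omega>" "g \<in> L2 \<Omega>"
  shows "integrable (lebesgue_on \<Omega>) g"
  using L2_integrable_mult[OF assms(3) continuous_in_L2[OF assms(1,2), of "\<lambda>x. 1"]] by simp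

text \<open>
Bumps converge boundedly to indicators of boxes, so \<open>g\<close> has integral zero over every closed box in \<open>\<Omega>\<close>.  Almost every
point is a Lebesgue point with respect to small cubes, where \<open>g\<close> is the limit of such averages.
\<close>

lemma fundamental_lemma:
  fixes \<Omega> :: "(real^'n) set"
  assumes \<Omega>: "bounded \<Omega>" "open \<Omega>" and g: "g \<in> L2 \<Omega>"
    and 0: "\<And>\<psi>. \<psi> \<in> test_functions \<Omega> \<Longrightarrow> L2_inner \<Omega> g \<psi> = 0"
  shows "AE x in lebesgue_on \<Omega>. g x = 0"
proof -
  define f where "f x = (if x \<in> \<Omega> then g x else 0)" for x
  have S: "\<Omega> \<in> sets lebesgue" using \<Omega> by auto
  have gi: "integrable (lebesgue_on \<Omega>) g" by (rule L2_integrable[OF \<Omega> g])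
  then have fi: "integrable lebesgue f"
  proof -
    have "f = (\<lambda>x. indicator \<Omega> x *\<^sub>R g x)" by (auto simp: f_def fun_eq_iff)
    then show ?thesis using gi S by (simp add: integrable_restrict_space)
  qed
  then have "f absolutely_integrable_on UNIV"
    by (simp add: set_integrable_def)
  then have fint: "f absolutely_integrable_on cbox p q" for p q
    by (rule set_integrable_subset) auto
  have box0: "integral (cbox p q) f = 0" if "cbox p q \<subseteq> \<Omega>" for p q
  proof -
    have "(\<lambda>n. LINT x|lebesgue_on \<Omega>. g x * box_bump n p q x) \<longlonglongrightarrow> (LINT x|lebesgue_on \<Omega>. g x * indicator (box p q) x)"
    proof (rule integral_dominated_convergence[where w = "\<lambda>x. \<bar>g x\<bar>"])
      show "AE x in lebesgue_on \<Omega>. (\<lambda>n. g x * box_bump n p q x) \<longlonglongrightarrow> g x * indicator (box p q) x"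
        by (intro AE_I2 tendsto_intros box_bump_limit)
      show "AE x in lebesgue_on \<Omega>. norm (g x * box_bump n p q x) \<le> \<bar>g x\<bar>" for n
        using box_bump_bound by (intro AE_I2) (auto simp: abs_mult intro!: mult_left_le)
      show "(\<lambda>x. g x * indicator (box p q) x) \<in> borel_measurable (lebesgue_on \<Omega>)"
      proof (rule borel_measurable_times)
        have "(indicator (box p q) :: _ \<Rightarrow> real) \<in> borel_measurable lebesgue"
          by (rule borel_measurable_indicator) simp
        then show "(indicator (box p q) :: _ \<Rightarrow> real) \<in> borel_measurable (lebesgue_on \<Omega>)"
          by (rule measurable_restrict_space1)
      qed (use gi in auto)
      show "(\<lambda>x. g x * box_bump n p q x) \<in> borel_measurable (lebesgue_on \<Omega>)" for n
        using gi continuous_in_L2[OF \<Omega> test_function_continuous[OF box_bump_test_function[OF that]]]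
        by (intro borel_measurable_times) (auto simp: L2_def)
    qed (use gi in auto)
    then have "(\<lambda>n. 0) \<longlonglongrightarrow> (LINT x|lebesgue_on \<Omega>. g x * indicator (box p q) x)"
      using 0[OF box_bump_test_function[OF that]] by (simp add: L2_inner_def)
    then have "(LINT x|lebesgue_on \<Omega>. g x * indicator (box p q) x) = 0"
      by (simp add: LIMSEQ_const_iff)
    moreover have "(LINT x|lebesgue_on \<Omega>. g x * indicator (box p q) x)
        = (LINT x:box p q|lebesgue. f x)"
      using S by (auto simp: integral_restrict_space set_lebesgue_integral_def f_def indicator_def
          intro!: Bochner_Integration.integral_cong)
    moreover have "\<dots> = integral (box p q) f"
      using \<open>f absolutely_integrable_on UNIV\<close>
      by (intro set_lebesgue_integral_eq_integral(2)) (auto intro: set_integrable_subset)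
    ultimately show ?thesis by (simp add: integral_open_interval)
  qed
  \<comment> \<open>Outside a null set the averages over small cubes converge.\<close>
  obtain N where N: "negligible N"
     "\<And>x e. \<lbrakk>x \<notin> N; 0 < e\<rbrakk> \<Longrightarrow> \<exists>d>0. \<forall>h. 0 < h \<and> h < d \<longrightarrow>
         norm (integral (cbox x (x + h *\<^sub>R One)) f /\<^sub>R h ^ DIM(real^'n) - f x) < e"
    by (rule integrable_ccontinuous_explicit[of f])
      (use fint in \<open>auto intro: set_lebesgue_integral_eq_integral(1)\<close>)
  have "f x = 0" if x: "x \<in> \<Omega>" "x \<notin> N" for x
  proof (rule ccontr)
    assume "f x \<noteq> 0"
    then obtain d where d: "d > 0" "\<And>h. 0 < h \<Longrightarrow> h < d \<Longrightarrow>
         norm (integral (cbox x (x + h *\<^sub>R One)) f /\<^sub>R h ^ DIM(real^'n) - f x) < norm (f x)"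
      using N(2)[OF x(2), of "norm (f x)"] by auto
    obtain e where e: "e > 0" "ball x e \<subseteq> \<Omega>" using \<Omega> x by (meson openE)
    define c where "c = norm (One :: real^'n) + 1"
    have c: "c > 0" by (simp add: c_def add_nonneg_pos)
    define h where "h = min (d / 2) (e / (2 * c))"
    have h: "0 < h" "h < d" "h * c < e" using d(1) e(1) c
      by (auto simp: h_def min_def field_simps)
    have "cbox x (x + h *\<^sub>R One) \<subseteq> ball x e"
    proof
      fix y assume y: "y \<in> cbox x (x + h *\<^sub>R One)"
      have "norm (y - x) \<le> norm (h *\<^sub>R (One :: real^'n))"
        by (rule norm_le_componentwise)
          (use y h in \<open>auto simp: mem_box inner_diff_left inner_add_left algebra_simps dest!: bspec\<close>)
      also have "\<dots> \<le> h * c" using h by (simp add: c_def algebra_simps)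
      finally show "y \<in> ball x e" using h by (simp add: dist_norm norm_minus_commute)
    qed
    then have "integral (cbox x (x + h *\<^sub>R One)) f = 0" using box0 e by blast
    then show False using d(2)[OF h(1,2)] by simp
  qed
  then have "{x \<in> space lebesgue. \<not> (x \<in> \<Omega> \<longrightarrow> f x = 0)} \<subseteq> N" by auto
  moreover have "N \<in> null_sets lebesgue" using N(1) by (simp add: negligible_iff_null_sets)
  ultimately have "AE x in lebesgue. x \<in> \<Omega> \<longrightarrow> f x = 0" by (rule AE_I'[rotated])
  then show ?thesis using S by (auto simp: AE_restrict_space_iff f_def)
qed

section \<open>Integration by parts\<close>

lemma lborel_integral_translate:
  fixes f :: "'a::euclidean_space \<Rightarrow> real"
  assumes "f \<in> borel_measurable borel"
  shows "(LINT x|lborel. f (c + x)) = (LINT x|lborel. f x)"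
proof -
  have "(LINT x|lborel. f x) = (LINT x|distr lborel borel ((+) c). f x)"
    by (simp add: lborel_distr_plus)
  also have "\<dots> = (LINT x|lborel. f (c + x))"
    using assms by (subst integral_distr) auto
  finally show ?thesis by simp
qed

text \<open>
The integral of a difference quotient \<open>(f (x + h e) - f x) / h\<close> vanishes by translation invariance.  The quotients are bounded
by the maximum of the partial derivative and supported in a fixed ball, so dominated
convergence as \<open>h\<close> tends to zero gives the claim.
\<close>

lemma integral_partial_deriv_eq_0:
  fixes f :: "real^'n \<Rightarrow> real"
  assumes diff: "\<And>x. f differentiable (at x)" and cont: "continuous_on UNIV (partial_deriv i f)"
    and comp: "compact (closure {x. f x \<noteq> 0})"
  shows "integrable lborel (partial_deriv i f)" "(LINT x|lborel. partial_deriv i f x) = 0"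
proof -
  define e :: "real^'n" where "e = axis i 1"
  have e1: "norm e = 1" by (simp add: e_def)
  have line: "((\<lambda>s. f (x + s *\<^sub>R e)) has_real_derivative partial_deriv i f (x + s *\<^sub>R e)) (at s)" for x s
  proof -
    let ?y = "x + s *\<^sub>R e"
    have 1: "((\<lambda>s. x + s *\<^sub>R e) has_derivative (\<lambda>h. h *\<^sub>R e)) (at s)"
      by (auto intro!: derivative_eq_intros)
    have 2: "(f has_derivative frechet_derivative f (at ?y)) (at ?y)"
      using diff[of ?y] by (simp add: frechet_derivative_works)
    have "((\<lambda>s. f (x + s *\<^sub>R e)) has_derivative (\<lambda>h. frechet_derivative f (at ?y) (h *\<^sub>R e))) (at s)"
      using has_derivative_compose[OF 1 2] .
    moreover have "frechet_derivative f (at ?y) (h *\<^sub>R e) = partial_deriv i f ?y * h" for h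
      using linear_scale[OF has_derivative_linear[OF 2]] by (simp add: partial_deriv_def e_def)
    ultimately show ?thesis by (simp add: has_field_derivative_def)
  qed
  obtain R where R: "\<And>x. f x \<noteq> 0 \<Longrightarrow> norm x \<le> R"
    using compact_imp_bounded[OF comp] closure_subset by (metis (mono_tags, lifting) bounded_iff mem_Collect_eq subsetD)
  have f0: "f x = 0" if "norm x > R" for x using R[of x] that by fastforce
  define K where "K = cball (0::real^'n) (R + 1)"
  have fcont: "continuous_on UNIV f"
    using diff by (simp add: differentiable_imp_continuous_on differentiable_on_def)
  have pd0: "partial_deriv i f x = 0" if "norm x > R" for x
  proof -
    have "(f has_derivative (\<lambda>h. 0)) (at x)"
      by (rule has_derivative_transform_within_open[of "\<lambda>x. 0" _ _ UNIV "- cball 0 R"])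
        (use that f0 in \<open>auto simp: not_le\<close>)
    then show ?thesis by (simp add: partial_deriv_eq)
  qed
  have "compact (partial_deriv i f ` K)"
    by (intro compact_continuous_image continuous_on_subset[OF cont]) (auto simp: K_def)
  then obtain B where B: "\<And>x. x \<in> K \<Longrightarrow> \<bar>partial_deriv i f x\<bar> \<le> B"
    by (metis (no_types, lifting) bounded_iff compact_imp_bounded image_eqI real_norm_def)
  have Bx: "\<bar>partial_deriv i f x\<bar> \<le> \<bar>B\<bar>" for x
  proof (cases "x \<in> K")
    case True
    then show ?thesis using B[OF True] by linarith
  next
    case False
    then show ?thesis using pd0[of x] by (auto simp: K_def)
  qed
  have int: "integrable lborel g" if "continuous_on UNIV g" "\<And>x. norm x > R \<Longrightarrow> g x = 0" for g :: "real^'n \<Rightarrow> real"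
  proof -
    have "integrable lborel (\<lambda>x. indicator K x *\<^sub>R g x)"
      by (rule borel_integrable_compact) (auto simp: K_def intro: continuous_on_subset that)
    moreover have "(\<lambda>x. indicator K x *\<^sub>R g x) = g"
      using that(2) by (auto simp: fun_eq_iff indicator_def K_def)
    ultimately show ?thesis by simp
  qed
  show "integrable lborel (partial_deriv i f)" using int cont pd0 by blast
  \<comment> \<open>Difference quotients with increment \<open>1 / (n + 1)\<close>.\<close>
  define q where "q n x = real (Suc n) * (f ((1 / real (Suc n)) *\<^sub>R e + x) - f x)" for n x
  have fint: "integrable lborel f" using int fcont f0 by blast
  have qcont: "continuous_on UNIV (q n)" for n
    unfolding q_def by (intro continuous_intros continuous_on_compose2[OF fcont]) auto
  have f_shift: "integrable lborel (\<lambda>x. f (c + x))" for c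
  proof -
    have "integrable (distr lborel borel ((+) c)) f" using fint by (simp add: lborel_distr_plus)
    then show ?thesis by (subst (asm) integrable_distr_eq) (use fcont in \<open>auto intro: borel_measurable_continuous_onI\<close>)
  qed
  have q0: "(LINT x|lborel. q n x) = 0" for n
  proof -
    have "(LINT x|lborel. q n x) = real (Suc n) * ((LINT x|lborel. f ((1 / real (Suc n)) *\<^sub>R e + x)) - (LINT x|lborel. f x))"
      unfolding q_def using f_shift fint by simp
    then show ?thesis
      using lborel_integral_translate[OF borel_measurable_continuous_onI[OF fcont]] by simp
  qed
  have "(\<lambda>n. LINT x|lborel. q n x) \<longlonglongrightarrow> (LINT x|lborel. partial_deriv i f x)"
  proof (rule integral_dominated_convergence[where w = "\<lambda>x. indicator K x *\<^sub>R \<bar>B\<bar>"])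
    show "partial_deriv i f \<in> borel_measurable lborel"
      using borel_measurable_continuous_onI[OF cont] by simp
    show "q n \<in> borel_measurable lborel" for n
      using borel_measurable_continuous_onI[OF qcont] by simp
    show "integrable lborel (\<lambda>x. indicator K x *\<^sub>R \<bar>B\<bar>)"
      by (rule borel_integrable_compact) (auto simp: K_def)
    show "AE x in lborel. (\<lambda>n. q n x) \<longlonglongrightarrow> partial_deriv i f x"
    proof (rule AE_I2)
      fix x
      have "((\<lambda>h. (f (x + h *\<^sub>R e) - f x) / h) \<longlongrightarrow> partial_deriv i f x) (at 0)"
        using line[of x 0] by (simp add: has_field_derivative_iff)
      moreover have "filterlim (\<lambda>n. 1 / real (Suc n)) (at 0) sequentially"
        using LIMSEQ_inverse_real_of_nat by (auto simp: filterlim_at inverse_eq_divide)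
      ultimately have "(\<lambda>n. (f (x + (1 / real (Suc n)) *\<^sub>R e) - f x) / (1 / real (Suc n))) \<longlonglongrightarrow> partial_deriv i f x"
        by (rule filterlim_compose)
      then show "(\<lambda>n. q n x) \<longlonglongrightarrow> partial_deriv i f x"
        by (simp add: q_def mult.commute add.commute)
    qed
    show "AE x in lborel. norm (q n x) \<le> indicator K x *\<^sub>R \<bar>B\<bar>" for n
    proof (rule AE_I2)
      fix x
      let ?h = "1 / real (Suc n)"
      have h: "0 < ?h" "?h \<le> 1" by auto
      show "norm (q n x) \<le> indicator K x *\<^sub>R \<bar>B\<bar>"
      proof (cases "x \<in> K")
        case True
        obtain s where "f (x + ?h *\<^sub>R e) - f (x + 0 *\<^sub>R e) = (?h - 0) * partial_deriv i f (x + s *\<^sub>R e)"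
          using MVT2[OF h(1), of "\<lambda>s. f (x + s *\<^sub>R e)" "\<lambda>s. partial_deriv i f (x + s *\<^sub>R e)"] line by blast
        then have "f (?h *\<^sub>R e + x) - f x = ?h * partial_deriv i f (x + s *\<^sub>R e)"
          by (simp add: add.commute)
        then have "q n x = real (Suc n) * (?h * partial_deriv i f (x + s *\<^sub>R e))"
          unfolding q_def by (rule arg_cong)
        also have "\<dots> = partial_deriv i f (x + s *\<^sub>R e)" by simp
        finally have "q n x = partial_deriv i f (x + s *\<^sub>R e)" .
        then show ?thesis using Bx[of "x + s *\<^sub>R e"] True by simp
      next
        case False
        then have x: "norm x > R + 1" by (simp add: K_def)
        have "norm (?h *\<^sub>R e + x) \<ge> norm x - norm (?h *\<^sub>R e)"
          by (metis add.commute norm_diff_ineq)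
        moreover have "norm (?h *\<^sub>R e) \<le> 1" using e1 h by simp
        ultimately have "norm (?h *\<^sub>R e + x) > R" using x by linarith
        then have "q n x = 0" using f0 x by (simp add: q_def)
        then show ?thesis by simp
      qed
    qed
  qed
  then show "(LINT x|lborel. partial_deriv i f x) = 0"
    by (simp add: q0 LIMSEQ_const_iff)
qed

section \<open>Weak gradients\<close>

definition wgrad :: "(real^'n) set \<Rightarrow> 'n \<Rightarrow> (real^'n \<Rightarrow> real) \<Rightarrow> real^'n \<Rightarrow> real" where
  "wgrad \<Omega> i u = (\<lambda>x. weak_gradient \<Omega> u x $ i)"

lemma is_weak_gradient_weak_gradient: "u \<in> H1 \<Omega> \<Longrightarrow> is_weak_gradient \<Omega> u (weak_gradient \<Omega> u)"
  unfolding weak_gradient_def by (rule someI_ex[where P = "is_weak_gradient \<Omega> u"]) (simp add: H1_def)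

lemma wgrad_L2: "u \<in> H1 \<Omega> \<Longrightarrow> wgrad \<Omega> i u \<in> L2 \<Omega>"
  using is_weak_gradient_weak_gradient[of u \<Omega>] by (auto simp: is_weak_gradient_def wgrad_def)

lemma H1_L2: "u \<in> H1 \<Omega> \<Longrightarrow> u \<in> L2 \<Omega>"
  by (simp add: H1_def)

lemma test_function_L2:
  assumes "bounded \<Omega>" "open \<Omega>" "\<phi> \<in> test_functions \<Omega>"
  shows "\<phi> \<in> L2 \<Omega>" "partial_deriv i \<phi> \<in> L2 \<Omega>"
  by (intro continuous_in_L2 assms test_function_continuous[OF assms(3)] test_function_partial_continuous[OF assms(3)])+

text \<open>
Two weak gradients differ by a function orthogonal to all test functions.  As a consequence, the chosen representative \<open>weak_gradient\<close> depends linearly on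
the function, up to null sets.
\<close>

lemma weak_gradient_unique:
  assumes \<Omega>: "bounded \<Omega>" "open \<Omega>" and "is_weak_gradient \<Omega> u g" "is_weak_gradient \<Omega> u g'"
  shows "AE x in lebesgue_on \<Omega>. g x $ i = g' x $ i"
proof -
  let ?d = "(\<lambda>x. g x $ i) - (\<lambda>x. g' x $ i)"
  have L: "(\<lambda>x. g x $ i) \<in> L2 \<Omega>" "(\<lambda>x. g' x $ i) \<in> L2 \<Omega>"
    using assms by (auto simp: is_weak_gradient_def)
  have "AE x in lebesgue_on \<Omega>. ?d x = 0"
  proof (rule fundamental_lemma[OF \<Omega>])
    show "?d \<in> L2 \<Omega>" using L by auto
    fix \<psi> assume \<psi>: "\<psi> \<in> test_functions \<Omega>"
    then have "L2_inner \<Omega> (\<lambda>x. g x $ i) \<psi> = L2_inner \<Omega> (\<lambda>x. g' x $ i) \<psi>"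
      using assms(3,4) by (simp add: is_weak_gradient_def)
    then show "L2_inner \<Omega> ?d \<psi> = 0"
      using L test_function_L2[OF \<Omega> \<psi>] by (subst L2.diff_left) auto
  qed
  then show ?thesis by simp
qed

lemma wgrad_AE:
  assumes "bounded \<Omega>" "open \<Omega>" "u \<in> H1 \<Omega>" "is_weak_gradient \<Omega> u g"
  shows "AE x in lebesgue_on \<Omega>. wgrad \<Omega> i u x = g x $ i"
  unfolding wgrad_def
  by (rule weak_gradient_unique[OF assms(1,2) is_weak_gradient_weak_gradient[OF assms(3)] assms(4)])

lemma is_weak_gradient_zero:
  assumes "bounded \<Omega>" "open \<Omega>"
  shows "is_weak_gradient \<Omega> 0 (\<lambda>x. 0)"
  using test_function_L2[OF assms] L2.mem(1)[of \<Omega>]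
  by (auto simp: is_weak_gradient_def simp flip: zero_fun_def)

lemma is_weak_gradient_add:
  assumes \<Omega>: "bounded \<Omega>" "open \<Omega>" and "u \<in> L2 \<Omega>" "v \<in> L2 \<Omega>"
    and "is_weak_gradient \<Omega> u g" "is_weak_gradient \<Omega> v h"
  shows "is_weak_gradient \<Omega> (u + v) (\<lambda>x. g x + h x)"
  unfolding is_weak_gradient_def
proof (intro allI conjI ballI)
  fix i
  have L: "(\<lambda>x. g x $ i) \<in> L2 \<Omega>" "(\<lambda>x. h x $ i) \<in> L2 \<Omega>"
    using assms by (auto simp: is_weak_gradient_def)
  have e: "(\<lambda>x. (g x + h x) $ i) = (\<lambda>x. g x $ i) + (\<lambda>x. h x $ i)" by auto
  show "(\<lambda>x. (g x + h x) $ i) \<in> L2 \<Omega>" unfolding e using L by auto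
  fix \<psi> assume \<psi>: "\<psi> \<in> test_functions \<Omega>"
  note T = test_function_L2[OF \<Omega> \<psi>]
  show "L2_inner \<Omega> (u + v) (partial_deriv i \<psi>) = - L2_inner \<Omega> (\<lambda>x. (g x + h x) $ i) \<psi>"
    unfolding e using assms L T \<psi> by (simp add: L2.add_left is_weak_gradient_def)
qed

lemma is_weak_gradient_scale:
  assumes \<Omega>: "bounded \<Omega>" "open \<Omega>" and "u \<in> L2 \<Omega>" and "is_weak_gradient \<Omega> u g"
  shows "is_weak_gradient \<Omega> (c *\<^sub>R u) (\<lambda>x. c *\<^sub>R g x)"
  unfolding is_weak_gradient_def
proof (intro allI conjI ballI)
  fix i
  have L: "(\<lambda>x. g x $ i) \<in> L2 \<Omega>"
    using assms by (auto simp: is_weak_gradient_def)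
  have e: "(\<lambda>x. (c *\<^sub>R g x) $ i) = c *\<^sub>R (\<lambda>x. g x $ i)" by (auto simp: fun_eq_iff)
  show "(\<lambda>x. (c *\<^sub>R g x) $ i) \<in> L2 \<Omega>" unfolding e using L by auto
  fix \<psi> assume \<psi>: "\<psi> \<in> test_functions \<Omega>"
  note T = test_function_L2[OF \<Omega> \<psi>]
  show "L2_inner \<Omega> (c *\<^sub>R u) (partial_deriv i \<psi>) = - L2_inner \<Omega> (\<lambda>x. (c *\<^sub>R g x) $ i) \<psi>"
    unfolding e using assms L T \<psi> by (simp add: L2.scale_left is_weak_gradient_def)
qed

lemma is_weak_gradient_cong_AE:
  assumes \<Omega>: "bounded \<Omega>" "open \<Omega>" and "u \<in> L2 \<Omega>" "u' \<in> L2 \<Omega>"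
    and "AE x in lebesgue_on \<Omega>. u x = u' x" and g: "is_weak_gradient \<Omega> u g"
  shows "is_weak_gradient \<Omega> u' g"
proof -
  have "L2_inner \<Omega> u' (partial_deriv i \<psi>) = L2_inner \<Omega> u (partial_deriv i \<psi>)"
    if "\<psi> \<in> test_functions \<Omega>" for i \<psi>
    using assms test_function_L2[OF \<Omega> that] by (intro L2_inner_cong_AE) auto
  then show ?thesis using g by (simp add: is_weak_gradient_def)
qed

lemma H1_cong_AE:
  assumes \<Omega>: "bounded \<Omega>" "open \<Omega>" and "u \<in> H1 \<Omega>" "AE x in lebesgue_on \<Omega>. u x = u' x"
  shows "u' \<in> H1 \<Omega>"
proof -
  have "u' \<in> L2 \<Omega>" using L2_cong_AE[OF H1_L2[OF assms(3)] assms(4)] \<Omega> by auto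
  then show ?thesis
    using assms is_weak_gradient_cong_AE[OF \<Omega>] by (auto simp: H1_def)
qed

lemma wgrad_cong_AE:
  assumes \<Omega>: "bounded \<Omega>" "open \<Omega>" and "u \<in> H1 \<Omega>" "AE x in lebesgue_on \<Omega>. u x = u' x"
  shows "AE x in lebesgue_on \<Omega>. wgrad \<Omega> i u x = wgrad \<Omega> i u' x"
proof -
  have u': "u' \<in> H1 \<Omega>" by (rule H1_cong_AE[OF assms])
  have "is_weak_gradient \<Omega> u' (weak_gradient \<Omega> u)"
    by (rule is_weak_gradient_cong_AE[OF \<Omega> H1_L2 H1_L2 _ is_weak_gradient_weak_gradient]) (use assms u' in auto)
  from wgrad_AE[OF \<Omega> u' this, of i] show ?thesis by eventually_elim (simp add: wgrad_def)
qed

lemma subspace_H1: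
  assumes \<Omega>: "bounded \<Omega>" "open \<Omega>"
  shows "subspace (H1 \<Omega>)"
proof (rule subspaceI)
  show "0 \<in> H1 \<Omega>" using is_weak_gradient_zero[OF \<Omega>] by (auto simp: H1_def)
next
  fix u v assume "u \<in> H1 \<Omega>" "v \<in> H1 \<Omega>"
  then show "u + v \<in> H1 \<Omega>"
    using is_weak_gradient_add[OF \<Omega>, of u v] by (fastforce simp: H1_def)
next
  fix c :: real and u assume "u \<in> H1 \<Omega>"
  then show "c *\<^sub>R u \<in> H1 \<Omega>"
    using is_weak_gradient_scale[OF \<Omega>] by (auto simp: H1_def)
qed

lemma wgrad_add:
  assumes \<Omega>: "bounded \<Omega>" "open \<Omega>" and "u \<in> H1 \<Omega>" "v \<in> H1 \<Omega>"
  shows "AE x in lebesgue_on \<Omega>. wgrad \<Omega> i (u + v) x = wgrad \<Omega> i u x + wgrad \<Omega> i v x"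
  using wgrad_AE[OF \<Omega> subspace_add[OF subspace_H1[OF \<Omega>] assms(3,4)]
      is_weak_gradient_add[OF \<Omega> H1_L2[OF assms(3)] H1_L2[OF assms(4)]
        is_weak_gradient_weak_gradient[OF assms(3)] is_weak_gradient_weak_gradient[OF assms(4)]], of i]
  by eventually_elim (simp add: wgrad_def)

lemma wgrad_scale:
  assumes \<Omega>: "bounded \<Omega>" "open \<Omega>" and "u \<in> H1 \<Omega>"
  shows "AE x in lebesgue_on \<Omega>. wgrad \<Omega> i (c *\<^sub>R u) x = c * wgrad \<Omega> i u x"
  using wgrad_AE[OF \<Omega> subspace_scale[OF subspace_H1[OF \<Omega>] assms(3)]
      is_weak_gradient_scale[OF \<Omega> H1_L2[OF assms(3)] is_weak_gradient_weak_gradient[OF assms(3)]], of i]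
  by eventually_elim (simp add: wgrad_def)

definition dirichlet :: "(real^'n) set \<Rightarrow> (real^'n \<Rightarrow> real) \<Rightarrow> (real^'n \<Rightarrow> real) \<Rightarrow> real" where
  "dirichlet \<Omega> u v = (\<Sum>i\<in>UNIV. L2_inner \<Omega> (wgrad \<Omega> i u) (wgrad \<Omega> i v))"

lemma semi_inner_dirichlet:
  assumes \<Omega>: "bounded \<Omega>" "open \<Omega>"
  shows "semi_inner (H1 \<Omega>) (dirichlet \<Omega>)"
proof
  show "subspace (H1 \<Omega>)" by (rule subspace_H1[OF \<Omega>])
  note H = subspace_add[OF this] subspace_scale[OF this]
  fix u v w assume u: "u \<in> H1 \<Omega>" and v: "v \<in> H1 \<Omega>" and w: "w \<in> H1 \<Omega>"
  have "L2_inner \<Omega> (wgrad \<Omega> i (u + v)) (wgrad \<Omega> i w) = L2_inner \<Omega> (wgrad \<Omega> i u + wgrad \<Omega> i v) (wgrad \<Omega> i w)" for i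
    using wgrad_add[OF \<Omega> u v, of i] u v w by (intro L2_inner_cong_AE wgrad_L2 H L2.mem) auto
  then show "dirichlet \<Omega> (u + v) w = dirichlet \<Omega> u w + dirichlet \<Omega> v w"
    using u v w by (simp add: dirichlet_def L2.add_left wgrad_L2 sum.distrib)
next
  note H = subspace_scale[OF subspace_H1[OF \<Omega>]]
  fix u w c assume u: "u \<in> H1 \<Omega>" and w: "w \<in> H1 \<Omega>"
  have "L2_inner \<Omega> (wgrad \<Omega> i (c *\<^sub>R u)) (wgrad \<Omega> i w) = L2_inner \<Omega> (c *\<^sub>R wgrad \<Omega> i u) (wgrad \<Omega> i w)" for i
    using wgrad_scale[OF \<Omega> u, of i c] u w by (intro L2_inner_cong_AE wgrad_L2 H L2.mem) auto
  then show "dirichlet \<Omega> (c *\<^sub>R u) w = c * dirichlet \<Omega> u w"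
    using u w by (simp add: dirichlet_def L2.scale_left wgrad_L2 sum_distrib_left)
next
  fix u v assume "u \<in> H1 \<Omega>" "v \<in> H1 \<Omega>"
  then show "dirichlet \<Omega> u v = dirichlet \<Omega> v u"
    by (simp add: dirichlet_def L2.sym wgrad_L2)
next
  fix v assume "v \<in> H1 \<Omega>"
  then show "0 \<le> dirichlet \<Omega> v v"
    by (auto simp: dirichlet_def intro!: sum_nonneg L2.nonneg wgrad_L2)
qed

lemma wgrad_nrm_le:
  assumes "u \<in> H1 \<Omega>"
  shows "L2.nrm \<Omega> (wgrad \<Omega> i u) \<le> sqrt (dirichlet \<Omega> u u)"
  unfolding L2.nrm_def dirichlet_def
  by (intro real_sqrt_le_mono member_le_sum) (auto intro!: L2.nonneg wgrad_L2 assms)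

lemma semi_inner_H1:
  assumes \<Omega>: "bounded \<Omega>" "open \<Omega>"
  shows "semi_inner (H1 \<Omega>) (\<lambda>u v. L2_inner \<Omega> u v + dirichlet \<Omega> u v)"
proof -
  interpret D: semi_inner "H1 \<Omega>" "dirichlet \<Omega>" by (rule semi_inner_dirichlet[OF \<Omega>])
  show ?thesis
  proof
    fix u v assume "u \<in> H1 \<Omega>" "v \<in> H1 \<Omega>"
    then show "L2_inner \<Omega> u v + dirichlet \<Omega> u v = L2_inner \<Omega> v u + dirichlet \<Omega> v u"
      using D.sym[of u v] L2.sym[of u \<Omega> v] by (simp add: H1_L2)
  qed (auto simp: D.subspace D.bilinear_simps L2.bilinear_simps H1_L2 distrib_left D.nonneg L2.nonneg)
qed

lemma H1_norm_eq:
  assumes "u \<in> H1 \<Omega>"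
  shows "H1_norm \<Omega> u = sqrt (L2_inner \<Omega> u u + dirichlet \<Omega> u u)"
  using assms by (simp add: H1_norm_def L2_norm_eq_nrm L2.nrm_sq dirichlet_def wgrad_L2 H1_L2 flip: wgrad_def)

lemma H1_norm_triangle:
  assumes \<Omega>: "bounded \<Omega>" "open \<Omega>" and "u \<in> H1 \<Omega>" "v \<in> H1 \<Omega>"
  shows "H1_norm \<Omega> (u + v) \<le> H1_norm \<Omega> u + H1_norm \<Omega> v"
proof -
  interpret H: semi_inner "H1 \<Omega>" "\<lambda>u v. L2_inner \<Omega> u v + dirichlet \<Omega> u v" by (rule semi_inner_H1[OF \<Omega>])
  show ?thesis using H.nrm_triangle[OF assms(3,4)] assms by (simp add: H1_norm_eq H.nrm_def H.mem)
qed

lemma H1_norm_scale: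
  assumes \<Omega>: "bounded \<Omega>" "open \<Omega>" and "u \<in> H1 \<Omega>"
  shows "H1_norm \<Omega> (c *\<^sub>R u) = \<bar>c\<bar> * H1_norm \<Omega> u"
proof -
  interpret H: semi_inner "H1 \<Omega>" "\<lambda>u v. L2_inner \<Omega> u v + dirichlet \<Omega> u v" by (rule semi_inner_H1[OF \<Omega>])
  show ?thesis using H.nrm_scale[OF assms(3)] assms by (simp add: H1_norm_eq H.nrm_def H.mem)
qed

lemma H1_norm_nonneg: "0 \<le> H1_norm \<Omega> u"
  by (simp add: H1_norm_def sum_nonneg)

section \<open>Functions with zero boundary values\<close>

lemma test_function_vanishes: "\<phi> \<in> test_functions \<Omega> \<Longrightarrow> x \<notin> \<Omega> \<Longrightarrow> \<phi> x = 0"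
  using closure_subset[of "{x. \<phi> x \<noteq> 0}"] by (auto simp: test_functions_def)

lemma compact_support_subset:
  assumes "\<phi> \<in> test_functions \<Omega>" and "\<And>k. Ck k \<psi>" and "\<And>x. \<phi> x = 0 \<Longrightarrow> \<psi> x = 0"
  shows "\<psi> \<in> test_functions \<Omega>"
proof -
  have "closure {x. \<psi> x \<noteq> 0} \<subseteq> closure {x. \<phi> x \<noteq> 0}"
    using assms(3) by (intro closure_mono) auto
  moreover have "compact (closure {x. \<psi> x \<noteq> 0})"
    using assms(1) calculation
    by (metis (mono_tags, lifting) closed_closure compact_Int_closed inf.absorb_iff2 mem_Collect_eq test_functions_def)
  ultimately show ?thesis using assms by (auto simp: test_functions_def)
qed

lemma test_function_mult:
  assumes "\<phi> \<in> test_functions \<Omega>" "\<And>k. Ck k \<psi>"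
  shows "(\<lambda>x. \<psi> x * \<phi> x) \<in> test_functions \<Omega>"
  by (rule compact_support_subset[OF assms(1)]) (use assms in \<open>auto simp: test_functions_def intro: Ck_mult\<close>)

lemma test_function_add:
  assumes "\<phi> \<in> test_functions \<Omega>" "\<psi> \<in> test_functions \<Omega>"
  shows "\<phi> + \<psi> \<in> test_functions \<Omega>"
proof -
  let ?S = "closure {x. \<phi> x \<noteq> 0} \<union> closure {x. \<psi> x \<noteq> 0}"
  have sub: "closure {x. (\<phi> + \<psi>) x \<noteq> 0} \<subseteq> ?S"
  proof (rule closure_minimal)
    have "{x. (\<phi> + \<psi>) x \<noteq> 0} \<subseteq> {x. \<phi> x \<noteq> 0} \<union> {x. \<psi> x \<noteq> 0}" by auto
    then show "{x. (\<phi> + \<psi>) x \<noteq> 0} \<subseteq> ?S"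
      using closure_subset[of "{x. \<phi> x \<noteq> 0}"] closure_subset[of "{x. \<psi> x \<noteq> 0}"] by blast
  qed auto
  have "compact ?S" using assms by (auto simp: test_functions_def)
  then have "compact (closure {x. (\<phi> + \<psi>) x \<noteq> 0})"
    using sub by (metis closed_closure compact_Int_closed inf.absorb_iff2)
  moreover have "Ck k (\<phi> + \<psi>)" for k
    using Ck_add[of k \<phi> \<psi>] assms by (simp add: test_functions_def plus_fun_def)
  ultimately show ?thesis using sub assms by (auto simp: test_functions_def)
qed

lemma test_function_scale:
  assumes "\<phi> \<in> test_functions \<Omega>"
  shows "c *\<^sub>R \<phi> \<in> test_functions \<Omega>"
  using test_function_mult[OF assms Ck_const, of c] by (simp add: scaleR_fun_def)

text \<open>
The product of two test functions has compact support in \<open>\<Omega>\<close>, so the integral of its partial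
derivative vanishes.
\<close>

lemma classical_gradient_weak:
  fixes \<Omega> :: "(real^'n) set"
  assumes \<Omega>: "bounded \<Omega>" "open \<Omega>" and \<phi>: "\<phi> \<in> test_functions \<Omega>"
  shows "is_weak_gradient \<Omega> \<phi> (\<lambda>x. \<chi> i. partial_deriv i \<phi> x)"
  unfolding is_weak_gradient_def
proof (intro allI conjI ballI)
  fix i
  show "(\<lambda>x. (\<chi> i. partial_deriv i \<phi> x) $ i) \<in> L2 \<Omega>"
    using test_function_L2[OF \<Omega> \<phi>] by simp
  fix \<psi> assume \<psi>: "\<psi> \<in> test_functions \<Omega>"
  note L = test_function_L2[OF \<Omega> \<phi>] test_function_L2[OF \<Omega> \<psi>]
  define f where "f x = \<phi> x * \<psi> x" for x
  have f: "f \<in> test_functions \<Omega>"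
    unfolding f_def using \<phi> by (intro test_function_mult[OF \<psi>]) (auto simp: test_functions_def)
  have pd: "partial_deriv i f = (\<lambda>x. \<phi> x * partial_deriv i \<psi> x + partial_deriv i \<phi> x * \<psi> x)"
    unfolding f_def by (intro ext partial_deriv_mult test_function_differentiable[OF \<phi>] test_function_differentiable[OF \<psi>])
  have out: "partial_deriv i f x = 0" if "x \<notin> \<Omega>" for x
    using that \<phi> \<psi> by (simp add: pd test_function_vanishes)
  have cont: "continuous_on UNIV (partial_deriv i f)" by (rule test_function_partial_continuous[OF f])
  have "0 = (LINT x|lborel. partial_deriv i f x)"
    using integral_partial_deriv_eq_0(2)[OF test_function_differentiable[OF f] cont] f
    by (simp add: test_functions_def)
  also have "\<dots> = (LINT x|lebesgue. partial_deriv i f x)"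
    using borel_measurable_continuous_onI[OF cont] by (simp add: integral_completion)
  also have "\<dots> = (LINT x|lebesgue. indicator \<Omega> x *\<^sub>R partial_deriv i f x)"
    by (rule Bochner_Integration.integral_cong) (auto simp: indicator_def out)
  also have "\<dots> = (LINT x|lebesgue_on \<Omega>. partial_deriv i f x)"
    using \<Omega> by (subst integral_restrict_space) auto
  also have "\<dots> = L2_inner \<Omega> \<phi> (partial_deriv i \<psi>) + L2_inner \<Omega> (partial_deriv i \<phi>) \<psi>"
    unfolding pd L2_inner_def using L by (simp add: L2_integrable_mult)
  finally show "L2_inner \<Omega> \<phi> (partial_deriv i \<psi>) = - L2_inner \<Omega> (\<lambda>x. (\<chi> i. partial_deriv i \<phi> x) $ i) \<psi>"
    by simp
qed

lemma test_function_H1: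
  assumes "bounded \<Omega>" "open \<Omega>" "\<phi> \<in> test_functions \<Omega>"
  shows "\<phi> \<in> H1 \<Omega>"
  using assms classical_gradient_weak[OF assms] test_function_L2[OF assms] by (auto simp: H1_def)

lemma H10_H1: "u \<in> H10 \<Omega> \<Longrightarrow> u \<in> H1 \<Omega>"
  by (simp add: H10_def)

lemma H10_iff: "u \<in> H10 \<Omega> \<longleftrightarrow> u \<in> H1 \<Omega> \<and>
    (\<exists>\<phi>. (\<forall>n. \<phi> n \<in> test_functions \<Omega>) \<and> (\<lambda>n. H1_norm \<Omega> (u - \<phi> n)) \<longlonglongrightarrow> 0)"
  by (simp add: H10_def fun_diff_def)

lemma subspace_H10:
  fixes \<Omega> :: "(real^'n) set"
  assumes \<Omega>: "bounded \<Omega>" "open \<Omega>"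
  shows "subspace (H10 \<Omega>)"
proof (rule subspaceI)
  note H = subspace_H1[OF \<Omega>]
  have "\<forall>k. Ck k (0 :: real^'n \<Rightarrow> real)" by (simp add: zero_fun_def Ck_const)
  then have "0 \<in> test_functions \<Omega>" by (auto simp: test_functions_def)
  moreover have "H1_norm \<Omega> 0 = 0"
    using H1_norm_scale[OF \<Omega> subspace_0[OF H], of 0] by simp
  ultimately show "0 \<in> H10 \<Omega>"
    unfolding H10_iff using subspace_0[OF H] by (auto intro!: exI[of _ "\<lambda>n. 0"])
next
  note H = subspace_H1[OF \<Omega>]
  fix u v assume "u \<in> H10 \<Omega>" "v \<in> H10 \<Omega>"
  then obtain \<phi> \<psi> where *: "u \<in> H1 \<Omega>" "v \<in> H1 \<Omega>" "\<And>n. \<phi> n \<in> test_functions \<Omega>" "\<And>n. \<psi> n \<in> test_functions \<Omega>"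
    "(\<lambda>n. H1_norm \<Omega> (u - \<phi> n)) \<longlonglongrightarrow> 0" "(\<lambda>n. H1_norm \<Omega> (v - \<psi> n)) \<longlonglongrightarrow> 0"
    by (auto simp: H10_iff)
  have D: "u - \<phi> n \<in> H1 \<Omega>" "v - \<psi> n \<in> H1 \<Omega>" "(u + v) - (\<phi> n + \<psi> n) \<in> H1 \<Omega>" for n
    using * test_function_H1[OF \<Omega>] by (auto intro!: subspace_diff[OF H] subspace_add[OF H])
  have "(\<lambda>n. H1_norm \<Omega> ((u + v) - (\<phi> n + \<psi> n))) \<longlonglongrightarrow> 0"
  proof (rule tendsto_sandwich[OF always_eventually always_eventually tendsto_const])
    show "(\<lambda>n. H1_norm \<Omega> (u - \<phi> n) + H1_norm \<Omega> (v - \<psi> n)) \<longlonglongrightarrow> 0"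
      using tendsto_add[OF *(5,6)] by simp
    have e: "(u + v) - (\<phi> n + \<psi> n) = (u - \<phi> n) + (v - \<psi> n)" for n by simp
    show "\<forall>n. H1_norm \<Omega> ((u + v) - (\<phi> n + \<psi> n)) \<le> H1_norm \<Omega> (u - \<phi> n) + H1_norm \<Omega> (v - \<psi> n)"
      unfolding e using D by (auto intro: H1_norm_triangle[OF \<Omega>])
  qed (use H1_norm_nonneg in blast)
  moreover have "\<phi> n + \<psi> n \<in> test_functions \<Omega>" for n using * by (intro test_function_add)
  ultimately show "u + v \<in> H10 \<Omega>"
    unfolding H10_iff using * subspace_add[OF H] by (auto intro!: exI[of _ "\<lambda>n. \<phi> n + \<psi> n"])
next
  note H = subspace_H1[OF \<Omega>]
  fix c :: real and u assume "u \<in> H10 \<Omega>"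
  then obtain \<phi> where *: "u \<in> H1 \<Omega>" "\<And>n. \<phi> n \<in> test_functions \<Omega>" "(\<lambda>n. H1_norm \<Omega> (u - \<phi> n)) \<longlonglongrightarrow> 0"
    by (auto simp: H10_iff)
  have "H1_norm \<Omega> (c *\<^sub>R u - c *\<^sub>R \<phi> n) = \<bar>c\<bar> * H1_norm \<Omega> (u - \<phi> n)" for n
    using H1_norm_scale[OF \<Omega>, of "u - \<phi> n" c] * test_function_H1[OF \<Omega>] subspace_diff[OF H]
    by (simp add: scaleR_diff_right)
  then have "(\<lambda>n. H1_norm \<Omega> (c *\<^sub>R u - c *\<^sub>R \<phi> n)) \<longlonglongrightarrow> 0"
    using tendsto_mult_right_zero[OF *(3)] by simp
  moreover have "c *\<^sub>R \<phi> n \<in> test_functions \<Omega>" for n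
    by (rule test_function_scale[OF *(2)])
  ultimately show "c *\<^sub>R u \<in> H10 \<Omega>"
    unfolding H10_iff using * subspace_scale[OF H] by (intro conjI exI[of _ "\<lambda>n. c *\<^sub>R \<phi> n"]) auto
qed

text \<open>
Membership depends on the almost everywhere class only, as the same approximating test functions serve.
\<close>

lemma H10_cong_AE:
  assumes \<Omega>: "bounded \<Omega>" "open \<Omega>" and u: "u \<in> H10 \<Omega>" and ae: "AE x in lebesgue_on \<Omega>. u x = u' x"
  shows "u' \<in> H10 \<Omega>"
proof -
  note H = subspace_H1[OF \<Omega>]
  obtain \<phi> where *: "u \<in> H1 \<Omega>" "\<And>n. \<phi> n \<in> test_functions \<Omega>" "(\<lambda>n. H1_norm \<Omega> (u - \<phi> n)) \<longlonglongrightarrow> 0"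
    using u by (auto simp: H10_iff)
  have u': "u' \<in> H1 \<Omega>" by (rule H1_cong_AE[OF \<Omega> *(1) ae])
  have "H1_norm \<Omega> (u' - \<phi> n) = H1_norm \<Omega> (u - \<phi> n)" for n
  proof -
    have D: "u - \<phi> n \<in> H1 \<Omega>" "u' - \<phi> n \<in> H1 \<Omega>"
      using * u' test_function_H1[OF \<Omega>] subspace_diff[OF H] by auto
    have ae': "AE x in lebesgue_on \<Omega>. (u - \<phi> n) x = (u' - \<phi> n) x"
      using ae by eventually_elim simp
    have "L2_inner \<Omega> (u - \<phi> n) (u - \<phi> n) = L2_inner \<Omega> (u' - \<phi> n) (u' - \<phi> n)"
      by (intro L2_inner_cong_AE H1_L2 D ae')
    moreover have "dirichlet \<Omega> (u - \<phi> n) (u - \<phi> n) = dirichlet \<Omega> (u' - \<phi> n) (u' - \<phi> n)"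
      unfolding dirichlet_def
      by (intro sum.cong L2_inner_cong_AE wgrad_L2 D wgrad_cong_AE[OF \<Omega> D(1) ae'] refl)
    ultimately show ?thesis using D by (simp add: H1_norm_eq)
  qed
  then show ?thesis unfolding H10_iff using * u' by (intro conjI exI[of _ \<phi>]) auto
qed

section \<open>The Poincare inequality\<close>

text \<open>
Test the weak derivative of \<open>\<phi>\<close> with \<open>x\<^sub>i \<phi>\<close>: since \<open>\<partial>\<^sub>i (x\<^sub>i \<phi>) = \<phi> + x\<^sub>i \<partial>\<^sub>i \<phi>\<close>, it follows that
\<open>|\<phi>|\<^sup>2 = - 2 (\<partial>\<^sub>i \<phi>, x\<^sub>i \<phi>)\<close>, and \<open>x\<^sub>i\<close> is bounded by \<open>R\<close> on \<open>\<Omega>\<close>.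
\<close>

lemma poincare_test_function:
  fixes \<Omega> :: "(real^'n) set"
  assumes \<Omega>: "bounded \<Omega>" "open \<Omega>" and \<phi>: "\<phi> \<in> test_functions \<Omega>"
    and R: "\<And>x. x \<in> \<Omega> \<Longrightarrow> norm x \<le> R" and R0: "R \<ge> 0"
  shows "L2.nrm \<Omega> \<phi> \<le> 2 * R * L2.nrm \<Omega> (partial_deriv i \<phi>)"
proof (cases "L2.nrm \<Omega> \<phi> = 0")
  case True
  then show ?thesis using test_function_L2[OF \<Omega> \<phi>] R0 by simp
next
  case False
  note L = test_function_L2[OF \<Omega> \<phi>]
  define \<psi> where "\<psi> x = x $ i * \<phi> x" for x
  have \<psi>: "\<psi> \<in> test_functions \<Omega>"
    unfolding \<psi>_def by (intro test_function_mult \<phi> Ck_coordinate)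
  have dc: "((\<lambda>x. x $ i) has_derivative (\<lambda>h. h $ i)) (at x)" for x :: "real^'n"
    by (intro bounded_linear.has_derivative[OF bounded_linear_vec_nth] has_derivative_ident)
  then have pc: "partial_deriv i (\<lambda>x. x $ i) x = 1" "(\<lambda>x. x $ i) differentiable (at x)" for x :: "real^'n"
    using partial_deriv_eq[OF dc, of i] by (auto simp: differentiable_def intro: dc)
  define \<theta> where "\<theta> x = x $ i * partial_deriv i \<phi> x" for x
  have pd: "partial_deriv i \<psi> = \<theta> + \<phi>"
    unfolding \<psi>_def \<theta>_def
    by (rule ext) (simp add: partial_deriv_mult[OF pc(2) test_function_differentiable[OF \<phi>]] pc(1))
  have \<theta>L: "\<theta> \<in> L2 \<Omega>"
    unfolding \<theta>_def
    by (intro continuous_in_L2 \<Omega> continuous_intros test_function_partial_continuous[OF \<phi>])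
  have \<psi>L: "\<psi> \<in> L2 \<Omega>" by (rule test_function_L2[OF \<Omega> \<psi>])
  have \<psi>_le: "L2.nrm \<Omega> \<psi> \<le> R * L2.nrm \<Omega> \<phi>"
  proof -
    have "L2_inner \<Omega> \<psi> \<psi> \<le> L2_inner \<Omega> (R *\<^sub>R \<phi>) (R *\<^sub>R \<phi>)"
      unfolding L2_inner_def
    proof (rule integral_mono)
      show "integrable (lebesgue_on \<Omega>) (\<lambda>x. \<psi> x * \<psi> x)" by (rule L2_integrable_mult[OF \<psi>L \<psi>L])
      show "integrable (lebesgue_on \<Omega>) (\<lambda>x. (R *\<^sub>R \<phi>) x * (R *\<^sub>R \<phi>) x)"
        using L by (intro L2_integrable_mult L2.mem)
      fix x assume "x \<in> space (lebesgue_on \<Omega>)"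
      then have "\<bar>x $ i\<bar> \<le> R" using R[of x] component_le_norm_cart[of x i] by auto
      then have "(x $ i)\<^sup>2 \<le> R\<^sup>2" using R0 by (simp add: abs_le_square_iff[symmetric])
      then have "(x $ i)\<^sup>2 * (\<phi> x)\<^sup>2 \<le> R\<^sup>2 * (\<phi> x)\<^sup>2" by (intro mult_right_mono) auto
      then show "\<psi> x * \<psi> x \<le> (R *\<^sub>R \<phi>) x * (R *\<^sub>R \<phi>) x"
        by (simp add: \<psi>_def power2_eq_square mult_ac)
    qed
    then have "L2.nrm \<Omega> \<psi> \<le> L2.nrm \<Omega> (R *\<^sub>R \<phi>)" by (simp add: L2.nrm_def)
    then show ?thesis using L R0 by (simp add: L2.nrm_scale)
  qed
  have "L2_inner \<Omega> \<phi> (\<theta> + \<phi>) = - L2_inner \<Omega> (partial_deriv i \<phi>) \<psi>"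
    using classical_gradient_weak[OF \<Omega> \<phi>] \<psi> by (simp add: is_weak_gradient_def flip: pd)
  moreover have "L2_inner \<Omega> \<phi> \<theta> = L2_inner \<Omega> (partial_deriv i \<phi>) \<psi>"
    unfolding L2_inner_def \<psi>_def \<theta>_def by (simp add: mult_ac)
  ultimately have "L2_inner \<Omega> \<phi> \<phi> = - 2 * L2_inner \<Omega> (partial_deriv i \<phi>) \<psi>"
    using L \<theta>L by (simp add: L2.add_right)
  also have "\<dots> \<le> 2 * (L2.nrm \<Omega> (partial_deriv i \<phi>) * L2.nrm \<Omega> \<psi>)"
    using L2.cauchy_schwarz[OF L(2) \<psi>L, of i] by linarith
  also have "\<dots> \<le> 2 * (L2.nrm \<Omega> (partial_deriv i \<phi>) * (R * L2.nrm \<Omega> \<phi>))"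
    using \<psi>_le L by (intro mult_left_mono) auto
  finally have "L2.nrm \<Omega> \<phi> * L2.nrm \<Omega> \<phi> \<le> (2 * R * L2.nrm \<Omega> (partial_deriv i \<phi>)) * L2.nrm \<Omega> \<phi>"
    using L L2.nrm_sq[OF L(1)] by (simp add: power2_eq_square mult_ac)
  moreover have "L2.nrm \<Omega> \<phi> > 0" using False L2.nrm_nonneg[OF L(1)] by linarith
  ultimately show ?thesis by simp
qed

text \<open>
Passage to the limit along approximating test functions, in any one coordinate direction \<open>i\<close>.
\<close>

lemma poincare_H10:
  fixes \<Omega> :: "(real^'n) set"
  assumes \<Omega>: "bounded \<Omega>" "open \<Omega>" and u: "u \<in> H10 \<Omega>"
    and R: "\<And>x. x \<in> \<Omega> \<Longrightarrow> norm x \<le> R" and R0: "R \<ge> 0"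
  shows "L2.nrm \<Omega> u \<le> 2 * R * sqrt (dirichlet \<Omega> u u)"
proof -
  note H = subspace_H1[OF \<Omega>]
  obtain \<phi> where *: "u \<in> H1 \<Omega>" "\<And>n. \<phi> n \<in> test_functions \<Omega>" "(\<lambda>n. H1_norm \<Omega> (u - \<phi> n)) \<longlonglongrightarrow> 0"
    using u by (auto simp: H10_iff)
  define i :: 'n where "i = undefined"
  interpret D: semi_inner "H1 \<Omega>" "dirichlet \<Omega>" by (rule semi_inner_dirichlet[OF \<Omega>])
  have bound: "L2.nrm \<Omega> u \<le> 2 * R * sqrt (dirichlet \<Omega> u u) + (1 + 2 * R) * H1_norm \<Omega> (u - \<phi> n)" for n
  proof -
    have \<phi>H: "\<phi> n \<in> H1 \<Omega>" by (rule test_function_H1[OF \<Omega> *(2)])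
    have d: "u - \<phi> n \<in> H1 \<Omega>" using * \<phi>H D.mem by auto
    have n1: "L2.nrm \<Omega> (u - \<phi> n) \<le> H1_norm \<Omega> (u - \<phi> n)"
      using d D.nonneg[OF d] by (simp add: H1_norm_eq L2.nrm_def)
    have n2: "sqrt (dirichlet \<Omega> (u - \<phi> n) (u - \<phi> n)) \<le> H1_norm \<Omega> (u - \<phi> n)"
      using d L2.nonneg[OF H1_L2[OF d]] by (simp add: H1_norm_eq)
    have "L2.nrm \<Omega> (partial_deriv i (\<phi> n)) = L2.nrm \<Omega> (wgrad \<Omega> i (\<phi> n))"
      using wgrad_AE[OF \<Omega> \<phi>H classical_gradient_weak[OF \<Omega> *(2)], of i] wgrad_L2[OF \<phi>H] test_function_L2[OF \<Omega> *(2)]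
      by (auto simp: L2.nrm_def intro!: L2_inner_cong_AE elim: eventually_mono)
    also have "\<dots> \<le> D.nrm (\<phi> n)" using wgrad_nrm_le[OF \<phi>H, of i] by (simp add: D.nrm_def)
    also have "\<dots> \<le> D.nrm u + D.nrm (u - \<phi> n)"
      using D.nrm_triangle[of u "- 1 *\<^sub>R (u - \<phi> n)"] D.nrm_scale[OF d, of "-1"] *(1) d D.mem(4)[OF d, of "-1"] by simp
    also have "\<dots> \<le> sqrt (dirichlet \<Omega> u u) + H1_norm \<Omega> (u - \<phi> n)"
      using n2 by (simp add: D.nrm_def)
    finally have g: "L2.nrm \<Omega> (partial_deriv i (\<phi> n)) \<le> sqrt (dirichlet \<Omega> u u) + H1_norm \<Omega> (u - \<phi> n)" .
    have "L2.nrm \<Omega> u \<le> L2.nrm \<Omega> (u - \<phi> n) + L2.nrm \<Omega> (\<phi> n)"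
      using L2.nrm_triangle[of "u - \<phi> n" \<Omega> "\<phi> n"] H1_L2[OF d] H1_L2[OF \<phi>H] by simp
    also have "\<dots> \<le> H1_norm \<Omega> (u - \<phi> n) + 2 * R * L2.nrm \<Omega> (partial_deriv i (\<phi> n))"
      using n1 poincare_test_function[OF \<Omega> *(2) R R0] by (intro add_mono) auto
    also have "\<dots> \<le> H1_norm \<Omega> (u - \<phi> n) + 2 * R * (sqrt (dirichlet \<Omega> u u) + H1_norm \<Omega> (u - \<phi> n))"
      using g R0 by (intro add_left_mono mult_left_mono) auto
    finally show ?thesis by (simp add: algebra_simps)
  qed
  have "(\<lambda>n. 2 * R * sqrt (dirichlet \<Omega> u u) + (1 + 2 * R) * H1_norm \<Omega> (u - \<phi> n))
      \<longlonglongrightarrow> 2 * R * sqrt (dirichlet \<Omega> u u) + (1 + 2 * R) * 0"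
    by (intro tendsto_intros *(3))
  from LIMSEQ_le_const[OF this] bound show ?thesis by auto
qed

section \<open>Time slices of the coefficients\<close>

text \<open>
Fubini for null sets: Lebesgue measure on the product space has the null sets of the completed product of
the Borel-Lebesgue measures, and almost every slice of such a set is a null set.
\<close>

lemma AE_lebesgue_on_Times_slices:
  fixes Q :: "real \<times> (real^'n) \<Rightarrow> bool"
  assumes "open J" "open \<Omega>" "AE p in lebesgue_on (J \<times> \<Omega>). Q p"
  shows "AE t in lborel. t \<in> J \<longrightarrow> (AE x in lebesgue_on \<Omega>. Q (t, x))"
proof -
  have S: "J \<times> \<Omega> \<in> sets lebesgue" using assms(1,2) by (simp add: open_Times lborelD)
  have \<Omega>: "\<Omega> \<in> sets lebesgue" using assms(2) by (simp add: lborelD)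
  have "AE p in lebesgue. p \<in> J \<times> \<Omega> \<longrightarrow> Q p" using assms(3) S by (simp add: AE_restrict_space_iff)
  then have "AE p in lborel \<Otimes>\<^sub>M lborel. p \<in> J \<times> \<Omega> \<longrightarrow> Q p"
    unfolding AE_completion_iff lborel_prod .
  then have "AE t in lborel. AE x in lborel. (t, x) \<in> J \<times> \<Omega> \<longrightarrow> Q (t, x)"
    by (rule lborel_pair.AE_pair)
  then show ?thesis
  proof eventually_elim
    case (elim t)
    then have "AE x in lebesgue. (t, x) \<in> J \<times> \<Omega> \<longrightarrow> Q (t, x)" by (rule AE_completion)
    then show ?case using \<Omega> by (auto simp: AE_restrict_space_iff elim!: eventually_mono)
  qed
qed

text \<open>
A Lebesgue measurable function has measurable slices only for almost every \<open>t\<close>: it agrees almost everywhere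
with a Borel function, all of whose slices are measurable.
\<close>

lemma borel_measurable_lebesgue_on_Times_slices:
  fixes g :: "real \<times> (real^'n) \<Rightarrow> real"
  assumes "open J" "open \<Omega>" "g \<in> borel_measurable (lebesgue_on (J \<times> \<Omega>))"
  shows "AE t in lborel. t \<in> J \<longrightarrow> (\<lambda>x. g (t, x)) \<in> borel_measurable (lebesgue_on \<Omega>)"
proof -
  have S: "J \<times> \<Omega> \<in> sets lebesgue" using assms(1,2) by (simp add: open_Times lborelD)
  have \<Omega>: "\<Omega> \<in> sets lebesgue" using assms(2) by (simp add: lborelD)
  have "(\<lambda>p. if p \<in> J \<times> \<Omega> then g p else 0) \<in> borel_measurable lebesgue"
    using assms(3) S by (subst borel_measurable_if) auto
  from completion_ex_borel_measurable_real[OF this] obtain h where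
    h: "h \<in> borel_measurable borel" "AE p in lborel. (if p \<in> J \<times> \<Omega> then g p else 0) = h p"
    by auto
  have "AE p in lebesgue. (if p \<in> J \<times> \<Omega> then g p else 0) = h p"
    using h(2) by (rule AE_completion)
  then have "AE p in lebesgue_on (J \<times> \<Omega>). g p = h p"
    using S by (auto simp: AE_restrict_space_iff elim!: eventually_mono)
  from AE_lebesgue_on_Times_slices[OF assms(1,2) this] show ?thesis
  proof eventually_elim
    case (elim t)
    show ?case
    proof
      assume "t \<in> J"
      with elim have ae: "AE x in lebesgue_on \<Omega>. h (t, x) = g (t, x)"
        by (auto elim!: eventually_mono)
      have "(\<lambda>x. h (t, x)) \<in> borel_measurable borel"
        using h(1) by (rule measurable_compose[rotated]) (intro borel_measurable_continuous_onI continuous_intros)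
      then have "(\<lambda>x. h (t, x)) \<in> borel_measurable (lebesgue_on \<Omega>)"
        by (intro measurable_restrict_space1 measurable_completion) simp
      then show "(\<lambda>x. g (t, x)) \<in> borel_measurable (lebesgue_on \<Omega>)"
        using ae \<Omega> by (rule borel_measurable_lebesgue_on_AE)
    qed
  qed
qed

lemma AE_lborel_in_open:
  fixes U :: "'a::euclidean_space set"
  assumes "AE x in lborel. P x" "open U" "U \<noteq> {}"
  shows "\<exists>x\<in>U. P x"
proof (rule ccontr)
  assume "\<not> ?thesis"
  then have no: "\<And>x. x \<in> U \<Longrightarrow> \<not> P x" by blast
  have "AE x in lebesgue. P x" using assms(1) by (rule AE_completion)
  then obtain N where "N \<in> null_sets lebesgue" "\<And>x. x \<notin> N \<Longrightarrow> P x"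
    unfolding completion.AE_iff_null_sets by auto
  then have "negligible U"
    using no negligible_subset[of N U] by (auto simp: negligible_iff_null_sets)
  then show False using assms open_not_negligible by blast
qed

text \<open>
The properties of the coefficients at one fixed time, with all bounds holding almost everywhere in space.
\<close>

definition regular_coefficients ::
    "(real^'n) set \<Rightarrow> real \<Rightarrow> real \<Rightarrow> ('n \<Rightarrow> 'n \<Rightarrow> real \<Rightarrow> real^'n \<Rightarrow> real) \<Rightarrow> real \<Rightarrow> bool" where
  "regular_coefficients \<Omega> \<alpha> K a t \<longleftrightarrow>
     (\<forall>i j. a i j t \<in> borel_measurable (lebesgue_on \<Omega>)) \<and>
     (AE x in lebesgue_on \<Omega>. (\<forall>i j. \<bar>a i j t x\<bar> \<le> K \<and> a i j t x = a j i t x) \<and>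
        (\<forall>\<xi>::real^'n. \<alpha> * (norm \<xi>)\<^sup>2 \<le> (\<Sum>i\<in>UNIV. \<Sum>j\<in>UNIV. a i j t x * \<xi> $ i * \<xi> $ j)))"

lemma Linfty_bound:
  assumes "g \<in> Linfty M"
  obtains B where "AE x in M. \<bar>g x\<bar> \<le> B"
proof -
  let ?e = "esssup M (\<lambda>x. ereal \<bar>g x\<bar>)"
  have ae: "AE x in M. ereal \<bar>g x\<bar> \<le> ?e" by (rule esssup_AE)
  have "?e \<noteq> \<infinity>" using assms by (auto simp: Linfty_def)
  then have "ereal \<bar>g x\<bar> \<le> ?e \<Longrightarrow> \<bar>g x\<bar> \<le> real_of_ereal ?e" for x
    by (cases ?e) auto
  with ae have "AE x in M. \<bar>g x\<bar> \<le> real_of_ereal ?e" by (auto elim!: eventually_mono)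
  then show ?thesis by (rule that)
qed

lemma regular_coefficients_limit:
  assumes \<Omega>: "open \<Omega>" and reg: "\<And>n. regular_coefficients \<Omega> \<alpha> K a (s n)"
    and lim: "AE x in lebesgue_on \<Omega>. \<forall>i j. (\<lambda>n. a i j (s n) x) \<longlonglongrightarrow> a i j t x"
  shows "regular_coefficients \<Omega> \<alpha> K a t"
  unfolding regular_coefficients_def
proof (intro conjI allI)
  fix i j
  have "(\<lambda>x. lim (\<lambda>n. a i j (s n) x)) \<in> borel_measurable (lebesgue_on \<Omega>)"
    using reg by (intro borel_measurable_lim_metric) (auto simp: regular_coefficients_def)
  moreover have "AE x in lebesgue_on \<Omega>. lim (\<lambda>n. a i j (s n) x) = a i j t x"
    using lim by eventually_elim (auto intro: limI)
  ultimately show "a i j t \<in> borel_measurable (lebesgue_on \<Omega>)"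
    by (rule borel_measurable_lebesgue_on_AE) (use \<Omega> in auto)
next
  have "AE x in lebesgue_on \<Omega>. \<forall>n. (\<forall>i j. \<bar>a i j (s n) x\<bar> \<le> K \<and> a i j (s n) x = a j i (s n) x) \<and>
        (\<forall>\<xi>::real^'a. \<alpha> * (norm \<xi>)\<^sup>2 \<le> (\<Sum>i\<in>UNIV. \<Sum>j\<in>UNIV. a i j (s n) x * \<xi> $ i * \<xi> $ j))"
    unfolding AE_all_countable using reg by (auto simp: regular_coefficients_def)
  with lim show "AE x in lebesgue_on \<Omega>. (\<forall>i j. \<bar>a i j t x\<bar> \<le> K \<and> a i j t x = a j i t x) \<and>
        (\<forall>\<xi>::real^'a. \<alpha> * (norm \<xi>)\<^sup>2 \<le> (\<Sum>i\<in>UNIV. \<Sum>j\<in>UNIV. a i j t x * \<xi> $ i * \<xi> $ j))"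
  proof eventually_elim
    case (elim x)
    show ?case
    proof (intro conjI allI)
      fix i j
      show "\<bar>a i j t x\<bar> \<le> K"
        using elim by (intro LIMSEQ_le_const2[OF tendsto_rabs[of "\<lambda>n. a i j (s n) x"]]) auto
      have "(\<lambda>n. a j i (s n) x) = (\<lambda>n. a i j (s n) x)" using elim(2) by (intro ext) blast
      then have "(\<lambda>n. a i j (s n) x) \<longlonglongrightarrow> a j i t x" using elim(1) by metis
      then show "a i j t x = a j i t x" using elim(1) LIMSEQ_unique by blast
    next
      fix \<xi> :: "real^'a"
      have "(\<lambda>n. \<Sum>i\<in>UNIV. \<Sum>j\<in>UNIV. a i j (s n) x * \<xi> $ i * \<xi> $ j) \<longlonglongrightarrow> (\<Sum>i\<in>UNIV. \<Sum>j\<in>UNIV. a i j t x * \<xi> $ i * \<xi> $ j)"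
        using elim by (intro tendsto_intros) auto
      then show "\<alpha> * (norm \<xi>)\<^sup>2 \<le> (\<Sum>i\<in>UNIV. \<Sum>j\<in>UNIV. a i j t x * \<xi> $ i * \<xi> $ j)"
        using elim(2) by (intro LIMSEQ_le_const) auto
    qed
  qed
qed

text \<open>
The hypotheses on boundedness, symmetry and ellipticity hold almost everywhere in space-time, hence on almost every
time slice.  Good times are dense, and continuity in time carries the properties to every time in the closed
interval.  No exceptional times remain, which makes the forms continuous in time.
\<close>

lemma coefficient_slices_regular:
  fixes \<Omega> :: "(real^'n) set"
  assumes \<Omega>: "open \<Omega>" and T: "T > 0" and adm: "admissible_coefficients \<Omega> T a \<alpha> \<omega>"
  obtains K where "K > 0" "\<And>t. t \<in> {0..T} \<Longrightarrow> regular_coefficients \<Omega> \<alpha> K a t"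
proof -
  let ?J = "{0<..<T}"
  have J: "open ?J" by simp
  have "\<exists>B. AE p in lebesgue_on (?J \<times> \<Omega>). \<bar>(\<lambda>(t, x). a i j t x) p\<bar> \<le> B" for i j
  proof -
    have "(\<lambda>(t, x). a i j t x) \<in> Linfty (lebesgue_on (?J \<times> \<Omega>))"
      using adm by (simp add: admissible_coefficients_def)
    from Linfty_bound[OF this] show ?thesis by blast
  qed
  then obtain B where B: "\<And>i j. AE p in lebesgue_on (?J \<times> \<Omega>). \<bar>(\<lambda>(t, x). a i j t x) p\<bar> \<le> B i j"
    by metis
  define K where "K = 1 + (\<Sum>i\<in>UNIV. \<Sum>j\<in>UNIV. \<bar>B i j\<bar>)"
  have BK: "B i j \<le> K" for i j
  proof -
    have "\<bar>B i j\<bar> \<le> (\<Sum>j\<in>UNIV. \<bar>B i j\<bar>)" by (rule member_le_sum) auto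
    also have "\<dots> \<le> (\<Sum>i\<in>UNIV. \<Sum>j\<in>UNIV. \<bar>B i j\<bar>)"
      by (rule member_le_sum[of i UNIV "\<lambda>i. \<Sum>j\<in>UNIV. \<bar>B i j\<bar>"]) (auto intro: sum_nonneg)
    finally show ?thesis by (simp add: K_def)
  qed
  have Kpos: "K > 0" by (simp add: K_def add_pos_nonneg sum_nonneg)
  have aeB: "AE p in lebesgue_on (?J \<times> \<Omega>). \<forall>i j. \<bar>(\<lambda>(t, x). a i j t x) p\<bar> \<le> B i j"
    by (intro eventually_all_finite B)
  have ae: "AE p in lebesgue_on (?J \<times> \<Omega>). (\<forall>i j. \<bar>a i j (fst p) (snd p)\<bar> \<le> K \<and> a i j (fst p) (snd p) = a j i (fst p) (snd p)) \<and>
        (\<forall>\<xi>::real^'n. \<alpha> * (norm \<xi>)\<^sup>2 \<le> (\<Sum>i\<in>UNIV. \<Sum>j\<in>UNIV. a i j (fst p) (snd p) * \<xi> $ i * \<xi> $ j))"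
  proof -
    have "AE (t, x) in lebesgue_on (?J \<times> \<Omega>). \<forall>i j. a i j t x = a j i t x"
      and "AE (t, x) in lebesgue_on (?J \<times> \<Omega>). \<forall>\<xi>::real^'n.
         (\<Sum>i\<in>UNIV. \<Sum>j\<in>UNIV. a i j t x * \<xi> $ i * \<xi> $ j) \<ge> \<alpha> * (norm \<xi>)\<^sup>2"
      using adm by (auto simp: admissible_coefficients_def)
    with aeB show ?thesis
      by eventually_elim (auto simp: case_prod_beta intro: order_trans[OF _ BK])
  qed
  \<comment> \<open>Almost every time slice is measurable and satisfies the bounds.\<close>
  have "AE t in lborel. \<forall>i j. t \<in> ?J \<longrightarrow> (\<lambda>x. (\<lambda>(t, x). a i j t x) (t, x)) \<in> borel_measurable (lebesgue_on \<Omega>)"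
    using adm by (intro eventually_all_finite borel_measurable_lebesgue_on_Times_slices J \<Omega>)
      (auto simp: admissible_coefficients_def Linfty_def)
  with AE_lebesgue_on_Times_slices[OF J \<Omega> ae]
  have good: "AE t in lborel. t \<in> ?J \<longrightarrow> regular_coefficients \<Omega> \<alpha> K a t"
    by eventually_elim (auto simp: regular_coefficients_def)
  have "regular_coefficients \<Omega> \<alpha> K a t" if t: "t \<in> {0..T}" for t
  proof -
    have "\<exists>s. s \<in> ?J \<and> dist s t < 1 / real (Suc n) \<and> regular_coefficients \<Omega> \<alpha> K a s" for n
    proof -
      let ?e = "1 / real (Suc n)"
      have "t \<in> closure ?J" using t T by (simp add: closure_greaterThanLessThan)
      then have "?J \<inter> ball t ?e \<noteq> {}"
        by (metis centre_in_ball disjoint_iff_not_equal open_Int_closure_eq_empty open_ball zero_less_divide_1_iff of_nat_0_less_iff zero_less_Suc Int_commute)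
      then have "\<exists>s\<in>?J \<inter> ball t ?e. s \<in> ?J \<longrightarrow> regular_coefficients \<Omega> \<alpha> K a s"
        by (intro AE_lborel_in_open[OF good]) (auto intro!: open_Int)
      then show ?thesis by (auto simp: dist_commute)
    qed
    then obtain s where s: "\<And>n. s n \<in> ?J" "\<And>n. dist (s n) t < 1 / real (Suc n)"
      "\<And>n. regular_coefficients \<Omega> \<alpha> K a (s n)" by metis
    have st: "s \<longlonglongrightarrow> t"
    proof (rule metric_LIMSEQ_I)
      fix r :: real assume "r > 0"
      then obtain N where N: "1 / real (Suc N) < r" using nat_approx_posE by blast
      have "dist (s n) t < r" if "n \<ge> N" for n
      proof -
        have "dist (s n) t < 1 / real (Suc n)" by (rule s)
        also have "\<dots> \<le> 1 / real (Suc N)" using that by (simp add: frac_le)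
        finally show ?thesis using N by simp
      qed
      then show "\<exists>no. \<forall>n\<ge>no. dist (s n) t < r" by blast
    qed
    have "AE x in lebesgue_on \<Omega>. \<forall>i j. continuous_on {0..T} (\<lambda>t. a i j t x)"
      using adm by (intro eventually_all_finite) (auto simp: admissible_coefficients_def)
    then have "AE x in lebesgue_on \<Omega>. \<forall>i j. (\<lambda>n. a i j (s n) x) \<longlonglongrightarrow> a i j t x"
    proof eventually_elim
      case (elim x)
      show ?case
      proof (intro allI)
        fix i j
        have "s n \<in> {0..T}" for n using s(1)[of n] by auto
        then show "(\<lambda>n. a i j (s n) x) \<longlonglongrightarrow> a i j t x"
          using continuous_on_tendsto_compose[OF elim[rule_format, of i j] st t] by auto
      qed
    qed
    then show ?thesis by (rule regular_coefficients_limit[OF \<Omega> s(3)])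
  qed
  with Kpos show ?thesis by (rule that)
qed

section \<open>Elliptic forms\<close>

text \<open>
Reduces statements on the form to the inner product, applied to the functions \<open>a\<^sub>i\<^sub>j \<partial>\<^sub>i u\<close> and \<open>\<partial>\<^sub>j v\<close>.
\<close>

lemma a_form_eq_sum:
  assumes \<Omega>: "bounded \<Omega>" "open \<Omega>" and reg: "regular_coefficients \<Omega> \<alpha> K a t"
    and "u \<in> H1 \<Omega>" "v \<in> H1 \<Omega>"
  shows "a_form \<Omega> a t u v = (\<Sum>i\<in>UNIV. \<Sum>j\<in>UNIV. L2_inner \<Omega> (\<lambda>x. a i j t x * wgrad \<Omega> i u x) (wgrad \<Omega> j v))"
    and "(\<lambda>x. a i j t x * wgrad \<Omega> i u x) \<in> L2 \<Omega>"
proof -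
  have L: "(\<lambda>x. a i j t x * wgrad \<Omega> i u x) \<in> L2 \<Omega>" for i j
    using reg by (intro bounded_mult_L2[where B = K] wgrad_L2 assms)
      (auto simp: regular_coefficients_def elim!: eventually_mono)
  then show "(\<lambda>x. a i j t x * wgrad \<Omega> i u x) \<in> L2 \<Omega>" .
  have int: "integrable (lebesgue_on \<Omega>) (\<lambda>x. a i j t x * wgrad \<Omega> i u x * wgrad \<Omega> j v x)" for i j
    by (rule L2_integrable_mult[OF L wgrad_L2[OF assms(5)]])
  show "a_form \<Omega> a t u v = (\<Sum>i\<in>UNIV. \<Sum>j\<in>UNIV. L2_inner \<Omega> (\<lambda>x. a i j t x * wgrad \<Omega> i u x) (wgrad \<Omega> j v))"
    unfolding a_form_def wgrad_def[symmetric, THEN fun_cong] L2_inner_def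
    using int by (simp add: Bochner_Integration.integral_sum)
qed

lemma dirichlet_eq_integral:
  assumes "u \<in> H1 \<Omega>"
  shows "integrable (lebesgue_on \<Omega>) (\<lambda>x. (norm (weak_gradient \<Omega> u x))\<^sup>2)"
    "dirichlet \<Omega> u u = (LINT x|lebesgue_on \<Omega>. (norm (weak_gradient \<Omega> u x))\<^sup>2)"
proof -
  have e: "(norm (weak_gradient \<Omega> u x))\<^sup>2 = (\<Sum>i\<in>UNIV. wgrad \<Omega> i u x * wgrad \<Omega> i u x)" for x
    by (simp add: power2_norm_eq_inner inner_vec_def wgrad_def)
  have int: "integrable (lebesgue_on \<Omega>) (\<lambda>x. wgrad \<Omega> i u x * wgrad \<Omega> i u x)" for i
    by (intro L2_integrable_mult wgrad_L2 assms)
  show "integrable (lebesgue_on \<Omega>) (\<lambda>x. (norm (weak_gradient \<Omega> u x))\<^sup>2)"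
    unfolding e using int by simp
  show "dirichlet \<Omega> u u = (LINT x|lebesgue_on \<Omega>. (norm (weak_gradient \<Omega> u x))\<^sup>2)"
    unfolding e dirichlet_def L2_inner_def using int by (simp add: Bochner_Integration.integral_sum)
qed

lemma a_form_coercive:
  assumes \<Omega>: "bounded \<Omega>" "open \<Omega>" and reg: "regular_coefficients \<Omega> \<alpha> K a t"
    and u: "u \<in> H1 \<Omega>"
  shows "\<alpha> * dirichlet \<Omega> u u \<le> a_form \<Omega> a t u u"
proof -
  have "integrable (lebesgue_on \<Omega>) (\<lambda>x. a i j t x * weak_gradient \<Omega> u x $ i * weak_gradient \<Omega> u x $ j)" for i j
    using L2_integrable_mult[OF a_form_eq_sum(2)[OF \<Omega> reg u u, of i j] wgrad_L2[OF u, of j]]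
    by (simp add: wgrad_def)
  then have int: "integrable (lebesgue_on \<Omega>) (\<lambda>x. \<Sum>i\<in>UNIV. \<Sum>j\<in>UNIV.
      a i j t x * weak_gradient \<Omega> u x $ i * weak_gradient \<Omega> u x $ j)"
    by simp
  have "\<alpha> * dirichlet \<Omega> u u = (LINT x|lebesgue_on \<Omega>. \<alpha> * (norm (weak_gradient \<Omega> u x))\<^sup>2)"
    using dirichlet_eq_integral[OF u] by simp
  also have "\<dots> \<le> a_form \<Omega> a t u u"
    unfolding a_form_def
  proof (rule integral_mono_AE)
    have "AE x in lebesgue_on \<Omega>. \<forall>\<xi>::real^'a. \<alpha> * (norm \<xi>)\<^sup>2 \<le> (\<Sum>i\<in>UNIV. \<Sum>j\<in>UNIV. a i j t x * \<xi> $ i * \<xi> $ j)"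
      using reg by (simp add: regular_coefficients_def)
    then show "AE x in lebesgue_on \<Omega>. \<alpha> * (norm (weak_gradient \<Omega> u x))\<^sup>2
        \<le> (\<Sum>i\<in>UNIV. \<Sum>j\<in>UNIV. a i j t x * weak_gradient \<Omega> u x $ i * weak_gradient \<Omega> u x $ j)"
      by eventually_elim blast
  qed (use dirichlet_eq_integral[OF u] int in auto)
  finally show ?thesis .
qed

lemma semi_inner_a_form:
  assumes \<Omega>: "bounded \<Omega>" "open \<Omega>" and reg: "regular_coefficients \<Omega> \<alpha> K a t" and \<alpha>: "\<alpha> > 0"
  shows "semi_inner (H1 \<Omega>) (a_form \<Omega> a t)"
proof
  show "subspace (H1 \<Omega>)" by (rule subspace_H1[OF \<Omega>])
  note H = subspace_add[OF this] subspace_scale[OF this]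
  note S = a_form_eq_sum[OF \<Omega> reg]
  fix u v w c assume u: "u \<in> H1 \<Omega>" and w: "w \<in> H1 \<Omega>"
  {
    assume v: "v \<in> H1 \<Omega>"
    have "L2_inner \<Omega> (\<lambda>x. a i j t x * wgrad \<Omega> i (u + v) x) (wgrad \<Omega> j w)
        = L2_inner \<Omega> ((\<lambda>x. a i j t x * wgrad \<Omega> i u x) + (\<lambda>x. a i j t x * wgrad \<Omega> i v x)) (wgrad \<Omega> j w)" for i j
      using wgrad_add[OF \<Omega> u v, of i] u v w S(2)[OF u w] S(2)[OF v w] S(2)[OF H(1)[OF u v] w]
      by (intro L2_inner_cong_AE wgrad_L2 L2.mem) (auto simp: distrib_left elim!: eventually_mono)
    then show "a_form \<Omega> a t (u + v) w = a_form \<Omega> a t u w + a_form \<Omega> a t v w"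
      using u v w H S by (simp add: L2.add_left wgrad_L2 sum.distrib)
  }
  have "L2_inner \<Omega> (\<lambda>x. a i j t x * wgrad \<Omega> i (c *\<^sub>R u) x) (wgrad \<Omega> j w)
      = L2_inner \<Omega> (c *\<^sub>R (\<lambda>x. a i j t x * wgrad \<Omega> i u x)) (wgrad \<Omega> j w)" for i j
    using wgrad_scale[OF \<Omega> u, of i c] u w S(2)[OF u w] S(2)[OF H(2)[OF u] w]
    by (intro L2_inner_cong_AE wgrad_L2 L2.mem) (auto elim!: eventually_mono)
  then show "a_form \<Omega> a t (c *\<^sub>R u) w = c * a_form \<Omega> a t u w"
    using u w H S by (simp add: L2.scale_left wgrad_L2 sum_distrib_left)
next
  fix u v assume u: "u \<in> H1 \<Omega>" and v: "v \<in> H1 \<Omega>"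
  note S = a_form_eq_sum[OF \<Omega> reg]
  have "L2_inner \<Omega> (\<lambda>x. a i j t x * wgrad \<Omega> i u x) (wgrad \<Omega> j v)
      = L2_inner \<Omega> (\<lambda>x. a j i t x * wgrad \<Omega> j v x) (wgrad \<Omega> i u)" for i j
    unfolding L2_inner_def
  proof (rule integral_cong_AE)
    have "AE x in lebesgue_on \<Omega>. \<forall>i j. a i j t x = a j i t x"
      using reg by (auto simp: regular_coefficients_def elim!: eventually_mono)
    then show "AE x in lebesgue_on \<Omega>. a i j t x * wgrad \<Omega> i u x * wgrad \<Omega> j v x
        = a j i t x * wgrad \<Omega> j v x * wgrad \<Omega> i u x"
      by eventually_elim simp
  qed (use L2_integrable_mult[OF S(2)[OF u v] wgrad_L2[OF v]] L2_integrable_mult[OF S(2)[OF v u] wgrad_L2[OF u]] in blast)+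
  then have "a_form \<Omega> a t u v = (\<Sum>i\<in>UNIV. \<Sum>j\<in>UNIV. L2_inner \<Omega> (\<lambda>x. a j i t x * wgrad \<Omega> j v x) (wgrad \<Omega> i u))"
    using S(1)[OF u v] by simp
  also have "\<dots> = a_form \<Omega> a t v u"
    unfolding S(1)[OF v u] by (rule sum.swap)
  finally show "a_form \<Omega> a t u v = a_form \<Omega> a t v u" .
next
  fix v assume v: "v \<in> H1 \<Omega>"
  interpret D: semi_inner "H1 \<Omega>" "dirichlet \<Omega>" by (rule semi_inner_dirichlet[OF \<Omega>])
  have "0 \<le> \<alpha> * dirichlet \<Omega> v v" using \<alpha> D.nonneg[OF v] by simp
  also have "\<dots> \<le> a_form \<Omega> a t v v" by (rule a_form_coercive[OF \<Omega> reg v])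
  finally show "0 \<le> a_form \<Omega> a t v v" .
qed

lemma a_form_diff_le:
  fixes \<Omega> :: "(real^'n) set"
  assumes \<Omega>: "bounded \<Omega>" "open \<Omega>" and reg: "regular_coefficients \<Omega> \<alpha> K a s" "regular_coefficients \<Omega> \<alpha> K a t"
    and u: "u \<in> H1 \<Omega>" and v: "v \<in> H1 \<Omega>"
    and close: "\<And>i j. AE x in lebesgue_on \<Omega>. \<bar>a i j s x - a i j t x\<bar> \<le> e" and e: "e \<ge> 0"
  shows "\<bar>a_form \<Omega> a s u v - a_form \<Omega> a t u v\<bar>
    \<le> (real CARD('n))\<^sup>2 * e * (sqrt (dirichlet \<Omega> u u) * sqrt (dirichlet \<Omega> v v))"
proof -
  let ?E = "e * (sqrt (dirichlet \<Omega> u u) * sqrt (dirichlet \<Omega> v v))"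
  have term_le: "\<bar>L2_inner \<Omega> (\<lambda>x. a i j s x * wgrad \<Omega> i u x) (wgrad \<Omega> j v)
      - L2_inner \<Omega> (\<lambda>x. a i j t x * wgrad \<Omega> i u x) (wgrad \<Omega> j v)\<bar> \<le> ?E" for i j
  proof -
    define d where "d x = (a i j s x - a i j t x) * wgrad \<Omega> i u x" for x
    have d: "d = (\<lambda>x. a i j s x * wgrad \<Omega> i u x) - (\<lambda>x. a i j t x * wgrad \<Omega> i u x)"
      by (auto simp: d_def fun_eq_iff algebra_simps)
    note L = a_form_eq_sum(2)[OF \<Omega> reg(1) u u, of i j] a_form_eq_sum(2)[OF \<Omega> reg(2) u u, of i j] wgrad_L2[OF v, of j]
    have dL: "d \<in> L2 \<Omega>" unfolding d using L by auto
    have "\<bar>L2_inner \<Omega> (\<lambda>x. a i j s x * wgrad \<Omega> i u x) (wgrad \<Omega> j v)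
      - L2_inner \<Omega> (\<lambda>x. a i j t x * wgrad \<Omega> i u x) (wgrad \<Omega> j v)\<bar> = \<bar>L2_inner \<Omega> d (wgrad \<Omega> j v)\<bar>"
      unfolding d using L by (simp add: L2.diff_left)
    also have "\<dots> \<le> L2.nrm \<Omega> d * L2.nrm \<Omega> (wgrad \<Omega> j v)"
      by (rule L2.cauchy_schwarz[OF dL L(3)])
    also have "L2.nrm \<Omega> d \<le> e * L2.nrm \<Omega> (wgrad \<Omega> i u)"
      unfolding d_def
    proof (intro L2_nrm_bounded_mult wgrad_L2 u close e)
      have "a i j s \<in> borel_measurable (lebesgue_on \<Omega>)" "a i j t \<in> borel_measurable (lebesgue_on \<Omega>)"
        using reg by (auto simp: regular_coefficients_def)
      then show "(\<lambda>x. a i j s x - a i j t x) \<in> borel_measurable (lebesgue_on \<Omega>)" by simp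
    qed
    also have "e * L2.nrm \<Omega> (wgrad \<Omega> i u) * L2.nrm \<Omega> (wgrad \<Omega> j v) \<le> e * sqrt (dirichlet \<Omega> u u) * sqrt (dirichlet \<Omega> v v)"
      using wgrad_nrm_le[OF u, of i] wgrad_nrm_le[OF v, of j] e wgrad_L2[OF u] wgrad_L2[OF v]
        semi_inner.nonneg[OF semi_inner_dirichlet[OF \<Omega>] u]
      by (intro mult_mono) (auto intro: order_trans[OF L2.nrm_nonneg])
    finally show ?thesis using L by (simp add: mult_right_mono mult.assoc)
  qed
  have "\<bar>a_form \<Omega> a s u v - a_form \<Omega> a t u v\<bar>
      \<le> (\<Sum>i\<in>(UNIV::'n set). \<Sum>j\<in>(UNIV::'n set). ?E)"
    unfolding a_form_eq_sum(1)[OF \<Omega> reg(1) u v] a_form_eq_sum(1)[OF \<Omega> reg(2) u v] sum_subtractf[symmetric]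
    by (intro order_trans[OF sum_abs] sum_mono term_le)
  then show ?thesis by (simp add: power2_eq_square mult_ac)
qed

text \<open>
Dominated convergence, from the continuity in time of the coefficients at almost every point.
\<close>

lemma a_form_continuous:
  fixes \<Omega> :: "(real^'n) set"
  assumes \<Omega>: "bounded \<Omega>" "open \<Omega>" and adm: "admissible_coefficients \<Omega> T a \<alpha> \<omega>"
    and reg: "\<And>t. t \<in> {0..T} \<Longrightarrow> regular_coefficients \<Omega> \<alpha> K a t"
    and u: "u \<in> H1 \<Omega>" and v: "v \<in> H1 \<Omega>"
  shows "continuous_on {0..T} (\<lambda>t. a_form \<Omega> a t u v)"
  unfolding continuous_on_sequentially comp_def
proof (intro allI ballI impI, elim conjE)
  fix s t assume t: "t \<in> {0..T}" and s: "\<forall>n. s n \<in> {0..T}" "s \<longlonglongrightarrow> t"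
  have "AE x in lebesgue_on \<Omega>. \<forall>i j. continuous_on {0..T} (\<lambda>t. a i j t x)"
    using adm by (intro eventually_all_finite) (auto simp: admissible_coefficients_def)
  then have lim: "AE x in lebesgue_on \<Omega>. \<forall>i j. (\<lambda>n. a i j (s n) x) \<longlonglongrightarrow> a i j t x"
  proof eventually_elim
    case (elim x)
    show ?case
    proof (intro allI)
      fix i j
      show "(\<lambda>n. a i j (s n) x) \<longlonglongrightarrow> a i j t x"
        by (rule continuous_on_tendsto_compose[OF elim[rule_format, of i j] s(2) t]) (use s(1) in simp)
    qed
  qed
  have "(\<lambda>n. L2_inner \<Omega> (\<lambda>x. a i j (s n) x * wgrad \<Omega> i u x) (wgrad \<Omega> j v))
      \<longlonglongrightarrow> L2_inner \<Omega> (\<lambda>x. a i j t x * wgrad \<Omega> i u x) (wgrad \<Omega> j v)" for i j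
    unfolding L2_inner_def
  proof (rule integral_dominated_convergence[where w = "\<lambda>x. K * \<bar>wgrad \<Omega> i u x * wgrad \<Omega> j v x\<bar>"])
    show "integrable (lebesgue_on \<Omega>) (\<lambda>x. K * \<bar>wgrad \<Omega> i u x * wgrad \<Omega> j v x\<bar>)"
      by (intro integrable_mult_right integrable_abs L2_integrable_mult wgrad_L2 u v)
    show "AE x in lebesgue_on \<Omega>. (\<lambda>n. a i j (s n) x * wgrad \<Omega> i u x * wgrad \<Omega> j v x) \<longlonglongrightarrow> a i j t x * wgrad \<Omega> i u x * wgrad \<Omega> j v x"
      using lim by eventually_elim (auto intro!: tendsto_intros)
    show "AE x in lebesgue_on \<Omega>. norm (a i j (s n) x * wgrad \<Omega> i u x * wgrad \<Omega> j v x) \<le> K * \<bar>wgrad \<Omega> i u x * wgrad \<Omega> j v x\<bar>" for n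
    proof -
      have "AE x in lebesgue_on \<Omega>. \<bar>a i j (s n) x\<bar> \<le> K"
        using reg[of "s n"] s by (auto simp: regular_coefficients_def elim!: eventually_mono)
      then show ?thesis
        by eventually_elim (simp add: abs_mult mult.assoc mult_right_mono)
    qed
  qed (use L2_integrable_mult[OF a_form_eq_sum(2)[OF \<Omega> reg u u] wgrad_L2[OF v]] s t in blast)+
  then have "(\<lambda>n. \<Sum>i\<in>UNIV. \<Sum>j\<in>UNIV. L2_inner \<Omega> (\<lambda>x. a i j (s n) x * wgrad \<Omega> i u x) (wgrad \<Omega> j v))
      \<longlonglongrightarrow> (\<Sum>i\<in>UNIV. \<Sum>j\<in>UNIV. L2_inner \<Omega> (\<lambda>x. a i j t x * wgrad \<Omega> i u x) (wgrad \<Omega> j v))"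
    by (intro tendsto_sum)
  then show "(\<lambda>n. a_form \<Omega> a (s n) u v) \<longlonglongrightarrow> a_form \<Omega> a t u v"
    using a_form_eq_sum(1)[OF \<Omega> reg u v] s t by simp
qed

lemma a_form_cong_AE:
  assumes \<Omega>: "bounded \<Omega>" "open \<Omega>" and reg: "regular_coefficients \<Omega> \<alpha> K a t"
    and "u \<in> H1 \<Omega>" "v \<in> H1 \<Omega>" "AE x in lebesgue_on \<Omega>. v x = v' x"
  shows "a_form \<Omega> a t u v = a_form \<Omega> a t u v'"
proof -
  have v': "v' \<in> H1 \<Omega>" by (rule H1_cong_AE[OF \<Omega> assms(5,6)])
  have "L2_inner \<Omega> (\<lambda>x. a i j t x * wgrad \<Omega> i u x) (wgrad \<Omega> j v)
      = L2_inner \<Omega> (\<lambda>x. a i j t x * wgrad \<Omega> i u x) (wgrad \<Omega> j v')" for i j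
    using wgrad_cong_AE[OF \<Omega> assms(5,6)] a_form_eq_sum(2)[OF \<Omega> reg assms(4) v'] v' assms
    by (intro L2_inner_cong_AE wgrad_L2) auto
  then show ?thesis
    using a_form_eq_sum(1)[OF \<Omega> reg assms(4,5)] a_form_eq_sum(1)[OF \<Omega> reg assms(4) v'] by simp
qed

lemma a_form_0_right:
  assumes \<Omega>: "bounded \<Omega>" "open \<Omega>"
  shows "a_form \<Omega> a t u 0 = 0"
proof -
  from wgrad_AE[OF \<Omega> subspace_0[OF subspace_H1[OF \<Omega>]] is_weak_gradient_zero[OF \<Omega>]]
  have "AE x in lebesgue_on \<Omega>. \<forall>i. wgrad \<Omega> i 0 x = 0"
    by (intro eventually_all_finite) auto
  then have "AE x in lebesgue_on \<Omega>. (\<Sum>i\<in>UNIV. \<Sum>j\<in>UNIV.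
        a i j t x * weak_gradient \<Omega> u x $ i * weak_gradient \<Omega> 0 x $ j) = 0"
    by eventually_elim (simp add: wgrad_def)
  then show ?thesis unfolding a_form_def by (rule integral_eq_zero_AE)
qed

section \<open>The finite element space\<close>

lemma poly_fun_add:
  assumes "poly_fun r p" "poly_fun r q"
  shows "poly_fun r (\<lambda>x. p x + q x)"
proof -
  obtain c d where "\<forall>x. p x = (\<Sum>e | (\<Sum>i\<in>UNIV. e i) \<le> r. c e * (\<Prod>i\<in>UNIV. x $ i ^ e i))"
    "\<forall>x. q x = (\<Sum>e | (\<Sum>i\<in>UNIV. e i) \<le> r. d e * (\<Prod>i\<in>UNIV. x $ i ^ e i))"
    using assms by (auto simp: poly_fun_def)
  then show ?thesis
    unfolding poly_fun_def by (intro exI[of _ "\<lambda>e. c e + d e"]) (simp add: distrib_right sum.distrib)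
qed

lemma poly_fun_scale:
  assumes "poly_fun r p"
  shows "poly_fun r (\<lambda>x. s * p x)"
proof -
  obtain c where "\<forall>x. p x = (\<Sum>e | (\<Sum>i\<in>UNIV. e i) \<le> r. c e * (\<Prod>i\<in>UNIV. x $ i ^ e i))"
    using assms by (auto simp: poly_fun_def)
  then show ?thesis
    unfolding poly_fun_def by (intro exI[of _ "\<lambda>e. s * c e"]) (simp add: sum_distrib_left mult.assoc)
qed

lemma subspace_fe_space:
  assumes \<Omega>: "bounded \<Omega>" "open \<Omega>"
  shows "subspace (fe_space \<Omega> \<T> r)"
proof (rule subspaceI)
  note H = subspace_H10[OF \<Omega>]
  have "poly_fun r (\<lambda>x. 0)" unfolding poly_fun_def by (intro exI[of _ "\<lambda>e. 0"]) simp
  then show "0 \<in> fe_space \<Omega> \<T> r"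
    using subspace_0[OF H] by (auto simp: fe_space_def intro!: exI[of _ "\<lambda>x. 0"])
next
  note H = subspace_H10[OF \<Omega>]
  fix u v assume u: "u \<in> fe_space \<Omega> \<T> r" and v: "v \<in> fe_space \<Omega> \<T> r"
  have "\<exists>p. poly_fun r p \<and> (AE x in lebesgue_on \<tau>. (u + v) x = p x)" if "\<tau> \<in> \<T>" for \<tau>
  proof -
    obtain p q where "poly_fun r p" "AE x in lebesgue_on \<tau>. u x = p x"
      "poly_fun r q" "AE x in lebesgue_on \<tau>. v x = q x"
      using u v \<open>\<tau> \<in> \<T>\<close> unfolding fe_space_def by blast
    then show ?thesis
      by (intro exI[of _ "\<lambda>x. p x + q x"]) (auto simp: poly_fun_add)
  qed
  then show "u + v \<in> fe_space \<Omega> \<T> r"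
    using u v subspace_add[OF H] by (auto simp: fe_space_def)
next
  note H = subspace_H10[OF \<Omega>]
  fix c :: real and u assume u: "u \<in> fe_space \<Omega> \<T> r"
  have "\<exists>p. poly_fun r p \<and> (AE x in lebesgue_on \<tau>. (c *\<^sub>R u) x = p x)" if "\<tau> \<in> \<T>" for \<tau>
  proof -
    obtain p where "poly_fun r p" "AE x in lebesgue_on \<tau>. u x = p x"
      using u \<open>\<tau> \<in> \<T>\<close> unfolding fe_space_def by blast
    then show ?thesis
      by (intro exI[of _ "\<lambda>x. c * p x"]) (auto simp: poly_fun_scale)
  qed
  then show "c *\<^sub>R u \<in> fe_space \<Omega> \<T> r"
    using u subspace_scale[OF H] by (auto simp: fe_space_def)
qed

lemma finite_multiindices: "finite {e :: 'n::finite \<Rightarrow> nat. (\<Sum>i\<in>UNIV. e i) \<le> r}"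
proof (rule finite_subset)
  show "{e :: 'n \<Rightarrow> nat. (\<Sum>i\<in>UNIV. e i) \<le> r} \<subseteq> PiE UNIV (\<lambda>_. {..r})"
  proof
    fix e :: "'n \<Rightarrow> nat" assume "e \<in> {e. (\<Sum>i\<in>UNIV. e i) \<le> r}"
    moreover have "e i \<le> (\<Sum>i\<in>UNIV. e i)" for i by (rule member_le_sum) auto
    ultimately show "e \<in> PiE UNIV (\<lambda>_. {..r})" by (auto intro: order_trans)
  qed
qed (auto intro: finite_PiE)

lemma sum_fun_apply: "(\<Sum>i\<in>I. g i) x = (\<Sum>i\<in>I. g i x)" for g :: "'i \<Rightarrow> 'a \<Rightarrow> real"
  by (induction I rule: infinite_finite_induct) auto

text \<open>
Simplices of a triangulation overlap, so the space is decomposed along cells instead: the sets of points that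
lie in exactly the simplices of a given family.  On each nonempty cell a finite element function agrees almost
everywhere with the polynomial of one of the simplices of the family.  It therefore has a representative
in the span of monomials cut off to cells, a finite set, and that representative belongs to the
finite element space again.
\<close>

lemma fe_space_finite_dimensional:
  fixes \<Omega> :: "(real^'n) set"
  assumes \<Omega>: "bounded \<Omega>" "open \<Omega>" and fin: "finite \<T>" and cover: "\<Union>\<T> = closure \<Omega>"
    and meas: "\<And>\<tau>. \<tau> \<in> \<T> \<Longrightarrow> \<tau> \<in> sets lebesgue"
  obtains B where "finite B" "B \<subseteq> fe_space \<Omega> \<T> r"
    "\<And>v. v \<in> fe_space \<Omega> \<T> r \<Longrightarrow> \<exists>w\<in>span B. AE x in lebesgue_on \<Omega>. v x = w x"
proof -
  let ?V = "fe_space \<Omega> \<T> r"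
  define E where "E = {e :: 'n \<Rightarrow> nat. (\<Sum>i\<in>UNIV. e i) \<le> r}"
  define mon where "mon e x = (\<Prod>i\<in>UNIV. x $ i ^ e i)" for e :: "'n \<Rightarrow> nat" and x :: "real^'n"
  define cell where "cell x = {\<tau>\<in>\<T>. x \<in> \<tau>}" for x
  \<comment> \<open>Monomials cut off to the cell of the family \<open>S\<close>.\<close>
  define \<beta> where "\<beta> S e = (\<lambda>x. if cell x = S then mon e x else 0)" for S e
  define W where "W = (\<lambda>(S, e). \<beta> S e) ` (Pow \<T> \<times> E)"
  have finW: "finite W" unfolding W_def E_def using fin finite_multiindices by auto
  have approx: "\<exists>w\<in>span W. w \<in> ?V \<and> (AE x in lebesgue_on \<Omega>. v x = w x)" if v: "v \<in> ?V" for v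
  proof -
    have "\<forall>\<tau>\<in>\<T>. \<exists>c. AE x in lebesgue_on \<tau>. v x = (\<Sum>e\<in>E. c e * mon e x)"
    proof
      fix \<tau> assume "\<tau> \<in> \<T>"
      then obtain p where "poly_fun r p" and ae: "AE x in lebesgue_on \<tau>. v x = p x"
        using v unfolding fe_space_def by blast
      then obtain c where "\<And>x. p x = (\<Sum>e\<in>E. c e * mon e x)" by (auto simp: poly_fun_def E_def mon_def)
      with ae show "\<exists>c. AE x in lebesgue_on \<tau>. v x = (\<Sum>e\<in>E. c e * mon e x)" by auto
    qed
    from bchoice[OF this] obtain c where
      c: "\<And>\<tau>. \<tau> \<in> \<T> \<Longrightarrow> AE x in lebesgue_on \<tau>. v x = (\<Sum>e\<in>E. c \<tau> e * mon e x)"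
      by blast
    define pick where "pick S = (SOME \<tau>. \<tau> \<in> S)" for S :: "(real^'n) set set"
    define w where "w = (\<Sum>S\<in>Pow \<T>. \<Sum>e\<in>E. c (pick S) e *\<^sub>R \<beta> S e)"
    have wW: "w \<in> span W"
      unfolding w_def W_def by (intro span_sum span_scale span_base) auto
    have wx: "w x = (\<Sum>e\<in>E. c (pick (cell x)) e * mon e x)" for x
    proof -
      have "w x = (\<Sum>S\<in>Pow \<T>. if S = cell x then (\<Sum>e\<in>E. c (pick S) e * mon e x) else 0)"
        unfolding w_def sum_fun_apply by (intro sum.cong) (auto simp: \<beta>_def)
      also have "\<dots> = (\<Sum>e\<in>E. c (pick (cell x)) e * mon e x)"
        using fin by (subst sum.delta) (auto simp: cell_def)
      finally show ?thesis .
    qed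
    have "AE x in lebesgue. \<forall>\<tau>\<in>\<T>. x \<in> \<tau> \<longrightarrow> v x = (\<Sum>e\<in>E. c \<tau> e * mon e x)"
      using c meas by (intro AE_finite_allI fin) (auto simp: AE_restrict_space_iff)
    then have eq: "AE x in lebesgue. x \<in> closure \<Omega> \<longrightarrow> v x = w x"
    proof eventually_elim
      case (elim x)
      show ?case
      proof
        assume "x \<in> closure \<Omega>"
        then have "cell x \<noteq> {}" using cover by (auto simp: cell_def)
        then have "pick (cell x) \<in> cell x" unfolding pick_def by (simp add: some_in_eq)
        then show "v x = w x" using elim by (auto simp: wx cell_def)
      qed
    qed
    have sub: "AE x in lebesgue_on S. v x = w x" if "S \<subseteq> closure \<Omega>" "S \<in> sets lebesgue" for S
      using eq that by (auto simp: AE_restrict_space_iff elim!: eventually_mono)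
    have ae\<Omega>: "AE x in lebesgue_on \<Omega>. v x = w x"
      using \<Omega> closure_subset by (intro sub) auto
    have "w \<in> ?V"
      unfolding fe_space_def
    proof (intro CollectI conjI ballI)
      show "w \<in> H10 \<Omega>" using H10_cong_AE[OF \<Omega> _ ae\<Omega>] v by (auto simp: fe_space_def)
      fix \<tau> assume \<tau>: "\<tau> \<in> \<T>"
      then obtain p where p: "poly_fun r p" "AE x in lebesgue_on \<tau>. v x = p x"
        using v unfolding fe_space_def by blast
      have "AE x in lebesgue_on \<tau>. v x = w x" using \<tau> cover meas by (intro sub) auto
      with p(2) have "AE x in lebesgue_on \<tau>. w x = p x" by eventually_elim simp
      with p(1) show "\<exists>p. poly_fun r p \<and> (AE x in lebesgue_on \<tau>. w x = p x)" by blast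
    qed
    with wW ae\<Omega> show ?thesis by blast
  qed
  \<comment> \<open>A maximal independent set of such representatives is finite, as it lies in the span of a finite set.\<close>
  obtain B where B: "B \<subseteq> ?V \<inter> span W" "independent B" "?V \<inter> span W \<subseteq> span B"
    using maximal_independent_subset[of "?V \<inter> span W"] by blast
  have "finite B" using independent_span_bound[OF finW B(2)] B(1) by blast
  then show ?thesis
  proof (rule that)
    show "B \<subseteq> ?V" using B(1) by auto
    fix v assume "v \<in> ?V"
    from approx[OF this] obtain w where "w \<in> span W" "w \<in> ?V" "AE x in lebesgue_on \<Omega>. v x = w x"
      by blast
    moreover from this have "w \<in> span B" using B(3) by auto
    ultimately show "\<exists>w\<in>span B. AE x in lebesgue_on \<Omega>. v x = w x" by blast
  qed
qed

section \<open>Averages over a time step\<close>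

lemma continuous_integrable_Ioc:
  fixes g :: "real \<Rightarrow> real"
  assumes "continuous_on {0..T} g" "0 \<le> p" "q \<le> T"
  shows "integrable (lebesgue_on {p<..q}) g"
proof -
  have "integrable (lebesgue_on {p..q}) g"
    using assms by (intro continuous_imp_integrable_real continuous_on_subset[OF assms(1)]) auto
  then have "set_integrable lebesgue {p..q} g"
    by (simp add: set_integrable_def integrable_restrict_space)
  then have "set_integrable lebesgue {p<..q} g"
    by (rule set_integrable_subset) auto
  then show ?thesis
    by (simp add: set_integrable_def integrable_restrict_space)
qed

lemma measure_lebesgue_on_Ioc: "p \<le> q \<Longrightarrow> measure (lebesgue_on {p<..q}) (space (lebesgue_on {p<..q})) = q - p" for p q :: real
  by (simp add: measure_restrict_space)

lemma lmeasurable_Ioc: "{p<..q} \<in> lmeasurable" for p q :: real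
  by (rule bounded_set_imp_lmeasurable) (auto intro: bounded_subset[of "{p..q}"])

lemma integral_Ioc_bound:
  fixes g :: "real \<Rightarrow> real"
  assumes "integrable (lebesgue_on {p<..q}) g" "p < q" "\<And>t. t \<in> {p<..q} \<Longrightarrow> \<bar>g t - c\<bar> \<le> e"
  shows "\<bar>1 / (q - p) * (LINT t|lebesgue_on {p<..q}. g t) - c\<bar> \<le> e"
proof -
  interpret finite_measure "lebesgue_on {p<..q}"
    by (intro finite_measure_lebesgue_on lmeasurable_Ioc)
  have "\<bar>(LINT t|lebesgue_on {p<..q}. g t - c)\<bar> \<le> (LINT t|lebesgue_on {p<..q}. \<bar>g t - c\<bar>)"
    by (rule integral_abs_bound)
  also have "\<dots> \<le> (LINT t|lebesgue_on {p<..q}. e)"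
    using assms(1,3) by (intro integral_mono) auto
  also have "\<dots> = e * (q - p)" using assms measure_lebesgue_on_Ioc[of p q] by simp
  also have "(LINT t|lebesgue_on {p<..q}. g t - c) = (LINT t|lebesgue_on {p<..q}. g t) - c * (q - p)"
    using assms measure_lebesgue_on_Ioc[of p q] by simp
  also have "\<dots> = (1 / (q - p) * (LINT t|lebesgue_on {p<..q}. g t) - c) * (q - p)"
    using assms(2) by (simp add: field_simps)
  finally show ?thesis using assms(2) by (simp add: abs_mult)
qed

lemma integral_abs_le_AE:
  fixes g :: "'a \<Rightarrow> real"
  assumes "integrable M h" "AE t in M. \<bar>g t\<bar> \<le> h t"
  shows "\<bar>LINT t|M. g t\<bar> \<le> (LINT t|M. h t)"
proof (cases "integrable M g")
  case True
  have "\<bar>LINT t|M. g t\<bar> \<le> (LINT t|M. \<bar>g t\<bar>)" by (rule integral_abs_bound)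
  also have "\<dots> \<le> (LINT t|M. h t)" using True assms by (intro integral_mono_AE) auto
  finally show ?thesis .
next
  case False
  have "0 \<le> (LINT t|M. h t)"
    using assms(2) by (intro integral_nonneg_AE) (auto elim!: eventually_mono)
  then show ?thesis using False by (simp add: not_integrable_integral_eq)
qed

lemma Linfty_L2_norm_bound:
  assumes "f \<in> Linfty_L2 \<Omega> J"
  shows "AE t in lebesgue_on J. f t \<in> L2 \<Omega> \<and> L2_norm \<Omega> (f t) \<le> Linfty_L2_norm \<Omega> J f"
proof -
  let ?e = "esssup (lebesgue_on J) (\<lambda>t. ereal (L2_norm \<Omega> (f t)))"
  have ae: "AE t in lebesgue_on J. ereal (L2_norm \<Omega> (f t)) \<le> ?e" by (rule esssup_AE)
  have "?e \<noteq> \<infinity>" and L: "AE t in lebesgue_on J. f t \<in> L2 \<Omega>" using assms by (auto simp: Linfty_L2_def)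
  then have "ereal x \<le> ?e \<Longrightarrow> x \<le> real_of_ereal ?e" for x by (cases ?e) auto
  with ae L show ?thesis unfolding Linfty_L2_norm_def by (auto elim!: eventually_elim2)
qed

lemma Linfty_L2_norm_nonneg:
  assumes f: "f \<in> Linfty_L2 \<Omega> {0<..<T}" and T: "T > 0"
  shows "0 \<le> Linfty_L2_norm \<Omega> {0<..<T} f"
proof -
  have "AE t in lebesgue. t \<in> {0<..<T} \<longrightarrow> L2_norm \<Omega> (f t) \<le> Linfty_L2_norm \<Omega> {0<..<T} f"
    using Linfty_L2_norm_bound[OF f] by (auto simp: AE_restrict_space_iff elim!: eventually_mono)
  then have "AE t in lborel. t \<in> {0<..<T} \<longrightarrow> L2_norm \<Omega> (f t) \<le> Linfty_L2_norm \<Omega> {0<..<T} f"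
    unfolding AE_completion_iff .
  from AE_lborel_in_open[OF this, of "{0<..<T}"] T
  obtain t where "L2_norm \<Omega> (f t) \<le> Linfty_L2_norm \<Omega> {0<..<T} f" by auto
  moreover have "0 \<le> L2_norm \<Omega> (f t)" by (simp add: L2_norm_def L2_inner_def)
  ultimately show ?thesis by linarith
qed

section \<open>Discrete operators\<close>

text \<open>
A time mesh and a triangulation, together with the consequences of the assumptions on the coefficients that are used.
\<close>

locale discretization =
  fixes \<Omega> :: "(real^'n) set" and T \<alpha> K c \<beta> \<kappa> :: real
    and a :: "'n \<Rightarrow> 'n \<Rightarrow> real \<Rightarrow> real^'n \<Rightarrow> real" and \<omega> :: "real \<Rightarrow> real"
    and M :: nat and tn :: "nat \<Rightarrow> real" and \<T> :: "(real^'n) set set" and r :: nat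
  assumes \<Omega>: "bounded \<Omega>" "open \<Omega>" and T: "T > 0" and \<alpha>: "\<alpha> > 0"
    and adm: "admissible_coefficients \<Omega> T a \<alpha> \<omega>"
    and \<omega>0: "\<And>s. s \<in> {0..T} \<Longrightarrow> 0 \<le> \<omega> s" and \<omega>mono: "mono_on {0..T} \<omega>"
    and reg: "\<And>t. t \<in> {0..T} \<Longrightarrow> regular_coefficients \<Omega> \<alpha> K a t"
    and mesh: "time_mesh T c \<beta> \<kappa> M tn" and \<kappa>: "\<kappa> > 0"
    and tri: "conformal_triangulation \<Omega> \<T>"
begin

abbreviation V where "V \<equiv> fe_space \<Omega> \<T> r"

lemma tn_less: "m \<in> {1..M} \<Longrightarrow> tn (m - 1) < tn m"
  using mesh by (simp add: time_mesh_def)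

lemma tn0: "tn 0 = 0" and tnM: "tn M = T"
  using mesh by (simp_all add: time_mesh_def)

lemma tn_mono: "\<lbrakk>l \<le> n; n \<le> M\<rbrakk> \<Longrightarrow> tn l \<le> tn n"
  using nodes_mono[of n tn l] tn_less by auto

lemma tn_range: "l \<le> M \<Longrightarrow> tn l \<in> {0..T}"
  using tn_mono[of 0 l] tn_mono[of l M] tn0 tnM by auto

lemma tn_range': "l \<le> M \<Longrightarrow> tn (l - 1) \<in> {0..T}"
  by (rule tn_range) simp

lemma M_pos: "M \<ge> 1"
  using tn0 tnM T by (cases M) auto

lemma step_pos: "m \<in> {1..M} \<Longrightarrow> mesh_step tn m > 0"
  using tn_less[of m] by (simp add: mesh_step_def)

lemma mesh_int_sub: "m \<in> {1..M} \<Longrightarrow> mesh_int tn m \<subseteq> {0..T}"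
  using tn_range[of m] tn_range'[of m] by (auto simp: mesh_int_def)

lemma mesh_int_unique:
  assumes "t \<in> mesh_int tn m" "t \<in> mesh_int tn l" "m \<in> {1..M}" "l \<in> {1..M}"
  shows "m = l"
proof (rule ccontr)
  assume "m \<noteq> l"
  then consider "m < l" | "l < m" by linarith
  then show False
  proof cases
    case 1
    then have "tn m \<le> tn (l - 1)" using assms by (intro tn_mono) auto
    then show False using assms by (auto simp: mesh_int_def)
  next
    case 2
    then have "tn l \<le> tn (m - 1)" using assms by (intro tn_mono) auto
    then show False using assms by (auto simp: mesh_int_def)
  qed
qed

lemma node_in_mesh_int: "m \<in> {1..M} \<Longrightarrow> tn m \<in> mesh_int tn m"
  using tn_less[of m] by (simp add: mesh_int_def)

lemma subspace_V: "subspace V" by (rule subspace_fe_space[OF \<Omega>])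

lemma V_H10: "V \<subseteq> H10 \<Omega>" by (auto simp: fe_space_def)

lemma V_H1: "V \<subseteq> H1 \<Omega>" using V_H10 H10_H1 by blast

lemma V_L2: "V \<subseteq> L2 \<Omega>" using V_H1 H1_L2 by blast

sublocale I: semi_inner V "L2_inner \<Omega>"
  by (rule semi_inner_subset[OF semi_inner_L2 subspace_V V_L2])

sublocale D: semi_inner V "dirichlet \<Omega>"
  by (rule semi_inner_subset[OF semi_inner_dirichlet[OF \<Omega>] subspace_V V_H1])

lemma a_form_integrable:
  assumes "m \<in> {1..M}" "u \<in> H1 \<Omega>" "v \<in> H1 \<Omega>"
  shows "integrable (lebesgue_on (mesh_int tn m)) (\<lambda>t. a_form \<Omega> a t u v)"
  unfolding mesh_int_def
  using tn_range[of m] tn_range'[of m] assms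
  by (intro continuous_integrable_Ioc[OF a_form_continuous[OF \<Omega> adm reg assms(2,3)]]) auto

lemma A_km_eq: "A_km \<Omega> a tn m u v = 1 / mesh_step tn m * (LINT t|lebesgue_on (mesh_int tn m). a_form \<Omega> a t u v)"
  by (simp add: A_km_def A_op_def)

lemma semi_inner_A_km_H1:
  assumes m: "m \<in> {1..M}"
  shows "semi_inner (H1 \<Omega>) (A_km \<Omega> a tn m)"
proof -
  have S: "semi_inner (H1 \<Omega>) (a_form \<Omega> a t)" if "t \<in> mesh_int tn m" for t
    using semi_inner_a_form[OF \<Omega> reg \<alpha>] mesh_int_sub[OF m] that by blast
  note int = a_form_integrable[OF m]
  have k: "mesh_step tn m > 0" using step_pos[OF m] .
  note H = subspace_H1[OF \<Omega>]
  show ?thesis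
  proof
    show "subspace (H1 \<Omega>)" by fact
    fix u v w assume uvw: "u \<in> H1 \<Omega>" "v \<in> H1 \<Omega>" "w \<in> H1 \<Omega>"
    have "(LINT t|lebesgue_on (mesh_int tn m). a_form \<Omega> a t (u + v) w)
        = (LINT t|lebesgue_on (mesh_int tn m). a_form \<Omega> a t u w + a_form \<Omega> a t v w)"
      by (rule Bochner_Integration.integral_cong) (use uvw semi_inner.add_left[OF S] in auto)
    then show "A_km \<Omega> a tn m (u + v) w = A_km \<Omega> a tn m u w + A_km \<Omega> a tn m v w"
      using int uvw by (simp add: A_km_eq distrib_left)
  next
    fix u w c assume uw: "u \<in> H1 \<Omega>" "w \<in> H1 \<Omega>"
    have "(LINT t|lebesgue_on (mesh_int tn m). a_form \<Omega> a t (c *\<^sub>R u) w)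
        = (LINT t|lebesgue_on (mesh_int tn m). c * a_form \<Omega> a t u w)"
      by (rule Bochner_Integration.integral_cong) (use uw semi_inner.scale_left[OF S] in auto)
    then show "A_km \<Omega> a tn m (c *\<^sub>R u) w = c * A_km \<Omega> a tn m u w"
      by (simp add: A_km_eq)
  next
    fix u v assume uv: "u \<in> H1 \<Omega>" "v \<in> H1 \<Omega>"
    have "(LINT t|lebesgue_on (mesh_int tn m). a_form \<Omega> a t u v)
        = (LINT t|lebesgue_on (mesh_int tn m). a_form \<Omega> a t v u)"
      by (rule Bochner_Integration.integral_cong) (use uv semi_inner.sym[OF S] in auto)
    then show "A_km \<Omega> a tn m u v = A_km \<Omega> a tn m v u" by (simp add: A_km_eq)
  next
    fix v assume v: "v \<in> H1 \<Omega>"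
    have "0 \<le> (LINT t|lebesgue_on (mesh_int tn m). a_form \<Omega> a t v v)"
      by (rule Bochner_Integration.integral_nonneg) (use v semi_inner.nonneg[OF S] in auto)
    then show "0 \<le> A_km \<Omega> a tn m v v" using k by (simp add: A_km_eq)
  qed
qed

lemma semi_inner_A_km: "m \<in> {1..M} \<Longrightarrow> semi_inner V (A_km \<Omega> a tn m)"
  by (rule semi_inner_subset[OF semi_inner_A_km_H1 subspace_V V_H1])

lemma A_km_coercive:
  assumes m: "m \<in> {1..M}" and v: "v \<in> H1 \<Omega>"
  shows "\<alpha> * dirichlet \<Omega> v v \<le> A_km \<Omega> a tn m v v"
proof -
  interpret finite_measure "lebesgue_on (mesh_int tn m)"
    unfolding mesh_int_def by (intro finite_measure_lebesgue_on lmeasurable_Ioc)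
  have "mesh_step tn m * (\<alpha> * dirichlet \<Omega> v v) = (LINT t|lebesgue_on (mesh_int tn m). \<alpha> * dirichlet \<Omega> v v)"
    using measure_lebesgue_on_Ioc[of "tn (m - 1)" "tn m"] tn_less[OF m]
    by (simp add: mesh_int_def mesh_step_def)
  also have "\<dots> \<le> (LINT t|lebesgue_on (mesh_int tn m). a_form \<Omega> a t v v)"
    using a_form_integrable[OF m v v] a_form_coercive[OF \<Omega> reg v] mesh_int_sub[OF m]
    by (intro integral_mono) auto
  finally show ?thesis using step_pos[OF m] by (simp add: A_km_eq field_simps)
qed

text \<open>
Two times in the steps \<open>l\<close> and \<open>n\<close> differ by at most \<open>t\<^sub>n - t\<^sub>l\<^sub>-\<^sub>1\<close>, and the bound on the forms at two times
survives averaging in both of them.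
\<close>

lemma A_km_close:
  assumes "1 \<le> l" "l < n" "n \<le> M" "u \<in> V" "v \<in> V"
  shows "\<bar>A_km \<Omega> a tn n u v - A_km \<Omega> a tn l u v\<bar>
    \<le> (real CARD('n))\<^sup>2 * \<omega> (tn n - tn (l - 1)) * (D.nrm u * D.nrm v)"
proof -
  let ?E = "(real CARD('n))\<^sup>2 * \<omega> (tn n - tn (l - 1)) * (D.nrm u * D.nrm v)"
  have uv: "u \<in> H1 \<Omega>" "v \<in> H1 \<Omega>" using assms V_H1 by auto
  have l: "l \<in> {1..M}" and n: "n \<in> {1..M}" using assms by auto
  have close: "\<bar>a_form \<Omega> a t u v - a_form \<Omega> a s u v\<bar> \<le> ?E"
    if t: "t \<in> mesh_int tn n" and s: "s \<in> mesh_int tn l" for s t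
  proof -
    have ts: "t \<in> {0..T}" "s \<in> {0..T}" using t s mesh_int_sub l n by blast+
    have "tn l \<le> tn (n - 1)" using assms by (intro tn_mono) auto
    then have "\<bar>t - s\<bar> \<le> tn n - tn (l - 1)" using t s by (auto simp: mesh_int_def)
    moreover have r: "tn n - tn (l - 1) \<in> {0..T}"
      using tn_range[of n] tn_range'[of l] \<open>tn l \<le> tn (n - 1)\<close> tn_less[OF l] tn_less[OF n] assms by auto
    ultimately have \<omega>le: "\<omega> \<bar>t - s\<bar> \<le> \<omega> (tn n - tn (l - 1))"
      using \<omega>mono by (auto simp: monotone_on_def)
    have "AE x in lebesgue_on \<Omega>. \<bar>a i j t x - a i j s x\<bar> \<le> \<omega> (tn n - tn (l - 1))" for i j
    proof -
      have "AE x in lebesgue_on \<Omega>. \<bar>a i j t x - a i j s x\<bar> \<le> \<omega> \<bar>t - s\<bar>"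
        using adm ts unfolding admissible_coefficients_def by blast
      then show ?thesis by eventually_elim (use \<omega>le in linarith)
    qed
    from a_form_diff_le[OF \<Omega> reg[OF ts(1)] reg[OF ts(2)] uv this \<omega>0[OF r]]
    show ?thesis by (simp add: D.nrm_def)
  qed
  have av: "\<bar>A_km \<Omega> a tn n u v - a_form \<Omega> a s u v\<bar> \<le> ?E" if "s \<in> mesh_int tn l" for s
    unfolding A_km_eq mesh_step_def mesh_int_def
    using a_form_integrable[OF n uv] tn_less[OF n] close[OF _ that]
    by (intro integral_Ioc_bound) (auto simp: mesh_int_def)
  have "\<bar>A_km \<Omega> a tn l u v - A_km \<Omega> a tn n u v\<bar> \<le> ?E"
    unfolding A_km_eq[of l] mesh_step_def mesh_int_def
    using a_form_integrable[OF l uv] tn_less[OF l] av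
    by (intro integral_Ioc_bound) (auto simp: mesh_int_def abs_minus_commute)
  then show ?thesis by (simp add: abs_minus_commute)
qed

lemma V_basis:
  obtains B where "finite B" "B \<subseteq> V" "\<And>v. v \<in> V \<Longrightarrow> \<exists>w\<in>span B. AE x in lebesgue_on \<Omega>. v x = w x"
proof (rule fe_space_finite_dimensional[OF \<Omega>, of \<T> r])
  show "finite \<T>" using tri by (simp add: conformal_triangulation_def triangulation_def)
  show "\<Union>\<T> = closure \<Omega>" using tri by (simp add: conformal_triangulation_def)
  fix \<tau> assume "\<tau> \<in> \<T>"
  then obtain C where "\<not> affine_dependent C" "\<tau> = convex hull C"
    using tri unfolding conformal_triangulation_def simplex_def by blast
  then have "compact \<tau>" by (simp add: aff_independent_finite finite_imp_compact_convex_hull)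
  then show "\<tau> \<in> sets lebesgue" by (intro fmeasurableD lmeasurable_compact)
qed (rule that)

text \<open>
The functionals that occur respect almost everywhere classes, as the Riesz representation requires.
\<close>

lemma null_vector:
  assumes "v \<in> V" "AE x in lebesgue_on \<Omega>. v x = 0"
  shows "L2_inner \<Omega> v v = 0" "t \<in> {0..T} \<Longrightarrow> u \<in> V \<Longrightarrow> a_form \<Omega> a t u v = 0"
    "m \<in> {1..M} \<Longrightarrow> u \<in> V \<Longrightarrow> A_km \<Omega> a tn m u v = 0"
proof -
  show "L2_inner \<Omega> v v = 0" using assms V_L2 L2_inner_self_eq_0_iff by blast
  have a0: "a_form \<Omega> a t u v = 0" if "t \<in> {0..T}" "u \<in> V" for t u
    using a_form_cong_AE[OF \<Omega> reg[OF that(1)], of u v 0] a_form_0_right[OF \<Omega>] that assms V_H1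
    by (auto simp: subset_iff)
  then show "t \<in> {0..T} \<Longrightarrow> u \<in> V \<Longrightarrow> a_form \<Omega> a t u v = 0" .
  assume m: "m \<in> {1..M}" and u: "u \<in> V"
  have "(LINT t|lebesgue_on (mesh_int tn m). a_form \<Omega> a t u v) = (LINT t|lebesgue_on (mesh_int tn m). 0)"
    using a0 mesh_int_sub[OF m] u by (intro Bochner_Integration.integral_cong) auto
  then show "A_km \<Omega> a tn m u v = 0" by (simp add: A_km_eq)
qed

lemma riesz_V:
  assumes "linear_functional V F" and null: "\<And>v. \<lbrakk>v \<in> V; AE x in lebesgue_on \<Omega>. v x = 0\<rbrakk> \<Longrightarrow> F v = 0"
  shows "\<exists>w\<in>V. \<forall>v\<in>V. L2_inner \<Omega> w v = F v"
proof -
  obtain B where B: "finite B" "B \<subseteq> V" "\<And>v. v \<in> V \<Longrightarrow> \<exists>w\<in>span B. AE x in lebesgue_on \<Omega>. v x = w x"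
    using V_basis by blast
  show ?thesis
  proof (rule I.riesz[OF B(1,2) assms(1)])
    fix v assume v: "v \<in> V"
    show "F v = 0" if "L2_inner \<Omega> v v = 0"
      using that v V_L2 L2_inner_self_eq_0_iff by (intro null) auto
    obtain w where w: "w \<in> span B" "AE x in lebesgue_on \<Omega>. v x = w x" using B(3)[OF v] by blast
    have wV: "w \<in> V" using w(1) B(2) subspace_V span_minimal by blast
    have "AE x in lebesgue_on \<Omega>. (v - w) x = 0" using w(2) by eventually_elim simp
    then have "L2_inner \<Omega> (v - w) (v - w) = 0" using v wV by (intro null_vector) auto
    then show "\<exists>w\<in>span B. L2_inner \<Omega> (v - w) (v - w) = 0" using w by blast
  qed
qed

lemma riesz_A_km:
  assumes "m \<in> {1..M}" "w \<in> V"
  shows "\<exists>y\<in>V. \<forall>\<psi>\<in>V. L2_inner \<Omega> y \<psi> = A_km \<Omega> a tn m w \<psi>"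
  using null_vector(3)[OF _ _ assms]
  by (intro riesz_V semi_inner.linear_functional_ip[OF semi_inner_A_km]) (use assms in auto)

text \<open>
The Riesz representation for the inner product \<open>(u, v) + \<sigma> A\<^sub>m(u, v)\<close>.
\<close>

lemma resolvent_exists:
  assumes m: "m \<in> {1..M}" and \<sigma>: "\<sigma> \<ge> 0" and w: "w \<in> V"
  shows "\<exists>z\<in>V. \<forall>\<psi>\<in>V. L2_inner \<Omega> z \<psi> + \<sigma> * A_km \<Omega> a tn m z \<psi> = L2_inner \<Omega> w \<psi>"
proof -
  interpret A: semi_inner V "A_km \<Omega> a tn m" by (rule semi_inner_A_km[OF m])
  let ?b = "\<lambda>u v. L2_inner \<Omega> u v + \<sigma> * A_km \<Omega> a tn m u v"
  interpret b: semi_inner V ?b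
  proof
    fix u v assume "u \<in> V" "v \<in> V"
    then show "?b u v = ?b v u" using I.sym[of u v] A.sym[of u v] by simp
  qed (use \<sigma> in \<open>auto simp: subspace_V I.bilinear_simps A.bilinear_simps distrib_left I.nonneg A.nonneg\<close>)
  obtain B where B: "finite B" "B \<subseteq> V" "\<And>v. v \<in> V \<Longrightarrow> \<exists>w\<in>span B. AE x in lebesgue_on \<Omega>. v x = w x"
    using V_basis by blast
  show ?thesis
  proof (rule b.riesz[OF B(1,2) I.linear_functional_ip[OF w]])
    fix v assume v: "v \<in> V"
    show "L2_inner \<Omega> w v = 0" if "?b v v = 0"
    proof -
      have "L2_inner \<Omega> v v = 0"
        using that I.nonneg[OF v] A.nonneg[OF v] \<sigma> by (simp add: add_nonneg_eq_0_iff)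
      then show ?thesis using I.null_orthogonal v w by blast
    qed
    obtain w where w: "w \<in> span B" "AE x in lebesgue_on \<Omega>. v x = w x" using B(3)[OF v] by blast
    have wV: "w \<in> V" using w(1) B(2) subspace_V span_minimal by blast
    have "AE x in lebesgue_on \<Omega>. (v - w) x = 0" using w(2) by eventually_elim simp
    then have "?b (v - w) (v - w) = 0" using v wV m null_vector(1,3)[of "v - w"] by auto
    then show "\<exists>w\<in>span B. ?b (v - w) (v - w) = 0" using w by blast
  qed
qed

text \<open>
The three nested choices in the definition (the operator at a fixed time, its integral, and the average) are of
objects that exist, by the Riesz representation in \<open>V\<close>.
\<close>

lemma A_khm_props:
  assumes m: "m \<in> {1..M}" and v: "v \<in> V"
  shows "A_khm \<Omega> a V tn m v \<in> V"
    "\<psi> \<in> V \<Longrightarrow> L2_inner \<Omega> (A_khm \<Omega> a V tn m v) \<psi> = A_km \<Omega> a tn m v \<psi>"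
proof -
  let ?k = "mesh_step tn m"
  have k: "?k > 0" using step_pos[OF m] .
  interpret A: semi_inner V "A_km \<Omega> a tn m" by (rule semi_inner_A_km[OF m])
  have Ah: "L2_inner \<Omega> (A_h \<Omega> a V t v) \<psi> = a_form \<Omega> a t v \<psi>" if t: "t \<in> {0..T}" and "\<psi> \<in> V" for t \<psi>
  proof -
    have "semi_inner V (a_form \<Omega> a t)"
      by (rule semi_inner_subset[OF semi_inner_a_form[OF \<Omega> reg[OF t] \<alpha>] subspace_V V_H1])
    then have "\<exists>w. w \<in> V \<and> (\<forall>\<psi>\<in>V. L2_inner \<Omega> w \<psi> = a_form \<Omega> a t v \<psi>)"
      using riesz_V[OF semi_inner.linear_functional_ip[OF _ v]] null_vector(2)[OF _ _ t v] by blast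
    from someI_ex[OF this] show ?thesis using that(2) by (simp add: A_h_def)
  qed
  have "(LINT t|lebesgue_on (mesh_int tn m). L2_inner \<Omega> (A_h \<Omega> a V t v) \<psi>) = ?k * A_km \<Omega> a tn m v \<psi>" if "\<psi> \<in> V" for \<psi>
  proof -
    have "(LINT t|lebesgue_on (mesh_int tn m). L2_inner \<Omega> (A_h \<Omega> a V t v) \<psi>) = (LINT t|lebesgue_on (mesh_int tn m). a_form \<Omega> a t v \<psi>)"
      using Ah that mesh_int_sub[OF m] by (intro Bochner_Integration.integral_cong) auto
    then show ?thesis using k by (simp add: A_km_eq)
  qed
  moreover obtain y where y: "y \<in> V" "\<And>\<psi>. \<psi> \<in> V \<Longrightarrow> L2_inner \<Omega> y \<psi> = A_km \<Omega> a tn m v \<psi>"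
    using riesz_A_km[OF m v] by blast
  ultimately have "?k *\<^sub>R y \<in> V \<and> (\<forall>\<psi>\<in>V. L2_inner \<Omega> (?k *\<^sub>R y) \<psi>
      = (LINT t|lebesgue_on (mesh_int tn m). L2_inner \<Omega> (A_h \<Omega> a V t v) \<psi>))"
    by (simp add: I.scale_left)
  then have ex: "\<exists>w. w \<in> V \<and> (\<forall>\<psi>\<in>V. L2_inner \<Omega> w \<psi>
      = (LINT t|lebesgue_on (mesh_int tn m). L2_inner \<Omega> (A_h \<Omega> a V t v) \<psi>))" by blast
  define W where "W = V_integral \<Omega> V (mesh_int tn m) (\<lambda>t. A_h \<Omega> a V t v)"
  have W: "W \<in> V" "\<And>\<psi>. \<psi> \<in> V \<Longrightarrow> L2_inner \<Omega> W \<psi> = ?k * A_km \<Omega> a tn m v \<psi>"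
    using someI_ex[OF ex] \<open>\<And>\<psi>. \<psi> \<in> V \<Longrightarrow> (LINT t|_. _ t) = _\<close> by (simp_all add: W_def V_integral_def)
  have e: "A_khm \<Omega> a V tn m v = (1 / ?k) *\<^sub>R W"
    by (simp add: A_khm_def W_def scaleR_fun_def)
  show "A_khm \<Omega> a V tn m v \<in> V" unfolding e using W by auto
  show "L2_inner \<Omega> (A_khm \<Omega> a V tn m v) \<psi> = A_km \<Omega> a tn m v \<psi>" if "\<psi> \<in> V"
    unfolding e using W that k by (simp add: I.scale_left)
qed

lemma L2_proj_props:
  assumes u: "u \<in> L2 \<Omega>"
  shows "L2_proj \<Omega> V u \<in> V" "\<psi> \<in> V \<Longrightarrow> L2_inner \<Omega> (L2_proj \<Omega> V u) \<psi> = L2_inner \<Omega> u \<psi>"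
proof -
  have lf: "linear_functional V (L2_inner \<Omega> u)"
    using L2.linear_functional_ip[OF u] subsetD[OF V_L2] by (simp add: linear_functional_def)
  have null: "L2_inner \<Omega> u v = 0" if "v \<in> V" "AE x in lebesgue_on \<Omega>. v x = 0" for v
    using L2.null_orthogonal[OF _ null_vector(1)[OF that] u] that V_L2 by blast
  obtain w where w: "w \<in> V" "\<And>v. v \<in> V \<Longrightarrow> L2_inner \<Omega> w v = L2_inner \<Omega> u v"
    using riesz_V[OF lf null] by blast
  have iff: "L2_inner \<Omega> (\<lambda>x. u x - w x) \<psi> = 0 \<longleftrightarrow> L2_inner \<Omega> w \<psi> = L2_inner \<Omega> u \<psi>" if "w \<in> V" "\<psi> \<in> V" for w \<psi>
    using L2.diff_left[of u \<Omega> w \<psi>] u subsetD[OF V_L2 that(1)] subsetD[OF V_L2 that(2)]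
    by (auto simp: fun_diff_def)
  have "\<exists>w. w \<in> V \<and> (\<forall>\<psi>\<in>V. L2_inner \<Omega> (\<lambda>x. u x - w x) \<psi> = 0)"
    using w iff by blast
  from someI_ex[OF this]
  have P: "L2_proj \<Omega> V u \<in> V \<and> (\<forall>\<psi>\<in>V. L2_inner \<Omega> (\<lambda>x. u x - L2_proj \<Omega> V u x) \<psi> = 0)"
    by (simp add: L2_proj_def)
  then show "L2_proj \<Omega> V u \<in> V" by blast
  show "L2_inner \<Omega> (L2_proj \<Omega> V u) \<psi> = L2_inner \<Omega> u \<psi>" if "\<psi> \<in> V"
    using P iff that by blast
qed

section \<open>The fully discrete scheme\<close>

text \<open>
Test functions supported in a single time step localise the scheme to that step.
\<close>

definition hat :: "nat \<Rightarrow> (real^'n \<Rightarrow> real) \<Rightarrow> real \<Rightarrow> real^'n \<Rightarrow> real" where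
  "hat m \<psi> t = (if t \<in> mesh_int tn m then \<psi> else 0)"

lemma hat_pw_const:
  assumes "m \<in> {1..M}" "\<psi> \<in> V"
  shows "hat m \<psi> \<in> pw_const V M tn"
  unfolding pw_const_def
proof (intro CollectI ballI)
  fix l assume l: "l \<in> {1..M}"
  show "\<exists>w\<in>V. \<forall>t\<in>mesh_int tn l. hat m \<psi> t = w"
  proof (cases "l = m")
    case True
    then show ?thesis using assms by (auto simp: hat_def)
  next
    case False
    then have "\<forall>t\<in>mesh_int tn l. hat m \<psi> t = 0"
      using mesh_int_unique[OF _ _ assms(1) l] by (auto simp: hat_def)
    then show ?thesis using I.mem(1) by blast
  qed
qed

lemma hat_node: "\<lbrakk>m \<in> {1..M}; l \<in> {1..M}\<rbrakk> \<Longrightarrow> hat m \<psi> (tn l) = (if l = m then \<psi> else 0)"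
  using mesh_int_unique[OF _ node_in_mesh_int[of l], of m] node_in_mesh_int[of m] by (auto simp: hat_def)

text \<open>
The last step contains the end point \<open>T\<close>, which the open time interval omits; this is a null set.
\<close>

lemma integral_over_step:
  assumes m: "m \<in> {1..M}" and g: "integrable (lebesgue_on (mesh_int tn m)) g"
  shows "(LINT t|lebesgue_on {0<..<T}. (if t \<in> mesh_int tn m then g t else 0)) = (LINT t|lebesgue_on (mesh_int tn m). (g t :: real))"
proof -
  let ?I = "mesh_int tn m"
  have sI: "?I \<in> sets lebesgue" by (simp add: mesh_int_def)
  have gi: "integrable lebesgue (\<lambda>t. indicator ?I t *\<^sub>R g t)"
    using g sI by (simp add: integrable_restrict_space)
  have "(LINT t|lebesgue_on {0<..<T}. (if t \<in> ?I then g t else 0))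
      = (LINT t|lebesgue_on {0<..<T}. indicator ?I t *\<^sub>R g t)"
    by (rule Bochner_Integration.integral_cong) auto
  also have "\<dots> = (LINT t|lebesgue. indicator {0<..<T} t *\<^sub>R (indicator ?I t *\<^sub>R g t))"
    by (subst integral_restrict_space) auto
  also have "\<dots> = (LINT t|lebesgue. indicator ?I t *\<^sub>R g t)"
  proof (rule integral_cong_AE)
    have "AE t in lebesgue. t \<noteq> T"
      by (rule AE_completion) (rule AE_lborel_singleton)
    then show "AE t in lebesgue. indicator {0<..<T} t *\<^sub>R (indicator ?I t *\<^sub>R g t) = indicator ?I t *\<^sub>R g t"
      using tn_range[of m] tn_range'[of m] m
      by (elim eventually_mono) (auto simp: indicator_def mesh_int_def)
    show meas: "(\<lambda>t. indicator ?I t *\<^sub>R g t) \<in> borel_measurable lebesgue" using gi by blast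
    show "(\<lambda>t. indicator {0<..<T} t *\<^sub>R (indicator ?I t *\<^sub>R g t)) \<in> borel_measurable lebesgue"
      by (rule borel_measurable_scaleR[OF borel_measurable_indicator meas]) simp
  qed
  also have "\<dots> = (LINT t|lebesgue_on ?I. g t)"
    using sI by (subst integral_restrict_space) auto
  finally show ?thesis .
qed

text \<open>
Integrating over the whole time interval against \<open>hat\<close> makes this the right-hand side of the scheme verbatim.
\<close>

definition load :: "(real \<Rightarrow> real^'n \<Rightarrow> real) \<Rightarrow> nat \<Rightarrow> (real^'n \<Rightarrow> real) \<Rightarrow> real" where
  "load f m \<psi> = 1 / mesh_step tn m * (LINT t|lebesgue_on {0<..<T}. L2_inner \<Omega> (f t) (hat m \<psi> t))"

text \<open>
With the projected initial value in position zero, the first step has the same form as the others.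
\<close>

definition state :: "(real^'n \<Rightarrow> real) \<Rightarrow> (real \<Rightarrow> real^'n \<Rightarrow> real) \<Rightarrow> nat \<Rightarrow> real^'n \<Rightarrow> real" where
  "state u\<^sub>0 u m = (if m = 0 then L2_proj \<Omega> V u\<^sub>0 else u (tn m))"

text \<open>
A pointwise bound on the integrand suffices: an integral that fails to exist has the value zero.
\<close>

lemma load_bound:
  assumes f: "f \<in> Linfty_L2 \<Omega> {0<..<T}" and m: "m \<in> {1..M}" and \<psi>: "\<psi> \<in> V"
  shows "\<bar>load f m \<psi>\<bar> \<le> Linfty_L2_norm \<Omega> {0<..<T} f * I.nrm \<psi>"
proof -
  let ?B = "Linfty_L2_norm \<Omega> {0<..<T} f" and ?I = "mesh_int tn m" and ?J = "{0<..<T}"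
  have \<psi>L: "\<psi> \<in> L2 \<Omega>" using \<psi> V_L2 by blast
  have "integrable (lebesgue_on ?I) (\<lambda>t. ?B * I.nrm \<psi>)"
    unfolding mesh_int_def by (intro continuous_integrable_Ioc[of T])
      (use tn_range[of m] tn_range'[of m] m in auto)
  note step = integral_over_step[OF m this]
  let ?h = "\<lambda>t. if t \<in> ?I then ?B * I.nrm \<psi> else 0"
  have meas: "measure (lebesgue_on ?I) (space (lebesgue_on ?I)) = mesh_step tn m"
    unfolding mesh_int_def mesh_step_def using tn_less[OF m] by (intro measure_lebesgue_on_Ioc) auto
  have hi: "integrable (lebesgue_on ?J) ?h"
  proof -
    interpret finite_measure "lebesgue_on ?J"
      by (intro finite_measure_lebesgue_on bounded_set_imp_lmeasurable) (auto intro: bounded_subset[of "{0..T}"])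
    have "?h \<in> borel_measurable (lebesgue_on ?J)"
      by (intro measurable_restrict_space1 measurable_If_set) (auto simp: mesh_int_def)
    then show ?thesis by (intro integrable_const_bound[where B = "\<bar>?B * I.nrm \<psi>\<bar>"]) auto
  qed
  have "\<bar>LINT t|lebesgue_on ?J. L2_inner \<Omega> (f t) (hat m \<psi> t)\<bar> \<le> (LINT t|lebesgue_on ?J. ?h t)"
  proof (rule integral_abs_le_AE[OF hi])
    show "AE t in lebesgue_on ?J. \<bar>L2_inner \<Omega> (f t) (hat m \<psi> t)\<bar> \<le> ?h t"
      using Linfty_L2_norm_bound[OF f]
    proof eventually_elim
      case (elim t)
      show ?case
      proof (cases "t \<in> ?I")
        case True
        have "\<bar>L2_inner \<Omega> (f t) \<psi>\<bar> \<le> L2.nrm \<Omega> (f t) * L2.nrm \<Omega> \<psi>"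
          using elim \<psi>L by (intro L2.cauchy_schwarz) auto
        also have "\<dots> \<le> ?B * L2.nrm \<Omega> \<psi>"
          using elim \<psi>L by (intro mult_right_mono) (auto simp: L2_norm_eq_nrm)
        finally show ?thesis using True by (simp add: hat_def)
      next
        case False
        then show ?thesis using elim by (simp add: hat_def)
      qed
    qed
  qed
  also have "\<dots> = ?B * I.nrm \<psi> * mesh_step tn m"
    unfolding step using meas by simp
  finally show ?thesis using step_pos[OF m] by (simp add: load_def abs_mult field_simps)
qed

lemma state_in_V:
  assumes sol: "fully_discrete_solution \<Omega> T a V M tn f u\<^sub>0 u" and u0: "u\<^sub>0 \<in> L2 \<Omega>" and "m \<le> M"
  shows "state u\<^sub>0 u m \<in> V"
    and "m \<noteq> 0 \<Longrightarrow> t \<in> mesh_int tn m \<Longrightarrow> u t = state u\<^sub>0 u m"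
proof -
  have *: "\<exists>w\<in>V. \<forall>t\<in>mesh_int tn m. u t = w" if "m \<noteq> 0"
    using sol assms(3) that by (auto simp: fully_discrete_solution_def pw_const_def)
  show "state u\<^sub>0 u m \<in> V"
  proof (cases "m = 0")
    case True
    then show ?thesis using L2_proj_props(1)[OF u0] by (simp add: state_def)
  next
    case False
    then show ?thesis using * node_in_mesh_int[of m] assms(3) by (auto simp: state_def)
  qed
  assume "m \<noteq> 0" "t \<in> mesh_int tn m"
  moreover have "tn m \<in> mesh_int tn m" using node_in_mesh_int[of m] assms(3) calculation by auto
  ultimately show "u t = state u\<^sub>0 u m" using * by (auto simp: state_def)
qed

lemma euler_equation:
  assumes sol: "fully_discrete_solution \<Omega> T a V M tn f u\<^sub>0 u" and u0: "u\<^sub>0 \<in> L2 \<Omega>"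
    and m: "m \<in> {1..M}" and \<psi>: "\<psi> \<in> V"
  shows "L2_inner \<Omega> (state u\<^sub>0 u m - state u\<^sub>0 u (m - 1)) \<psi>
    + mesh_step tn m * A_km \<Omega> a tn m (state u\<^sub>0 u m) \<psi> = mesh_step tn m * load f m \<psi>"
proof -
  let ?U = "state u\<^sub>0 u"
  have UV: "?U l \<in> V" if "l \<le> M" for l using state_in_V(1)[OF sol u0 that] .
  have k: "mesh_step tn m > 0" by (rule step_pos[OF m])
  have "(LINT t|lebesgue_on {0<..<T}. a_form \<Omega> a t (u t) (hat m \<psi> t))
      = (LINT t|lebesgue_on {0<..<T}. (if t \<in> mesh_int tn m then a_form \<Omega> a t (?U m) \<psi> else 0))"
    using state_in_V(2)[OF sol u0, of m] m
    by (intro Bochner_Integration.integral_cong) (auto simp: hat_def a_form_0_right[OF \<Omega>])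
  also have "\<dots> = mesh_step tn m * A_km \<Omega> a tn m (?U m) \<psi>"
    using k by (subst integral_over_step[OF m a_form_integrable[OF m]])
      (use UV[of m] m \<psi> V_H1 in \<open>auto simp: A_km_eq\<close>)
  finally have 1: "(LINT t|lebesgue_on {0<..<T}. a_form \<Omega> a t (u t) (hat m \<psi> t)) = mesh_step tn m * A_km \<Omega> a tn m (?U m) \<psi>" .
  have zero: "L2_inner \<Omega> w 0 = 0" for w by (simp add: L2_inner_def)
  have "(\<Sum>l=2..M. L2_inner \<Omega> (\<lambda>x. u (tn l) x - u (tn (l - 1)) x) (hat m \<psi> (tn l)))
      = (\<Sum>l=2..M. if l = m then L2_inner \<Omega> (?U m - ?U (m - 1)) \<psi> else 0)"
    using m by (intro sum.cong) (auto simp: hat_node zero state_def fun_diff_def)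
  also have "\<dots> = (if m = 1 then 0 else L2_inner \<Omega> (?U m - ?U (m - 1)) \<psi>)"
    using m by (subst sum.delta) auto
  finally have 2: "(\<Sum>l=2..M. L2_inner \<Omega> (\<lambda>x. u (tn l) x - u (tn (l - 1)) x) (hat m \<psi> (tn l)))
      = (if m = 1 then 0 else L2_inner \<Omega> (?U m - ?U (m - 1)) \<psi>)" .
  have 3: "L2_inner \<Omega> w (hat m \<psi> (tn 1)) = (if m = 1 then L2_inner \<Omega> w \<psi> else 0)" for w
    using hat_node[OF m, of 1] M_pos zero by auto
  have 4: "(LINT t|lebesgue_on {0<..<T}. L2_inner \<Omega> (f t) (hat m \<psi> t)) = mesh_step tn m * load f m \<psi>"
    using k by (simp add: load_def)
  have eq: "(LINT t|lebesgue_on {0<..<T}. a_form \<Omega> a t (u t) (hat m \<psi> t)) +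
        (\<Sum>l=2..M. L2_inner \<Omega> (\<lambda>x. u (tn l) x - u (tn (l - 1)) x) (hat m \<psi> (tn l))) +
        L2_inner \<Omega> (u (tn 1)) (hat m \<psi> (tn 1))
        = (LINT t|lebesgue_on {0<..<T}. L2_inner \<Omega> (f t) (hat m \<psi> t)) + L2_inner \<Omega> u\<^sub>0 (hat m \<psi> (tn 1))"
    using sol hat_pw_const[OF m \<psi>] unfolding fully_discrete_solution_def by blast
  show ?thesis
  proof (cases "m = 1")
    case True
    have "L2_inner \<Omega> (?U m - ?U (m - 1)) \<psi> = L2_inner \<Omega> (u (tn 1)) \<psi> - L2_inner \<Omega> u\<^sub>0 \<psi>"
      using UV[of m] UV[of 0] m \<psi> True L2_proj_props(2)[OF u0 \<psi>]
      by (simp add: I.diff_left) (simp add: state_def)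
    then show ?thesis using eq unfolding 1 2 3 4 using True by simp
  next
    case False
    then show ?thesis using eq unfolding 1 2 3 4 by simp
  qed
qed

text \<open>
By the scheme, the jump quotient represents \<open>load f m - A\<^sub>m u\<^sub>m\<close>; test with itself.
\<close>

lemma jump_quotient_bound:
  assumes sol: "fully_discrete_solution \<Omega> T a V M tn f u\<^sub>0 u" and u0: "u\<^sub>0 \<in> L2 \<Omega>"
    and f: "f \<in> Linfty_L2 \<Omega> {0<..<T}" and m: "m \<in> {1..M}"
  shows "L2_norm \<Omega> (\<lambda>x. jump \<Omega> V tn u\<^sub>0 u (m - 1) x / mesh_step tn m)
    \<le> Linfty_L2_norm \<Omega> {0<..<T} f + L2_norm \<Omega> (A_khm \<Omega> a V tn m (u (tn m)))"
proof -
  let ?U = "state u\<^sub>0 u" and ?B = "Linfty_L2_norm \<Omega> {0<..<T} f" and ?W = "A_khm \<Omega> a V tn m (u (tn m))"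
  have UV: "?U m \<in> V" "?U (m - 1) \<in> V" using state_in_V(1)[OF sol u0] m by auto
  have Um: "u (tn m) = ?U m" using m by (simp add: state_def)
  have k: "mesh_step tn m > 0" by (rule step_pos[OF m])
  define J where "J = (1 / mesh_step tn m) *\<^sub>R (?U m - ?U (m - 1))"
  have JV: "J \<in> V" using UV by (simp add: J_def)
  have W: "?W \<in> V" "L2_inner \<Omega> ?W J = A_km \<Omega> a tn m (?U m) J"
    using A_khm_props[OF m UV(1)] JV by (simp_all add: Um)
  have Jeq: "(\<lambda>x. jump \<Omega> V tn u\<^sub>0 u (m - 1) x / mesh_step tn m) = J"
    using m by (auto simp: jump_def J_def state_def fun_eq_iff diff_divide_distrib)
  have "mesh_step tn m * L2_inner \<Omega> J J = L2_inner \<Omega> (?U m - ?U (m - 1)) J"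
    using k UV JV by (simp add: J_def I.scale_left)
  also have "\<dots> = mesh_step tn m * (load f m J - L2_inner \<Omega> ?W J)"
    using euler_equation[OF sol u0 m JV] W by (simp add: algebra_simps)
  finally have "L2_inner \<Omega> J J = load f m J - L2_inner \<Omega> ?W J" using k by simp
  also have "\<dots> \<le> ?B * I.nrm J + I.nrm ?W * I.nrm J"
    using load_bound[OF f m JV] I.cauchy_schwarz[OF W(1) JV] by linarith
  finally have sq: "I.nrm J * I.nrm J \<le> (?B + I.nrm ?W) * I.nrm J"
    using I.nrm_sq[OF JV] by (simp add: power2_eq_square algebra_simps)
  have "I.nrm J \<le> ?B + I.nrm ?W" if "I.nrm J > 0"
    using sq that by simp
  moreover have "0 \<le> ?B" by (rule Linfty_L2_norm_nonneg[OF f T])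
  ultimately have "I.nrm J \<le> ?B + I.nrm ?W"
    using I.nrm_nonneg[OF JV] I.nrm_nonneg[OF W(1)] by (cases "I.nrm J = 0") auto
  then show ?thesis unfolding Jeq L2_norm_eq_nrm .
qed

end

section \<open>The stability estimate\<close>

theorem theorem3p15:
  fixes \<Omega> :: "(real^'n) set"
    and T \<alpha> c \<beta> \<kappa> :: real
    and a :: "'n \<Rightarrow> 'n \<Rightarrow> real \<Rightarrow> real^'n \<Rightarrow> real"
    and \<omega> :: "real \<Rightarrow> real"
  assumes "bounded \<Omega>" and "lipschitz_domain \<Omega>" and "polyhedral_set \<Omega>"
    and "T > 0" and "\<alpha> > 0"
    and "modulus T \<omega>" and "admissible_coefficients \<Omega> T a \<alpha> \<omega>"
    and "c > 0" and "\<beta> > 0" and "\<kappa> > 0"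
  shows "\<exists>\<mu>>0. \<exists>\<delta>\<^sub>0>0. \<exists>C>0. \<forall>M tn \<T> r f u\<^sub>0 u.
    time_mesh T c \<beta> \<kappa> M tn \<longrightarrow> k_max M tn - k_min M tn \<le> \<delta>\<^sub>0 \<longrightarrow>
    conformal_triangulation \<Omega> \<T> \<longrightarrow> r \<ge> 1 \<longrightarrow>
    f \<in> Linfty_L2 \<Omega> {0<..<T} \<longrightarrow>
    u\<^sub>0 \<in> H10 \<Omega> \<longrightarrow> (\<forall>m\<in>{1..M}. functional_in_L2 \<Omega> (A_km \<Omega> a tn m u\<^sub>0)) \<longrightarrow>
    fully_discrete_solution \<Omega> T a (fe_space \<Omega> \<T> r) M tn f u\<^sub>0 u \<longrightarrow>
    (MAX m\<in>{1..M}.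
        L2_norm \<Omega> (A_khm \<Omega> a (fe_space \<Omega> \<T> r) tn m (u (tn m))) +
        L2_norm \<Omega> (\<lambda>x. jump \<Omega> (fe_space \<Omega> \<T> r) tn u\<^sub>0 u (m - 1) x / mesh_step tn m))
    \<le> C * exp (\<mu> * T) *
       (ln (T / k_max M tn) * Linfty_L2_norm \<Omega> {0<..<T} f +
        \<mu> * T * (MAX m\<in>{1..M}.
          L2_norm \<Omega> (A_khm \<Omega> a (fe_space \<Omega> \<T> r) tn m (L2_proj \<Omega> (fe_space \<Omega> \<T> r) u\<^sub>0))))"
proof -
  have \<Omega>: "bounded \<Omega>" "open \<Omega>" using assms(1,2) by (auto simp: lipschitz_domain_def)
  obtain K where reg: "\<And>t. t \<in> {0..T} \<Longrightarrow> regular_coefficients \<Omega> \<alpha> K a t"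
    using coefficient_slices_regular[OF \<Omega>(2) assms(4,7)] by blast
  obtain R where R: "R > 0" "\<And>x. x \<in> \<Omega> \<Longrightarrow> norm x \<le> R"
    using \<Omega>(1) unfolding bounded_pos by blast
  define L where "L = (real CARD('n))\<^sup>2"
  define P where "P = 2 * R"
  \<comment> \<open>The constant in front of the kernel sum; \<open>\<mu>\<close> is chosen to make the product of \<open>\<Gamma>\<close> and the kernel integral at most \<open>1 / 2\<close>.\<close>
  define \<Gamma> where "\<Gamma> = P / \<alpha> * L / sqrt (\<alpha> * (2 / (3 * (1 + \<kappa>)\<^sup>2)))"
  have pos: "L > 0" "P > 0" using R by (auto simp: L_def P_def)
  have \<Gamma>: "\<Gamma> > 0" using pos assms by (simp add: \<Gamma>_def)
  have \<omega>0: "\<And>s. s \<in> {0..T} \<Longrightarrow> 0 \<le> \<omega> s" and \<omega>mono: "mono_on {0..T} \<omega>"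
    and anti: "antimono_on {0<..T} (\<lambda>s. \<omega> s / s powr (3 / 2))"
    using assms(6) by (auto simp: modulus_def)
  have "integrable (lebesgue_on {0<..<T}) (\<lambda>t. \<omega> t * t powr (- 3 / 2))"
    using assms(6) by (simp add: modulus_def)
  moreover have "\<omega> t * t powr (- 3 / 2) = \<omega> t / t powr (3 / 2)" for t
    by (simp add: powr_minus_divide)
  ultimately have dini: "integrable (lebesgue_on {0<..<T}) (\<lambda>t. \<omega> t / t powr (3 / 2))" by simp
  have \<kappa>1: "1 + \<kappa> > 0" using assms by simp
  have "1 / (2 * \<Gamma>) > 0" using \<Gamma> by simp
  from exponential_weight_small[OF dini \<kappa>1 this] obtain \<mu> where \<mu>: "\<mu> > 0"
    and \<mu>int: "integrable (lebesgue_on {0<..<T}) (\<lambda>s. \<omega> s / s powr (3 / 2) * exp (- \<mu> * s / (1 + \<kappa>)))"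
    and \<mu>small: "(LINT s|lebesgue_on {0<..<T}. \<omega> s / s powr (3 / 2) * exp (- \<mu> * s / (1 + \<kappa>))) \<le> 1 / (2 * \<Gamma>)"
    by blast
  define \<Lambda> where "\<Lambda> = 1 + \<beta> + \<bar>(1 - \<beta>) * ln T - ln c\<bar>"
  have \<Lambda>: "\<Lambda> > 0" using assms by (simp add: \<Lambda>_def add_pos_nonneg)
  \<comment> \<open>The factor \<open>\<mu> T\<close> in front of the initial data is compensated by \<open>4 / (\<mu> T)\<close>.\<close>
  define C where "C = 4 * \<Lambda> + 1 + 4 / (\<mu> * T)"
  have C: "C > 0" using \<Lambda> \<mu> assms by (simp add: C_def add_pos_nonneg)
  have "(MAX m\<in>{1..M}.
        L2_norm \<Omega> (A_khm \<Omega> a (fe_space \<Omega> \<T> r) tn m (u (tn m))) +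
        L2_norm \<Omega> (\<lambda>x. jump \<Omega> (fe_space \<Omega> \<T> r) tn u\<^sub>0 u (m - 1) x / mesh_step tn m))
    \<le> C * exp (\<mu> * T) *
       (ln (T / k_max M tn) * Linfty_L2_norm \<Omega> {0<..<T} f +
        \<mu> * T * (MAX m\<in>{1..M}.
          L2_norm \<Omega> (A_khm \<Omega> a (fe_space \<Omega> \<T> r) tn m (L2_proj \<Omega> (fe_space \<Omega> \<T> r) u\<^sub>0))))"
    if mesh: "time_mesh T c \<beta> \<kappa> M tn" and tri: "conformal_triangulation \<Omega> \<T>"
      and f: "f \<in> Linfty_L2 \<Omega> {0<..<T}" and u0: "u\<^sub>0 \<in> H10 \<Omega>"
      and sol: "fully_discrete_solution \<Omega> T a (fe_space \<Omega> \<T> r) M tn f u\<^sub>0 u"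
    for M tn \<T> r f u\<^sub>0 u
  proof -
    interpret discretization \<Omega> T \<alpha> K c \<beta> \<kappa> a \<omega> M tn \<T> r
      by standard (fact \<Omega> assms reg mesh tri \<omega>0 \<omega>mono)+
    have u0L: "u\<^sub>0 \<in> L2 \<Omega>" using u0 H10_H1 H1_L2 by blast
    have ratio: "mesh_step tn m \<le> \<kappa> * mesh_step tn (m + 1) \<and> mesh_step tn (m + 1) \<le> \<kappa> * mesh_step tn m"
      if "m \<in> {1..<M}" for m
    proof -
      have "mesh_step tn m > 0" "mesh_step tn (m + 1) > 0" using step_pos that by auto
      moreover have "1 / \<kappa> \<le> mesh_step tn m / mesh_step tn (m + 1)" "mesh_step tn m / mesh_step tn (m + 1) \<le> \<kappa>"
        using mesh that by (auto simp: time_mesh_def)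
      ultimately show ?thesis using \<kappa> by (simp add: field_simps)
    qed
    interpret S: parabolic_scheme V "L2_inner \<Omega>" "dirichlet \<Omega>" "A_km \<Omega> a tn" tn M T \<alpha> \<kappa> P L \<omega>
    proof (intro parabolic_scheme.intro parabolic_scheme_axioms.intro I.semi_inner_axioms D.semi_inner_axioms)
      fix m assume m: "m \<in> {1..M}"
      show "semi_inner V (A_km \<Omega> a tn m)" by (rule semi_inner_A_km[OF m])
      show "\<alpha> * dirichlet \<Omega> v v \<le> A_km \<Omega> a tn m v v" if "v \<in> V" for v
        using A_km_coercive[OF m] that V_H1 by blast
      show "\<exists>y\<in>V. \<forall>\<psi>\<in>V. L2_inner \<Omega> y \<psi> = A_km \<Omega> a tn m w \<psi>" if "w \<in> V" for w
        by (rule riesz_A_km[OF m that])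
      show "\<exists>z\<in>V. \<forall>\<psi>\<in>V. L2_inner \<Omega> z \<psi> + c * A_km \<Omega> a tn m z \<psi> = L2_inner \<Omega> w \<psi>"
        if "c \<ge> 0" "w \<in> V" for c w
        by (rule resolvent_exists[OF m that])
      show "tn (m - 1) < tn m" by (rule tn_less[OF m])
    next
      fix v assume "v \<in> V"
      then show "I.nrm v \<le> P * D.nrm v"
        using poincare_H10[OF \<Omega> _ R(2), of v] R(1) V_H10 by (auto simp: D.nrm_def P_def)
    next
      fix l n v w assume "1 \<le> l" "l < n" "n \<le> M" "v \<in> V" "w \<in> V"
      then show "\<bar>A_km \<Omega> a tn n v w - A_km \<Omega> a tn l v w\<bar> \<le> L * \<omega> (tn n - tn (l - 1)) * (D.nrm v * D.nrm w)"
        unfolding L_def by (rule A_km_close)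
    next
      fix l assume "l \<in> {1..<M}"
      then show "tn l - tn (l - 1) \<le> \<kappa> * (tn (Suc l) - tn l)" "tn (Suc l) - tn l \<le> \<kappa> * (tn l - tn (l - 1))"
        using ratio[of l] by (auto simp: mesh_step_def)
    qed (use pos \<alpha> \<kappa> \<omega>0 tn0 tnM in auto)
    let ?U = "state u\<^sub>0 u" and ?B = "Linfty_L2_norm \<Omega> {0<..<T} f"
    let ?g = "\<lambda>m. A_khm \<Omega> a V tn m (L2_proj \<Omega> V u\<^sub>0)" and ?w = "\<lambda>m. A_khm \<Omega> a V tn m (u (tn m))"
    define G where "G = (MAX m\<in>{1..M}. L2_norm \<Omega> (?g m))"
    define logk where "logk = ln (T / k_max M tn)"
    have ne: "{1..M} \<noteq> {}" using M_pos by auto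
    have kmin: "k_min M tn \<le> mesh_step tn m" if "m \<in> {1..M}" for m
      using that by (auto simp: k_min_def)
    have "k_min M tn \<in> mesh_step tn ` {1..M}" unfolding k_min_def using ne by (intro Min_in) auto
    then have kmin0: "k_min M tn > 0" using step_pos by auto
    have "k_max M tn \<in> mesh_step tn ` {1..M}" unfolding k_max_def using ne by (intro Max_in) auto
    then have kmax0: "k_max M tn > 0" using step_pos by auto
    have log: "1 + ln (T / k_min M tn) \<le> \<Lambda> * logk" "1 \<le> logk"
      unfolding \<Lambda>_def logk_def
      using log_mesh_ratio[OF \<open>c > 0\<close> \<open>\<beta> > 0\<close> T kmax0, of "k_min M tn"] mesh
      by (simp_all add: time_mesh_def)
    have B0: "?B \<ge> 0" by (rule Linfty_L2_norm_nonneg[OF f T])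
    have gG: "I.nrm (?g m) \<le> G" if "m \<in> {1..M}" for m
      unfolding G_def using that by (subst L2_norm_eq_nrm[symmetric], intro Max_ge) auto
    have g0: "0 \<le> G"
    proof -
      have "0 \<le> I.nrm (?g 1)"
        using A_khm_props(1)[of 1, OF _ L2_proj_props(1)[OF u0L]] M_pos by auto
      then show ?thesis using gG[of 1] M_pos by simp
    qed
    have main: "I.nrm (?w n) \<le> 2 * exp (\<mu> * T) * (G + ?B * (1 + ln (T / k_min M tn)))" if n: "n \<in> {1..M}" for n
    proof (rule S.maximal_regularity[where u = ?U and w = ?w and g = ?g and F = "load f"])
      show "?U l \<in> V" if "l \<le> M" for l by (rule state_in_V(1)[OF sol u0L that])
      show "L2_inner \<Omega> (?U l - ?U (l - 1)) \<psi> + (tn l - tn (l - 1)) * A_km \<Omega> a tn l (?U l) \<psi> = (tn l - tn (l - 1)) * load f l \<psi>"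
        if "l \<in> {1..M}" "\<psi> \<in> V" for l \<psi>
        using euler_equation[OF sol u0L that] by (simp add: mesh_step_def)
      show "\<bar>load f l \<psi>\<bar> \<le> ?B * I.nrm \<psi>" if "l \<in> {1..M}" "\<psi> \<in> V" for l \<psi>
        by (rule load_bound[OF f that])
      have ut: "u (tn l) = ?U l" "u (tn l) \<in> V" if "l \<in> {1..M}" for l
        using that state_in_V(1)[OF sol u0L, of l] by (auto simp: state_def)
      show "?w l \<in> V" if "l \<in> {1..M}" for l
        by (rule A_khm_props(1)[OF that ut(2)[OF that]])
      show "L2_inner \<Omega> (?w l) \<psi> = A_km \<Omega> a tn l (?U l) \<psi>" if "l \<in> {1..M}" "\<psi> \<in> V" for l \<psi>
        using A_khm_props(2)[OF that(1) ut(2)[OF that(1)] that(2)] ut(1)[OF that(1)] by simp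
      show "?g l \<in> V" if "l \<in> {1..M}" for l
        by (rule A_khm_props(1)[OF that L2_proj_props(1)[OF u0L]])
      show "L2_inner \<Omega> (?g l) \<psi> = A_km \<Omega> a tn l (?U 0) \<psi>" if "l \<in> {1..M}" "\<psi> \<in> V" for l \<psi>
        using A_khm_props(2)[OF that(1) L2_proj_props(1)[OF u0L] that(2)] by (simp add: state_def)
      show "k_min M tn \<le> tn l - tn (l - 1)" if "l \<in> {1..M}" for l
        using kmin[OF that] by (simp add: mesh_step_def)
      have "S.\<Gamma> = \<Gamma>" by (simp add: S.\<Gamma>_def \<Gamma>_def)
      then show "S.\<Gamma> * (LINT s|lebesgue_on {0<..<T}. \<omega> s / s powr (3 / 2) * exp (- \<mu> * s / (1 + \<kappa>))) \<le> 1 / 2"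
        using mult_left_mono[OF \<mu>small, of \<Gamma>] \<Gamma> by simp
    qed (use gG B0 kmin0 anti \<mu>int \<mu> n in auto)
    have "L2_norm \<Omega> (?w m) + L2_norm \<Omega> (\<lambda>x. jump \<Omega> V tn u\<^sub>0 u (m - 1) x / mesh_step tn m)
        \<le> C * exp (\<mu> * T) * (logk * ?B + \<mu> * T * G)" if m: "m \<in> {1..M}" for m
    proof -
      let ?e = "exp (\<mu> * T)"
      have e1: "1 \<le> ?e" using \<mu> T by simp
      have "I.nrm (?w m) \<le> 2 * ?e * (G + ?B * (\<Lambda> * logk))"
        using main[OF m] log(1) B0 by (elim order_trans, intro mult_left_mono add_left_mono) auto
      moreover have "1 * ?B \<le> (?e * logk) * ?B"
        using mult_mono[OF e1 log(2)] B0 by (intro mult_right_mono) auto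
      ultimately have "2 * I.nrm (?w m) + ?B \<le> ?e * ((4 * \<Lambda> + 1) * (logk * ?B) + 4 / (\<mu> * T) * (\<mu> * T * G))"
        using \<mu> T by (simp add: algebra_simps)
      also have "\<dots> \<le> ?e * (C * (logk * ?B) + C * (\<mu> * T * G))"
        using \<mu> T \<Lambda> B0 g0 log(2)
        by (intro mult_left_mono add_mono mult_right_mono) (auto simp: C_def)
      also have "\<dots> = C * ?e * (logk * ?B + \<mu> * T * G)" by (simp add: algebra_simps)
      finally have "2 * I.nrm (?w m) + ?B \<le> C * ?e * (logk * ?B + \<mu> * T * G)" .
      then show ?thesis
        using jump_quotient_bound[OF sol u0L f m] by (simp add: L2_norm_eq_nrm)
    qed
    then show ?thesis
      unfolding G_def[symmetric] logk_def[symmetric] using ne by (intro Max.boundedI) auto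
  qed
  then show ?thesis using \<mu> C by (intro exI[of _ \<mu>] exI[of _ 1] exI[of _ C] conjI) auto
qed

end
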